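(* Let $S\subset\mathbb{R}^2$ be a set of $n$ points in general position such that no line spanned by two points of $S$ is vertical, let $0\le k\le n-2$, let $G_k=(S,E_k)$ be the $k$-edge graph of $S$, and let $f\in\mathbb{R}[x_1,x_2]$ be a polynomial of degree $r$ such that all irreducible components of $Z(f)$ are non-singular and $S\cap Z(f)=\emptyset$. If the number of points of intersection of $Z(f)$ and $G_k$ is finite, then it is at most $13nr^2$.
   Context: A set of at least three points in the plane is in general position if no three of them are collinear. For a finite set $S$ of $n$ points in general position in the plane such that no line spanned by two points of $S$ is vertical, and $0\le k\le n-2$, $E_k$ is the set of line segments connecting two points $x,y\in S$ such that exactly $k$ points of $S$ lie in the open halfplane below the line $\operatorname{aff}(x,y)$; the geometric graph $G_k=(S,E_k)$ is the $k$-edge graph of $S$. The points of intersection of $Z(f)$ and $G_k$ are the points of $Z(f)$ lying on the union of the segments in $E_k$. $Z(f)=\{(x_1,x_2)\in\mathbb{R}^2: f(x_1,x_2)=0\}$. The irreducible components of $Z(f)$ are the curves $Z(f_i)$ for the irreducible factors $f_i$ of $f$ over $\mathbb{R}$; $Z(f_i)$ is non-singular if the gradient of $f_i$ does not vanish at any point of $Z(f_i)$. *)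

theory Defs
  imports "HOL-Analysis.Analysis" "HOL-Computational_Algebra.Computational_Algebra"
begin

type_synonym point = "real \<times> real"

(* R[x1,x2] is rendered as real poly poly = (R[x1])[x2]: the inner variable is x1, the outer
   variable is x2, so coeff (coeff f j) i is the coefficient of x1^i x2^j. The units of this ring
   are the nonzero constants, so the library notion irreducible is irreducibility over R. *)

definition eval2 :: "real poly poly \<Rightarrow> point \<Rightarrow> real" where
  "eval2 f p = poly (poly f [:snd p:]) (fst p)"

(* The 0 is inserted only to give the zero polynomial the value 0. *)
definition total_degree :: "real poly poly \<Rightarrow> nat" where
  "total_degree f = Max (insert 0 {i + j | i j. coeff (coeff f j) i \<noteq> 0})"

definition zero_set :: "real poly poly \<Rightarrow> point set" where
  "zero_set f = {p. eval2 f p = 0}"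

definition nonsingular :: "real poly poly \<Rightarrow> bool" where
  "nonsingular g \<longleftrightarrow> (\<forall>p \<in> zero_set g. \<not> (GDERIV (eval2 g) p :> 0))"

definition general_position :: "point set \<Rightarrow> bool" where
  "general_position S \<longleftrightarrow>
     (finite S \<longrightarrow> 3 \<le> card S) \<and> (\<forall>T \<subseteq> S. card T = 3 \<longrightarrow> \<not> collinear T)"

definition no_vertical_line :: "point set \<Rightarrow> bool" where
  "no_vertical_line S \<longleftrightarrow> (\<forall>x \<in> S. \<forall>y \<in> S. x \<noteq> y \<longrightarrow> fst x \<noteq> fst y)"

(* The open halfplane below the line aff(x,y); meaningful when that line is not vertical. *)
definition halfplane_below :: "point \<Rightarrow> point \<Rightarrow> point set" where
  "halfplane_below x y = {p. \<exists>q \<in> affine hull {x, y}. fst q = fst p \<and> snd p < snd q}"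

definition k_edges :: "point set \<Rightarrow> nat \<Rightarrow> point set set" where
  "k_edges S k = {closed_segment x y | x y.
     x \<in> S \<and> y \<in> S \<and> x \<noteq> y \<and> card (S \<inter> halfplane_below x y) = k}"

(* A geometric graph is a pair of its vertices and its edges, the edges being segments. *)
definition k_edge_graph :: "point set \<Rightarrow> nat \<Rightarrow> point set \<times> point set set" where
  "k_edge_graph S k = (S, k_edges S k)"

definition intersection_points ::
    "real poly poly \<Rightarrow> point set \<times> point set set \<Rightarrow> point set" where
  "intersection_points f G = zero_set f \<inter> \<Union> (snd G)"

end

theory Submission
  imports Defs "HOL-Computational_Algebra.Field_as_Ring"
begin

text \<open>It suffices to bound the intersections for one irreducible factor g of degree d. Sweeping a
  slope from minus to plus infinity, the k + 1 lowest points change exactly at the k-edges, each of which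
  moves one of them from its left to its right end; following the moving points decomposes the k-edges
  into k + 1 convex chains, and following the remaining n - k - 1 points decomposes them into n - k - 1
  concave chains. Removing from Z(g) its points with vertical tangent and its inflection points, at most
  4 d^2 by Bezout's inequality, leaves convex and concave arcs, and a convex arc meets a concave chain
  in at most two points unless they share a segment. An arc is determined by its right end, which is one
  of the removed points, a vertical asymptote or infinity, and this leaves at most 5 d^2 arcs of each
  kind. The total is 4 d^2 + 10 d^2 (k + 1) + 10 d^2 (n - k - 1).\<close>

section \<open>Total degree and Bezout's inequality\<close>

text \<open>The difficulty is to charge arcs to right ends without multiplicity. At a singular point
  many arcs could end; a nonzero gradient lets at most one arc of each convexity run into a removed
  point from the left. A vertical asymptote or infinity may be shared by as many arcs as
  \<open>g\<close> has degree in x2. Asymptotes, however, sit at roots of the leading coefficient in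
  x2, whose degree is at most \<open>d\<close> minus the degree in x2, so asymptotes and infinity
  together cost at most \<open>d^2\<close>; with the \<open>4 d^2\<close> removed points this is the
  \<open>5 d^2\<close>. Arcs are never enumerated: the intersection points on one chain are charged
  directly. On a straight curve the Hessian expression vanishes everywhere, so there only vertical
  tangents are removed; a curve of degree 0 in x2 consists of vertical lines and is counted
  separately. Finiteness of the intersection rules out a shared segment. Since
  \<open>n \<ge> 3\<close>, \<open>4 d^2 + 10 n d^2\<close> is at most \<open>13 n d^2\<close>, and
  the factors of \<open>f\<close> add up because squares are superadditive.\<close>

abbreviation coeff2 :: "real poly poly \<Rightarrow> nat \<Rightarrow> nat \<Rightarrow> real" where
  "coeff2 f i j \<equiv> coeff (coeff f j) i"

lemma eval2_0 [simp]: "eval2 0 p = 0"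
  and eval2_add: "eval2 (f + g) p = eval2 f p + eval2 g p"
  and eval2_diff: "eval2 (f - g) p = eval2 f p - eval2 g p"
  and eval2_mult: "eval2 (f * g) p = eval2 f p * eval2 g p"
  and eval2_power: "eval2 (f ^ m) p = eval2 f p ^ m"
  by (simp_all add: eval2_def poly_power)

lemma eval2_sum: "eval2 (sum W A) p = (\<Sum>a\<in>A. eval2 (W a) p)"
  by (induction A rule: infinite_finite_induct) (simp_all add: eval2_add)

lemma eval2_prod: "eval2 (prod W A) p = (\<Prod>a\<in>A. eval2 (W a) p)"
  by (induction A rule: infinite_finite_induct) (simp_all add: eval2_mult eval2_def)

lemma eval2_pCons: "eval2 (pCons a g) (x, y) = poly a x + y * eval2 g (x, y)"
  by (simp add: eval2_def)

lemma finite_total_degree_set: "finite {i + j | i j. coeff2 f i j \<noteq> 0}"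
proof -
  have "{i + j | i j. coeff2 f i j \<noteq> 0} \<subseteq> (\<lambda>(j, i). i + j) ` (SIGMA j:{..degree f}. {..degree (coeff f j)})"
  proof
    fix s
    assume "s \<in> {i + j | i j. coeff2 f i j \<noteq> 0}"
    then obtain i j where ij: "s = i + j" "coeff2 f i j \<noteq> 0"
      by blast
    then have "coeff f j \<noteq> 0"
      by auto
    with ij show "s \<in> (\<lambda>(j, i). i + j) ` (SIGMA j:{..degree f}. {..degree (coeff f j)})"
      by (intro image_eqI[of _ _ "(j, i)"]) (auto simp: le_degree)
  qed
  then show ?thesis
    by (rule finite_subset) auto
qed

lemma total_degree_le_iff: "total_degree f \<le> d \<longleftrightarrow> (\<forall>i j. coeff2 f i j \<noteq> 0 \<longrightarrow> i + j \<le> d)"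
  unfolding total_degree_def using finite_total_degree_set[of f]
  by (subst Max_le_iff) auto

lemma le_total_degree: "coeff2 f i j \<noteq> 0 \<Longrightarrow> i + j \<le> total_degree f"
  using total_degree_le_iff by blast

lemma total_degree_witness:
  assumes "f \<noteq> 0"
  obtains i j where "coeff2 f i j \<noteq> 0" "i + j = total_degree f"
proof -
  obtain a b where "coeff2 f a b \<noteq> 0"
    using assms by (metis coeff_0 poly_eqI)
  then have "Max (insert 0 {i + j | i j. coeff2 f i j \<noteq> 0}) \<in> {i + j | i j. coeff2 f i j \<noteq> 0}"
    using Max_in[OF finite_total_degree_set[of f]]
    by (subst Max_insert[OF finite_total_degree_set]) auto
  then show ?thesis
    using that by (auto simp: total_degree_def)
qed

text \<open>The exponent of the leading monomial in the order that compares total degrees first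
  and then the exponents of the outer variable.\<close>

definition lead_exp :: "real poly poly \<Rightarrow> nat \<Rightarrow> nat \<Rightarrow> bool" where
  "lead_exp f a b \<longleftrightarrow> coeff2 f a b \<noteq> 0 \<and> a + b = total_degree f \<and>
     (\<forall>i j. coeff2 f i j \<noteq> 0 \<longrightarrow> i + j = total_degree f \<longrightarrow> j \<le> b)"

lemma lead_exp_exists:
  assumes "f \<noteq> 0"
  obtains a b where "lead_exp f a b"
proof -
  define J where "J = {j. j \<le> total_degree f \<and> coeff2 f (total_degree f - j) j \<noteq> 0}"
  have fin: "finite J"
    by (simp add: J_def)
  obtain i j where "coeff2 f i j \<noteq> 0" "i + j = total_degree f"
    using total_degree_witness[OF assms] .
  moreover from this have "i = total_degree f - j"
    by simp
  ultimately have "j \<in> J"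
    by (auto simp: J_def)
  then have "Max J \<in> J"
    using fin Max_in by blast
  have "lead_exp f (total_degree f - Max J) (Max J)"
    unfolding lead_exp_def
  proof (intro conjI allI impI)
    fix i j
    assume "coeff2 f i j \<noteq> 0" "i + j = total_degree f"
    moreover from this have "i = total_degree f - j"
      by simp
    ultimately have "j \<in> J"
      by (auto simp: J_def)
    then show "j \<le> Max J"
      using fin by simp
  qed (use \<open>Max J \<in> J\<close> in \<open>auto simp: J_def\<close>)
  then show ?thesis
    using that by blast
qed

section \<open>Degrees and leading monomials of products\<close>

lemma coeff2_mult: "coeff2 (f * g) i j = (\<Sum>(j', i')\<in>{..j} \<times> {..i}. coeff2 f i' j' * coeff2 g (i - i') (j - j'))"
  by (simp add: coeff_mult coeff_sum sum.cartesian_product)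

lemma total_degree_mult_le: "total_degree (f * g) \<le> total_degree f + total_degree g"
  unfolding total_degree_le_iff
proof (intro allI impI)
  fix i j
  assume "coeff2 (f * g) i j \<noteq> 0"
  then obtain j' i' where "j' \<le> j" "i' \<le> i" "coeff2 f i' j' \<noteq> 0" "coeff2 g (i - i') (j - j') \<noteq> 0"
    unfolding coeff2_mult by (elim sum.not_neutral_contains_not_neutral) auto
  then show "i + j \<le> total_degree f + total_degree g"
    using le_total_degree[of f j' i'] le_total_degree[of g "j - j'" "i - i'"] by linarith
qed

lemma lead_exp_mult:
  assumes f: "lead_exp f a b" and g: "lead_exp g c d"
  shows "lead_exp (f * g) (a + c) (b + d)"
proof -
  \<comment> \<open>Two monomials whose product reaches the claimed total degree and x2-exponent
    must both be leading. This isolates the one nonzero summand of the coefficient and later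
    excludes a larger exponent of x2.\<close>
  have unique: "i' = a \<and> j' = b \<and> i'' = c \<and> j'' = d"
    if nz: "coeff2 f i' j' \<noteq> 0" "coeff2 g i'' j'' \<noteq> 0" and deg: "i' + i'' + (j' + j'') = a + c + (b + d)"
      and j: "b + d \<le> j' + j''" for i' j' i'' j''
  proof -
    have "i' + j' \<le> a + b" "i'' + j'' \<le> c + d"
      using nz f g le_total_degree unfolding lead_exp_def by metis+
    with deg have "i' + j' = a + b" "i'' + j'' = c + d"
      by linarith+
    moreover from this have "j' \<le> b" "j'' \<le> d"
      using nz f g unfolding lead_exp_def by metis+
    ultimately show ?thesis
      using j by linarith
  qed
  have "coeff2 (f * g) (a + c) (b + d) = (\<Sum>(j', i')\<in>{(b, a)}. coeff2 f i' j' * coeff2 g (a + c - i') (b + d - j'))"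
    unfolding coeff2_mult
  proof (rule sum.mono_neutral_right)
    show "\<forall>x\<in>{..b + d} \<times> {..a + c} - {(b, a)}.
        (case x of (j', i') \<Rightarrow> coeff2 f i' j' * coeff2 g (a + c - i') (b + d - j')) = 0"
      using unique by fastforce
  qed auto
  then have nz: "coeff2 (f * g) (a + c) (b + d) \<noteq> 0"
    using f g by (simp add: lead_exp_def)
  have deg: "a + c + (b + d) = total_degree (f * g)"
    using le_total_degree[OF nz] total_degree_mult_le[of f g] f g by (simp add: lead_exp_def)
  show ?thesis
    unfolding lead_exp_def
  proof (intro conjI allI impI)
    fix i j
    assume ij: "coeff2 (f * g) i j \<noteq> 0" "i + j = total_degree (f * g)"
    then obtain j' i' where *: "j' \<le> j" "i' \<le> i" "coeff2 f i' j' \<noteq> 0" "coeff2 g (i - i') (j - j') \<noteq> 0"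
      unfolding coeff2_mult by (elim sum.not_neutral_contains_not_neutral) auto
    show "j \<le> b + d"
    proof (rule ccontr)
      assume "\<not> j \<le> b + d"
      then show False
        using unique[OF *(3,4)] * ij deg by auto
    qed
  qed (use nz deg in auto)
qed

lemma total_degree_mult:
  assumes "f \<noteq> 0" "g \<noteq> 0"
  shows "total_degree (f * g) = total_degree f + total_degree g"
proof -
  obtain a b c d where "lead_exp f a b" "lead_exp g c d"
    using lead_exp_exists assms by metis
  then show ?thesis
    using lead_exp_mult[of f a b g c d] by (simp add: lead_exp_def)
qed

text \<open>Gaussian elimination: a pivot unknown \<open>a0\<close> is solved from equation
  \<open>b\<close>, and the induction hypothesis is applied to the other equations after
  substituting it.\<close>

lemma homogeneous_system_nontrivial:
  fixes M :: "'a \<Rightarrow> 'b \<Rightarrow> real"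
  assumes "finite B" "finite A" "card B < card A"
  shows "\<exists>c. (\<exists>a\<in>A. c a \<noteq> 0) \<and> (\<forall>b\<in>B. (\<Sum>a\<in>A. c a * M a b) = 0)"
  using assms
proof (induction B arbitrary: A M rule: finite_induct)
  case empty
  then show ?case
    by (intro exI[of _ "\<lambda>_. 1"]) (auto simp: card_gt_0_iff)
next
  case (insert b B)
  show ?case
  proof (cases "\<forall>a\<in>A. M a b = 0")
    case True
    have "card B < card A"
      using insert by simp
    from insert.IH[OF insert.prems(1) this, of M] True show ?thesis
      by auto
  next
    case False
    then obtain a0 where a0: "a0 \<in> A" "M a0 b \<noteq> 0"
      by blast
    define A' where "A' = A - {a0}"
    have A: "A = insert a0 A'" "a0 \<notin> A'" and fin: "finite A'" "card B < card A'"
      using insert a0 by (auto simp: A'_def)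
    obtain c where c: "\<exists>a\<in>A'. c a \<noteq> 0"
      "\<And>b'. b' \<in> B \<Longrightarrow> (\<Sum>a\<in>A'. c a * (M a b' - M a b / M a0 b * M a0 b')) = 0"
      using insert.IH[OF fin, of "\<lambda>a b'. M a b' - M a b / M a0 b * M a0 b'"] by blast
    define c' where "c' = c(a0 := - (\<Sum>a\<in>A'. c a * M a b) / M a0 b)"
    have eq: "(\<Sum>a\<in>A. c' a * M a b') = (\<Sum>a\<in>A'. c a * (M a b' - M a b / M a0 b * M a0 b'))" for b'
    proof -
      have "(\<Sum>a\<in>A'. c' a * M a b') = (\<Sum>a\<in>A'. c a * M a b')"
        using A(2) by (intro sum.cong) (auto simp: c'_def)
      then have "(\<Sum>a\<in>A. c' a * M a b') = c' a0 * M a0 b' + (\<Sum>a\<in>A'. c a * M a b')"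
        using A fin by simp
      also have "c' a0 * M a0 b' = - (\<Sum>a\<in>A'. c a * M a b / M a0 b * M a0 b')"
        by (simp add: c'_def sum_distrib_right sum_divide_distrib sum_negf)
      finally show ?thesis
        by (simp add: algebra_simps sum_subtractf)
    qed
    have "(\<Sum>a\<in>A. c' a * M a b) = 0"
      unfolding eq using a0 by simp
    then have "\<forall>b'\<in>insert b B. (\<Sum>a\<in>A. c' a * M a b') = 0"
      using c(2) eq by auto
    moreover have "\<exists>a\<in>A. c' a \<noteq> 0"
      using c(1) A by (auto simp: c'_def)
    ultimately show ?thesis
      by blast
  qed
qed

text \<open>The exponents of the monomials of total degree at most \<open>m\<close>, so
  \<open>card (triangle m)\<close> is the dimension of the space of polynomials of that
  degree.\<close>

definition triangle :: "nat \<Rightarrow> (nat \<times> nat) set" where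
  "triangle m = {(i, j). i + j \<le> m}"

lemma finite_triangle: "finite (triangle m)"
  by (rule finite_subset[of _ "{..m} \<times> {..m}"]) (auto simp: triangle_def)

lemma card_triangle: "2 * card (triangle m) = (m + 1) * (m + 2)"
proof (induction m)
  case 0
  have "triangle 0 = {(0, 0)}"
    by (auto simp: triangle_def)
  then show ?case
    by simp
next
  case (Suc m)
  have "triangle (Suc m) = triangle m \<union> (\<lambda>i. (i, Suc m - i)) ` {..Suc m}"
    by (auto simp: triangle_def image_iff)
  moreover have "card ((\<lambda>i. (i, Suc m - i)) ` {..Suc m}) = m + 2"
    by (subst card_image) (auto simp: inj_on_def)
  moreover have "triangle m \<inter> (\<lambda>i. (i, Suc m - i)) ` {..Suc m} = {}"
    by (auto simp: triangle_def)
  ultimately have "card (triangle (Suc m)) = card (triangle m) + (m + 2)"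
    using finite_triangle[of m] by (simp only: card_Un_disjoint finite_imageI finite_atMost)
  then show ?case
    using Suc by (simp add: algebra_simps)
qed

text \<open>The excluded exponents are a smaller triangle shifted by \<open>(a, b)\<close>. The
  remaining monomials span a complement to the multiples of a polynomial with leading exponents
  \<open>(a, b)\<close>.\<close>

lemma card_triangle_without_multiples:
  assumes "a + b \<le> m"
  shows "card {(i, j) \<in> triangle m. \<not> (a \<le> i \<and> b \<le> j)} + card (triangle (m - (a + b))) = card (triangle m)"
proof -
  have "{(i, j) \<in> triangle m. a \<le> i \<and> b \<le> j} = (\<lambda>(i, j). (i + a, j + b)) ` triangle (m - (a + b))"
  proof (intro equalityI subsetI)
    fix x
    assume "x \<in> {(i, j) \<in> triangle m. a \<le> i \<and> b \<le> j}"
    then have "x = (\<lambda>(i, j). (i + a, j + b)) (fst x - a, snd x - b)"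
      "(fst x - a, snd x - b) \<in> triangle (m - (a + b))"
      by (auto simp: triangle_def)
    then show "x \<in> (\<lambda>(i, j). (i + a, j + b)) ` triangle (m - (a + b))"
      by (rule image_eqI)
  qed (use assms in \<open>auto simp: triangle_def\<close>)
  then have "card {(i, j) \<in> triangle m. a \<le> i \<and> b \<le> j} = card (triangle (m - (a + b)))"
    by (simp only:) (subst card_image, auto simp: inj_on_def)
  moreover have "triangle m = {(i, j) \<in> triangle m. \<not> (a \<le> i \<and> b \<le> j)} \<union> {(i, j) \<in> triangle m. a \<le> i \<and> b \<le> j}"
    by auto
  then have "card (triangle m) =
      card ({(i, j) \<in> triangle m. \<not> (a \<le> i \<and> b \<le> j)} \<union> {(i, j) \<in> triangle m. a \<le> i \<and> b \<le> j})"
    by (rule arg_cong)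
  then have "card (triangle m) =
      card {(i, j) \<in> triangle m. \<not> (a \<le> i \<and> b \<le> j)} + card {(i, j) \<in> triangle m. a \<le> i \<and> b \<le> j}"
    by (subst (asm) card_Un_disjoint) (auto intro: finite_subset[OF _ finite_triangle[of m]])
  ultimately show ?thesis
    by simp
qed

text \<open>A linear relation is a homogeneous system with one equation per monomial of degree at
  most \<open>N\<close>, and there are more unknowns than equations.\<close>

lemma polys_linearly_dependent:
  fixes W :: "'a \<Rightarrow> real poly poly"
  assumes "finite A" "\<And>a. a \<in> A \<Longrightarrow> total_degree (W a) \<le> N" "card (triangle N) < card A"
  obtains c where "\<exists>a\<in>A. c a \<noteq> 0" "(\<Sum>a\<in>A. smult [:c a:] (W a)) = 0"
proof -
  obtain c where c: "\<exists>a\<in>A. c a \<noteq> 0" "\<And>i j. (i, j) \<in> triangle N \<Longrightarrow> (\<Sum>a\<in>A. c a * coeff2 (W a) i j) = 0"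
    using homogeneous_system_nontrivial[OF finite_triangle assms(1,3), of "\<lambda>a (i, j). coeff2 (W a) i j"] by fastforce
  have "(\<Sum>a\<in>A. smult [:c a:] (W a)) = 0"
  proof (intro poly_eqI)
    fix i j
    have "coeff2 (\<Sum>a\<in>A. smult [:c a:] (W a)) i j = (\<Sum>a\<in>A. c a * coeff2 (W a) i j)"
      by (simp add: coeff_sum)
    also have "\<dots> = 0"
    proof (cases "i + j \<le> N")
      case False
      then have "coeff2 (W a) i j = 0" if "a \<in> A" for a
        using assms(2)[OF that] le_total_degree order_trans by blast
      then show ?thesis
        by simp
    qed (use c in \<open>auto simp: triangle_def\<close>)
    finally show "coeff2 (\<Sum>a\<in>A. smult [:c a:] (W a)) i j = coeff2 0 i j"
      by simp
  qed
  with c(1) that show ?thesis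
    by blast
qed

text \<open>A product of one line through each other point: vertical if the abscissa differs from
  that of \<open>P\<close>, horizontal if it is the same, so that no factor vanishes at
  \<open>P\<close>.\<close>

lemma interpolation_poly:
  assumes "finite F" "P \<in> F"
  obtains l where "total_degree l \<le> card F" "eval2 l P \<noteq> 0" "\<And>P'. P' \<in> F - {P} \<Longrightarrow> eval2 l P' = 0"
proof -
  define h :: "point \<Rightarrow> real poly poly" where
    "h P' = (if fst P' = fst P then [:[:- snd P':], 1:] else [:[:- fst P', 1:]:])" for P'
  have eval: "eval2 (h P') p = (if fst P' = fst P then snd p - snd P' else fst p - fst P')" for P' p
    by (simp add: h_def eval2_def)
  have deg: "total_degree (h P') \<le> 1" for P'
    unfolding total_degree_le_iff by (auto simp: h_def coeff_pCons split: nat.splits if_splits)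
  have "total_degree (prod h A) \<le> card A" if "finite A" for A
    using that
  proof (induction A rule: finite_induct)
    case empty
    have "total_degree 1 \<le> 0"
      unfolding total_degree_le_iff by auto
    then show ?case
      by simp
  next
    case (insert x A)
    have "total_degree (h x * prod h A) \<le> Suc (card A)"
      using total_degree_mult_le[of "h x" "prod h A"] deg[of x] insert by simp
    then show ?case
      using insert by simp
  qed
  then have "total_degree (prod h (F - {P})) \<le> card F"
    using assms by (meson card_Diff1_le finite_Diff order_trans)
  moreover have "eval2 (prod h (F - {P})) P \<noteq> 0"
    using assms by (auto simp: eval2_prod eval prod_eq_iff)
  moreover have "eval2 (prod h (F - {P})) P' = 0" if "P' \<in> F - {P}" for P'
    using assms that by (auto simp: eval2_prod eval intro!: prod_zero bexI[of _ P'])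
  ultimately show ?thesis
    using that by blast
qed

lemma coeff2_sum_monoms:
  assumes "finite T"
  shows "coeff2 (\<Sum>(i, j)\<in>T. smult [:c (i, j):] (monom (monom 1 i) j)) a b = (if (a, b) \<in> T then c (a, b) else 0)"
proof -
  have "coeff2 (\<Sum>(i, j)\<in>T. smult [:c (i, j):] (monom (monom 1 i) j)) a b = (\<Sum>x\<in>T. if (a, b) = x then c x else 0)"
    unfolding coeff_sum by (intro sum.cong) (auto simp: coeff_monom split: if_splits)
  then show ?thesis
    using assms by simp
qed

lemma total_degree_monom_le: "total_degree (monom (monom 1 i) j) \<le> i + j"
  unfolding total_degree_le_iff by (auto simp: coeff_monom split: if_splits)

text \<open>The combinations u g + v q + l with deg (u g), deg (v q) at most N, no monomial of v divisible by
  the leading monomial of g, and l in the span of the interpolation polynomials of F, have only trivial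
  relations; comparing dimensions gives the bound.\<close>

theorem bezout_inequality:
  fixes g q :: "real poly poly"
  assumes g: "irreducible g" and ndvd: "\<not> g dvd q"
    and F: "finite F" "F \<subseteq> zero_set g \<inter> zero_set q"
  shows "card F \<le> total_degree g * total_degree q"
proof (rule ccontr)
  assume less: "\<not> ?thesis"
  \<comment> \<open>Any large \<open>N\<close> would do for the dimension count; this one makes
    \<open>N - a - b = card F\<close>.\<close>
  define a b N where "a = total_degree g" and "b = total_degree q" and "N = total_degree g + total_degree q + card F"
  have prime: "prime_elem g"
    using g by (rule irreducible_imp_prime_elem)
  then have "g \<noteq> 0"
    by auto
  then obtain i0 j0 where lead: "lead_exp g i0 j0"
    using lead_exp_exists by blast
  then have ij0: "i0 + j0 = a"
    by (simp add: lead_exp_def a_def)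
  have "\<exists>l. \<forall>P\<in>F. total_degree (l P) \<le> card F \<and> eval2 (l P) P \<noteq> 0 \<and> (\<forall>P'\<in>F - {P}. eval2 (l P) P' = 0)"
    by (rule bchoice) (meson F(1) interpolation_poly)
  then obtain l where l: "\<And>P. P \<in> F \<Longrightarrow> total_degree (l P) \<le> card F" "\<And>P. P \<in> F \<Longrightarrow> eval2 (l P) P \<noteq> 0"
    "\<And>P P'. P \<in> F \<Longrightarrow> P' \<in> F - {P} \<Longrightarrow> eval2 (l P) P' = 0"
    by blast
  define U V where "U = triangle (N - a)" and "V = {(i, j) \<in> triangle (N - b). \<not> (i0 \<le> i \<and> j0 \<le> j)}"
  \<comment> \<open>A disjoint sum, so that a polynomial occurring in several families is counted
    once for each of them.\<close>
  define A where "A = U <+> V <+> F"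
  have fin: "finite U" "finite V"
    unfolding U_def V_def by (auto intro: finite_triangle finite_subset[OF _ finite_triangle[of "N - b"]])
  then have finA: "finite A"
    using F(1) by (simp add: A_def)
  define mon :: "nat \<times> nat \<Rightarrow> real poly poly" where "mon = (\<lambda>(i, j). monom (monom 1 i) j)"
  define W where "W = case_sum (\<lambda>m. mon m * g) (case_sum (\<lambda>m. mon m * q) l)"
  have mon_le: "total_degree (mon m) \<le> d" if "m \<in> triangle d" for m d
    using that order_trans[OF total_degree_monom_le] by (auto simp: mon_def triangle_def)
  have "total_degree (W x) \<le> N" if x: "x \<in> A" for x
  proof -
    have "total_degree (mon m * g) \<le> N" if "m \<in> U" for m
      using total_degree_mult_le[of "mon m" g] mon_le[of m "N - a"] that by (simp add: U_def N_def a_def)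
    moreover have "total_degree (mon m * q) \<le> N" if "m \<in> V" for m
      using total_degree_mult_le[of "mon m" q] mon_le[of m "N - b"] that by (auto simp: V_def N_def b_def)
    moreover have "total_degree (l P) \<le> N" if "P \<in> F" for P
      using l(1)[OF that] by (simp add: N_def)
    ultimately show ?thesis
      using x by (auto simp: A_def W_def)
  qed
  \<comment> \<open>With T(m) for \<open>card (triangle m)\<close>, the family has T(N - a) + T(N -
    b) - T(N - a - b) + \<open>card F\<close> members, while T(N) = T(N - a) + T(N - b) - T(N - a -
    b) + a b. Hence more than a b common zeros force a relation.\<close>
  moreover have "card (triangle N) < card A"
  proof -
    have cV: "card V + card (triangle (N - b - a)) = card (triangle (N - b))"
      using card_triangle_without_multiples[of i0 j0 "N - b"] ij0 unfolding V_def a_def b_def N_def by simp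
    have "2 * card A = 2 * card U + 2 * card V + 2 * card F"
      using fin F(1) by (simp add: A_def card_Plus)
    moreover have "N - b - a = card F" "N - a = b + card F" "N - b = a + card F"
      by (auto simp: N_def a_def b_def)
    ultimately have "2 * card A + (card F + 1) * (card F + 2) =
        (b + card F + 1) * (b + card F + 2) + (a + card F + 1) * (a + card F + 2) + 2 * card F"
      using cV card_triangle[of "card F"] card_triangle[of "b + card F"] card_triangle[of "a + card F"]
      unfolding U_def by simp
    moreover have "2 * card (triangle N) = (a + b + card F + 1) * (a + b + card F + 2)"
      using card_triangle[of N] by (simp add: N_def a_def b_def)
    moreover have "a * b < card F"
      using less by (simp add: a_def b_def)
    ultimately show ?thesis
      by (simp add: algebra_simps)
  qed
  ultimately obtain c where c: "\<exists>x\<in>A. c x \<noteq> 0" "(\<Sum>x\<in>A. smult [:c x:] (W x)) = 0"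
    using polys_linearly_dependent[OF finA] by blast
  define u v where "u = (\<Sum>m\<in>U. smult [:c (Inl m):] (mon m))" and "v = (\<Sum>m\<in>V. smult [:c (Inr (Inl m)):] (mon m))"
  have "(\<Sum>x\<in>A. smult [:c x:] (W x)) = u * g + v * q + (\<Sum>P\<in>F. smult [:c (Inr (Inr P)):] (l P))"
    unfolding A_def using fin F(1)
    by (simp add: sum.Plus u_def v_def W_def sum_distrib_right o_def)
  with c(2) have rel: "u * g + v * q + (\<Sum>P\<in>F. smult [:c (Inr (Inr P)):] (l P)) = 0"
    by simp
  \<comment> \<open>At a point of \<open>F\<close> both \<open>g\<close> and \<open>q\<close>
    vanish, and so do all interpolation polynomials but its own.\<close>
  have c0F: "c (Inr (Inr P)) = 0" if P: "P \<in> F" for P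
  proof -
    have "eval2 g P = 0" "eval2 q P = 0"
      using F(2) P by (auto simp: zero_set_def)
    then have "0 = (\<Sum>P'\<in>F. c (Inr (Inr P')) * eval2 (l P') P)"
      using arg_cong[OF rel, of "\<lambda>h. eval2 h P"] by (simp add: eval2_add eval2_mult eval2_sum) (simp add: eval2_def)
    also have "\<dots> = (\<Sum>P'\<in>{P}. c (Inr (Inr P')) * eval2 (l P') P)"
    proof (rule sum.mono_neutral_right)
      have "eval2 (l P') P = 0" if "P' \<in> F - {P}" for P'
        using l(3)[of P' P] that P by blast
      then show "\<forall>P'\<in>F - {P}. c (Inr (Inr P')) * eval2 (l P') P = 0"
        by simp
    qed (use F(1) P in auto)
    finally show ?thesis
      using l(2)[OF P] by simp
  qed
  then have rel: "u * g + v * q = 0"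
    using rel by simp
  then have "g dvd v * q"
    by (metis add_eq_0_iff dvd_minus_iff dvd_triv_right)
  then have "g dvd v"
    using prime ndvd prime_elem_dvd_mult_iff by blast
  have coeff2_v: "coeff2 v i j = (if (i, j) \<in> V then c (Inr (Inl (i, j))) else 0)" for i j
    unfolding v_def using coeff2_sum_monoms[OF fin(2), of "\<lambda>m. c (Inr (Inl m))" j i] by (simp add: mon_def case_prod_unfold)
  have coeff2_u: "coeff2 u i j = (if (i, j) \<in> U then c (Inl (i, j)) else 0)" for i j
    unfolding u_def using coeff2_sum_monoms[OF fin(1), of "\<lambda>m. c (Inl m)" j i] by (simp add: mon_def case_prod_unfold)
  \<comment> \<open>A nonzero multiple of \<open>g\<close> contains a monomial divisible by the
    leading monomial of \<open>g\<close>, and \<open>V\<close> omits all of these.\<close>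
  have "v = 0"
  proof (rule ccontr)
    assume "v \<noteq> 0"
    with \<open>g dvd v\<close> obtain w where w: "v = g * w" "w \<noteq> 0"
      by auto
    obtain i1 j1 where "lead_exp w i1 j1"
      using lead_exp_exists w(2) by blast
    then have "coeff2 v (i0 + i1) (j0 + j1) \<noteq> 0"
      using lead_exp_mult[OF lead] w(1) by (simp add: lead_exp_def)
    then show False
      unfolding coeff2_v by (auto simp: V_def split: if_splits)
  qed
  with rel \<open>g \<noteq> 0\<close> have "u = 0"
    by simp
  have "c x = 0" if "x \<in> A" for x
    using that c0F coeff2_u coeff2_v \<open>u = 0\<close> \<open>v = 0\<close> unfolding A_def by (auto split: if_splits) (metis coeff_0)+
  with c(1) show False
    by blast
qed

section \<open>Zeros of a polynomial near a point\<close>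

text \<open>The partial derivative in x1, which is the inner variable; \<open>pderiv\<close> acts on
  the outer variable and is the partial derivative in x2.\<close>

definition dx :: "real poly poly \<Rightarrow> real poly poly" where
  "dx g = map_poly pderiv g"

lemma dx_pCons: "dx (pCons a g) = pCons (pderiv a) (dx g)"
  by (simp add: dx_def map_poly_pCons)

lemma coeff2_dx: "coeff2 (dx g) i j = of_nat (Suc i) * coeff2 g (Suc i) j"
  by (simp add: dx_def coeff_map_poly coeff_pderiv)

lemma coeff2_pderiv: "coeff2 (pderiv g) i j = of_nat (Suc j) * coeff2 g i (Suc j)"
proof -
  have "of_nat (Suc j) * coeff g (Suc j) = smult (of_nat (Suc j)) (coeff g (Suc j))"
    by (simp only: of_nat_poly mult_pCons_left mult_zero_left) simp
  then show ?thesis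
    by (simp add: coeff_pderiv)
qed

lemma dx_pderiv_commute: "dx (pderiv g) = pderiv (dx g)"
  by (intro poly_eqI) (simp add: coeff2_dx coeff2_pderiv del: of_nat_Suc)

lemma total_degree_dx_le: "total_degree (dx g) \<le> total_degree g"
  unfolding total_degree_le_iff coeff2_dx using le_total_degree[of g] by fastforce

lemma total_degree_pderiv_le: "total_degree (pderiv g) \<le> total_degree g"
  unfolding total_degree_le_iff coeff2_pderiv using le_total_degree[of g] by fastforce

lemma eval2_has_derivative:
  "(eval2 g has_derivative (\<lambda>h. eval2 (dx g) p * fst h + eval2 (pderiv g) p * snd h)) (at p)"
proof (induction g)
  case 0
  have "eval2 0 = (\<lambda>_. 0)"
    by auto
  then show ?case
    by (simp add: dx_def)
next
  case (pCons a g)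
  have eq: "eval2 (pCons b h) = (\<lambda>p. poly b (fst p) + snd p * eval2 h p)" for b h
    by (auto simp: eval2_def)
  have "((\<lambda>p. poly a (fst p)) has_derivative (\<lambda>h. poly (pderiv a) (fst p) * fst h)) (at p)"
    using has_derivative_compose[OF has_derivative_fst[OF has_derivative_ident]
        poly_DERIV[of a "fst p", unfolded has_field_derivative_def]] by simp
  from has_derivative_add[OF this has_derivative_mult[OF has_derivative_snd[OF has_derivative_ident] pCons.IH]]
  show ?case
    unfolding eq dx_pCons pderiv_pCons eval2_add by (simp add: algebra_simps eq)
qed

lemma continuous_on_eval2 [continuous_intros]: "continuous_on S (eval2 g)"
  by (meson continuous_at_imp_continuous_on eval2_has_derivative has_derivative_continuous)

lemma continuous_on_eval2_comp [continuous_intros]: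
  assumes "continuous_on S y"
  shows "continuous_on S (\<lambda>x. eval2 g (x, y x))"
  using continuous_on_compose2[OF continuous_on_eval2[of UNIV g], of S "\<lambda>x. (x, y x)"] assms
  by (simp add: continuous_intros)

lemma tendsto_eval2:
  assumes "(u \<longlongrightarrow> x) F" "(v \<longlongrightarrow> y) F"
  shows "((\<lambda>t. eval2 g (u t, v t)) \<longlongrightarrow> eval2 g (x, y)) F"
proof (rule isCont_tendsto_compose[OF _ tendsto_Pair[OF assms]])
  show "isCont (eval2 g) (x, y)"
    using continuous_on_eval2[of UNIV g] by (simp add: continuous_on_eq_continuous_at)
qed

lemma eval2_chain:
  assumes "(u has_real_derivative u') (at t)" "(v has_real_derivative v') (at t)"
  shows "((\<lambda>t. eval2 g (u t, v t)) has_real_derivative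
    eval2 (dx g) (u t, v t) * u' + eval2 (pderiv g) (u t, v t) * v') (at t)"
proof -
  have "((\<lambda>t. (u t, v t)) has_derivative (\<lambda>h. (u' * h, v' * h))) (at t)"
    using assms unfolding has_field_derivative_def by (intro has_derivative_Pair) auto
  from has_derivative_compose[OF this eval2_has_derivative[of g "(u t, v t)"]]
  show ?thesis
    unfolding has_field_derivative_def by (rule has_derivative_eq_rhs) (auto simp: algebra_simps)
qed

lemma nonsingular_gradient:
  assumes "nonsingular g" "eval2 g p = 0"
  shows "eval2 (dx g) p \<noteq> 0 \<or> eval2 (pderiv g) p \<noteq> 0"
proof (rule ccontr)
  assume "\<not> ?thesis"
  then have "(eval2 g has_derivative (\<lambda>h. 0)) (at p)"
    using eval2_has_derivative[of g p] by simp
  then have "GDERIV (eval2 g) p :> 0"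
    by (simp add: gderiv_def)
  with assms show False
    unfolding nonsingular_def zero_set_def by blast
qed

text \<open>Caratheodory's form of differentiability. Its continuous factors \<open>A\<close> and
  \<open>B\<close> make it possible to differentiate an implicitly defined function that is only
  known to be continuous.\<close>

lemma eval2_increment:
  "\<exists>A B. isCont A p \<and> isCont B p \<and> A p = eval2 (dx g) p \<and> B p = eval2 (pderiv g) p \<and>
     (\<forall>q. eval2 g q - eval2 g p = (fst q - fst p) * A q + (snd q - snd p) * B q)"
proof (induction g)
  case 0
  show ?case
    by (intro exI[of _ "\<lambda>_. 0"]) (simp add: dx_def)
next
  case (pCons a g)
  have eq: "eval2 (pCons b h) = (\<lambda>p. poly b (fst p) + snd p * eval2 h p)" for b h
    by (auto simp: eval2_def)
  from pCons obtain A B where AB: "isCont A p" "isCont B p" "A p = eval2 (dx g) p" "B p = eval2 (pderiv g) p"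
    "\<And>q. eval2 g q - eval2 g p = (fst q - fst p) * A q + (snd q - snd p) * B q"
    by blast
  obtain C where C: "\<And>z. poly a z - poly a (fst p) = C z * (z - fst p)" "isCont C (fst p)" "C (fst p) = poly (pderiv a) (fst p)"
    using poly_DERIV[of a "fst p"] unfolding CARAT_DERIV by blast
  have "isCont (\<lambda>q. C (fst q)) p"
    using isCont_o2[OF continuous_fst[OF continuous_ident], of p C] C(2) by simp
  then have "isCont (\<lambda>q. C (fst q) + snd q * A q) p" "isCont (\<lambda>q. snd q * B q + eval2 g p) p"
    using AB by (auto intro!: continuous_intros)
  moreover have "eval2 (pCons a g) q - eval2 (pCons a g) p =
      (fst q - fst p) * (C (fst q) + snd q * A q) + (snd q - snd p) * (snd q * B q + eval2 g p)" for q
  proof -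
    have "poly a (fst q) = poly a (fst p) + C (fst q) * (fst q - fst p)"
      "eval2 g q = eval2 g p + ((fst q - fst p) * A q + (snd q - snd p) * B q)"
      using C(1)[of "fst q"] AB(5)[of q] by linarith+
    note this[THEN eq_reflection]
    then show ?thesis
      unfolding eq by (simp only:) (simp add: algebra_simps)
  qed
  ultimately show ?case
    using C(3) AB(3,4)
    by (intro exI[of _ "\<lambda>q. C (fst q) + snd q * A q"] exI[of _ "\<lambda>q. snd q * B q + eval2 g p"])
      (simp add: eq dx_pCons pderiv_pCons eval2_add)
qed

lemma open_eval2_ne: "open {p. eval2 g p \<noteq> 0}"
  using continuous_on_eval2[of UNIV g] by (intro open_Collect_neq) auto

lemma convex_vertical:
  assumes "convex U" "(x, v) \<in> U" "(x, w) \<in> U" "v \<le> t" "t \<le> w"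
  shows "(x, t) \<in> (U :: point set)"
proof -
  have "(x, t) \<in> closed_segment (x, v) (x, w)"
    using assms by (simp add: closed_segment_same_fst closed_segment_eq_real_ivl1)
  then show ?thesis
    using assms convex_contains_segment by blast
qed

lemma convex_horizontal:
  assumes "convex U" "(v, y) \<in> U" "(w, y) \<in> U" "v \<le> t" "t \<le> w"
  shows "(t, y) \<in> (U :: point set)"
proof -
  have "(t, y) \<in> closed_segment (v, y) (w, y)"
    using assms by (simp add: closed_segment_same_snd closed_segment_eq_real_ivl1)
  then show ?thesis
    using assms convex_contains_segment by blast
qed

text \<open>The uniqueness half of the implicit function theorem: in a ball on which the
  x2-derivative has no zero, Rolle's theorem forbids two zeros on a vertical line.\<close>

lemma zeros_unique_vertically:
  assumes "eval2 (pderiv g) p \<noteq> 0"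
  obtains U where "open U" "p \<in> U" "\<And>x v w. \<lbrakk>(x, v) \<in> U; (x, w) \<in> U; eval2 g (x, v) = 0; eval2 g (x, w) = 0\<rbrakk> \<Longrightarrow> v = w"
proof -
  obtain e where e: "e > 0" "ball p e \<subseteq> {p. eval2 (pderiv g) p \<noteq> 0}"
    using assms open_eval2_ne[of "pderiv g"] open_contains_ball by blast
  have "\<not> v < w" if vw: "(x, v) \<in> ball p e" "(x, w) \<in> ball p e" "eval2 g (x, v) = 0" "eval2 g (x, w) = 0" for x v w
  proof
    assume "v < w"
    have der: "((\<lambda>t. eval2 g (x, t)) has_real_derivative eval2 (pderiv g) (x, t)) (at t)" for t
      using eval2_chain[of "\<lambda>_. x" 0 t "\<lambda>t. t" 1 g] by simp
    then obtain t where "v < t" "t < w" "eval2 (pderiv g) (x, t) = 0"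
      using MVT2[OF \<open>v < w\<close> der] vw by auto
    moreover from this have "(x, t) \<in> ball p e"
      using convex_vertical[OF convex_ball vw(1,2)] by simp
    ultimately show False
      using e by blast
  qed
  then show ?thesis
    using e(1) by (intro that[of "ball p e"]) (simp, simp, metis linorder_neqE_linordered_idom)
qed

text \<open>The same with the coordinates exchanged, for points at which the tangent is
  vertical.\<close>

lemma zeros_unique_horizontally:
  assumes "eval2 (dx g) p \<noteq> 0"
  obtains U where "open U" "p \<in> U" "\<And>y v w. \<lbrakk>(v, y) \<in> U; (w, y) \<in> U; eval2 g (v, y) = 0; eval2 g (w, y) = 0\<rbrakk> \<Longrightarrow> v = w"
proof -
  obtain e where e: "e > 0" "ball p e \<subseteq> {p. eval2 (dx g) p \<noteq> 0}"
    using assms open_eval2_ne[of "dx g"] open_contains_ball by blast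
  have "\<not> v < w" if vw: "(v, y) \<in> ball p e" "(w, y) \<in> ball p e" "eval2 g (v, y) = 0" "eval2 g (w, y) = 0" for y v w
  proof
    assume "v < w"
    have der: "((\<lambda>t. eval2 g (t, y)) has_real_derivative eval2 (dx g) (t, y)) (at t)" for t
      using eval2_chain[of "\<lambda>t. t" 1 t "\<lambda>_. y" 0 g] by simp
    then obtain t where "v < t" "t < w" "eval2 (dx g) (t, y) = 0"
      using MVT2[OF \<open>v < w\<close> der] vw by auto
    moreover from this have "(t, y) \<in> ball p e"
      using convex_horizontal[OF convex_ball vw(1,2)] by simp
    ultimately show False
      using e by blast
  qed
  then show ?thesis
    using e(1) by (intro that[of "ball p e"]) (simp, simp, metis linorder_neqE_linordered_idom)
qed

text \<open>The existence half of the implicit function theorem: \<open>g\<close> has opposite signs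
  slightly above and below the zero, the signs persist for nearby abscissas, and the intermediate
  value theorem applies.\<close>

lemma zero_persists:
  assumes zero: "eval2 g (x0, y0) = 0" and dy: "eval2 (pderiv g) (x0, y0) \<noteq> 0" and "e > 0"
  shows "\<exists>d>0. \<forall>x. \<bar>x - x0\<bar> < d \<longrightarrow> (\<exists>v. \<bar>v - y0\<bar> < e \<and> eval2 g (x, v) = 0)"
proof -
  \<comment> \<open>Multiplying by \<open>c\<close> makes the function increasing at
    \<open>y0\<close> whatever the sign of the derivative.\<close>
  define c where "c = eval2 (pderiv g) (x0, y0)"
  have der: "((\<lambda>t. c * eval2 g (x0, t)) has_real_derivative c * eval2 (pderiv g) (x0, t)) (at t)" for t
    using DERIV_cmult[OF eval2_chain[of "\<lambda>_. x0" 0 t "\<lambda>t. t" 1 g]] by simp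
  have "c * eval2 (pderiv g) (x0, y0) > 0"
    using dy by (simp add: c_def zero_less_mult_iff) linarith
  then obtain d1 where d1: "d1 > 0" "\<And>h. 0 < h \<Longrightarrow> h < d1 \<Longrightarrow> c * eval2 g (x0, y0) < c * eval2 g (x0, y0 + h)"
    using DERIV_pos_inc_right[OF der] by blast
  from \<open>c * eval2 (pderiv g) (x0, y0) > 0\<close>
  obtain d2 where d2: "d2 > 0" "\<And>h. 0 < h \<Longrightarrow> h < d2 \<Longrightarrow> c * eval2 g (x0, y0 - h) < c * eval2 g (x0, y0)"
    using DERIV_pos_inc_left[OF der] by blast
  define h where "h = min e (min d1 d2) / 2"
  have h: "0 < h" "h < e" "h < d1" "h < d2"
    using \<open>e > 0\<close> d1 d2 by (auto simp: h_def min_def)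
  have pos: "c * eval2 g (x0, y0 + h) > 0" and neg: "c * eval2 g (x0, y0 - h) < 0"
    using d1(2)[of h] d2(2)[of h] h zero by auto
  have cont: "((\<lambda>x. c * eval2 g (x, v)) \<longlongrightarrow> c * eval2 g (x0, v)) (nhds x0)" for v
    by (intro tendsto_mult tendsto_eval2 tendsto_const filterlim_ident)
  have "\<forall>\<^sub>F x in nhds x0. c * eval2 g (x, y0 + h) > 0 \<and> c * eval2 g (x, y0 - h) < 0"
    using order_tendstoD(1)[OF cont pos] order_tendstoD(2)[OF cont neg] by (rule eventually_conj)
  then obtain d where d: "d > 0" "\<And>x. \<bar>x - x0\<bar> < d \<Longrightarrow> c * eval2 g (x, y0 + h) > 0 \<and> c * eval2 g (x, y0 - h) < 0"
    unfolding eventually_nhds_metric dist_real_def by blast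
  have "\<exists>v. \<bar>v - y0\<bar> < e \<and> eval2 g (x, v) = 0" if x: "\<bar>x - x0\<bar> < d" for x
  proof -
    have "continuous_on {y0 - h..y0 + h} (\<lambda>v. c * eval2 g (x, v))"
      by (intro continuous_at_imp_continuous_on ballI continuous_mult continuous_const)
        (auto simp: isCont_def intro!: tendsto_eval2)
    then obtain v where "y0 - h \<le> v" "v \<le> y0 + h" "c * eval2 g (x, v) = 0"
      using IVT'[of "\<lambda>v. c * eval2 g (x, v)" "y0 - h" 0 "y0 + h"] d(2)[OF x] h by auto
    then show ?thesis
      using dy h by (intro exI[of _ v]) (auto simp: c_def)
  qed
  with d(1) show ?thesis
    by blast
qed

text \<open>The implicit function theorem with a continuous branch kept inside a prescribed
  neighbourhood \<open>W\<close>. The branch is picked by choice; uniqueness of zeros inside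
  \<open>U\<close> makes the choice continuous.\<close>

lemma local_branch:
  assumes zero: "eval2 g (x0, y0) = 0" and dy: "eval2 (pderiv g) (x0, y0) \<noteq> 0"
    and W: "open W" "(x0, y0) \<in> W"
  obtains d y where "d > 0" "continuous_on {x0 - d<..<x0 + d} y" "y x0 = y0"
    "\<And>x. x \<in> {x0 - d<..<x0 + d} \<Longrightarrow> eval2 g (x, y x) = 0 \<and> (x, y x) \<in> W"
proof -
  obtain U' where U': "open U'" "(x0, y0) \<in> U'"
    "\<And>x v w. \<lbrakk>(x, v) \<in> U'; (x, w) \<in> U'; eval2 g (x, v) = 0; eval2 g (x, w) = 0\<rbrakk> \<Longrightarrow> v = w"
    using zeros_unique_vertically[OF dy] by blast
  define U where "U = U' \<inter> W \<inter> {p. eval2 (pderiv g) p \<noteq> 0}"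
  have U: "open U" "(x0, y0) \<in> U"
    using U' W dy open_eval2_ne by (auto simp: U_def)
  have unique: "v = w" if "(x, v) \<in> U" "(x, w) \<in> U" "eval2 g (x, v) = 0" "eval2 g (x, w) = 0" for x v w
    using U'(3) that by (auto simp: U_def)
  \<comment> \<open>Applied at the base point this yields the branch, and at the other points of the
    branch its continuity.\<close>
  have near: "\<exists>d>0. \<forall>x. \<bar>x - x1\<bar> < d \<longrightarrow> (\<exists>v. \<bar>v - y1\<bar> < e \<and> (x, v) \<in> U \<and> eval2 g (x, v) = 0)"
    if p: "(x1, y1) \<in> U" "eval2 g (x1, y1) = 0" and "e > 0" for x1 y1 e
  proof -
    obtain A B where AB: "open A" "open B" "x1 \<in> A" "y1 \<in> B" "A \<times> B \<subseteq> U"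
      using p(1) U(1) open_prod_elim by (metis mem_Sigma_iff)
    obtain r where r: "r > 0" "ball x1 r \<subseteq> A"
      using AB open_contains_ball by blast
    obtain r' where r': "r' > 0" "ball y1 r' \<subseteq> B"
      using AB open_contains_ball by blast
    have "min e r' > 0"
      using r' \<open>e > 0\<close> by simp
    moreover have "eval2 (pderiv g) (x1, y1) \<noteq> 0"
      using p by (simp add: U_def)
    ultimately obtain d where d: "d > 0" "\<And>x. \<bar>x - x1\<bar> < d \<Longrightarrow> \<exists>v. \<bar>v - y1\<bar> < min e r' \<and> eval2 g (x, v) = 0"
      using zero_persists[OF p(2)] by blast
    have "\<exists>v. \<bar>v - y1\<bar> < e \<and> (x, v) \<in> U \<and> eval2 g (x, v) = 0" if "\<bar>x - x1\<bar> < min d r" for x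
    proof -
      have "\<bar>x - x1\<bar> < d"
        using that by simp
      then obtain v where v: "\<bar>v - y1\<bar> < min e r'" "eval2 g (x, v) = 0"
        using d(2) by blast
      moreover have "x \<in> A" "v \<in> B"
        using that v r r' by (auto simp: subset_iff dist_real_def abs_minus_commute)
      ultimately show ?thesis
        using AB(5) by auto
    qed
    then show ?thesis
      using d(1) r(1) by (intro exI[of _ "min d r"]) auto
  qed
  obtain d where d: "d > 0" "\<And>x. \<bar>x - x0\<bar> < d \<Longrightarrow> \<exists>v. (x, v) \<in> U \<and> eval2 g (x, v) = 0"
    using near[OF U(2) zero zero_less_one] by blast
  have "\<exists>y. \<forall>x. \<bar>x - x0\<bar> < d \<longrightarrow> (x, y x) \<in> U \<and> eval2 g (x, y x) = 0"
    by (rule choice) (use d(2) in blast)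
  then obtain y where y: "\<And>x. \<bar>x - x0\<bar> < d \<Longrightarrow> (x, y x) \<in> U" "\<And>x. \<bar>x - x0\<bar> < d \<Longrightarrow> eval2 g (x, y x) = 0"
    by blast
  have "isCont y x1" if x1: "\<bar>x1 - x0\<bar> < d" for x1
    unfolding continuous_at_eps_delta
  proof (intro allI impI)
    fix e :: real
    assume "e > 0"
    obtain d' where d': "d' > 0" "\<And>x. \<bar>x - x1\<bar> < d' \<Longrightarrow> \<exists>v. \<bar>v - y x1\<bar> < e \<and> (x, v) \<in> U \<and> eval2 g (x, v) = 0"
      using near[OF y[OF x1] \<open>e > 0\<close>] by blast
    have "dist (y x) (y x1) < e" if x: "dist x x1 < min d' (d - \<bar>x1 - x0\<bar>)" for x
    proof -
      have "\<bar>x - x0\<bar> < d" "\<bar>x - x1\<bar> < d'"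
        using x by (auto simp: dist_real_def)
      moreover from this obtain v where "\<bar>v - y x1\<bar> < e" "(x, v) \<in> U" "eval2 g (x, v) = 0"
        using d' by blast
      ultimately show ?thesis
        using unique[of x v "y x"] y[of x] by (simp add: dist_real_def)
    qed
    then show "\<exists>da>0. \<forall>x'. dist x' x1 < da \<longrightarrow> dist (y x') (y x1) < e"
      using d'(1) x1 by (intro exI[of _ "min d' (d - \<bar>x1 - x0\<bar>)"]) auto
  qed
  then have "continuous_on {x0 - d<..<x0 + d} y"
    by (intro continuous_at_imp_continuous_on) (auto simp: abs_less_iff)
  moreover have "y x0 = y0"
    using unique[of x0 "y x0" y0] y[of x0] U(2) zero d(1) by simp
  ultimately show ?thesis
    using d(1) y by (intro that[of d y]) (auto simp: abs_less_iff U_def)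
qed

section \<open>Arcs of a plane curve\<close>

lemma mono_left_limit:
  fixes z :: "real \<Rightarrow> real"
  assumes "c < b" and mono: "\<And>x x'. c < x \<Longrightarrow> x \<le> x' \<Longrightarrow> x' < b \<Longrightarrow> z x \<le> z x'"
  shows "(\<exists>L. (z \<longlongrightarrow> L) (at_left b)) \<or> filterlim z at_top (at_left b)"
proof (cases "bdd_above (z ` {c<..<b})")
  case True
  define L where "L = Sup (z ` {c<..<b})"
  have ne: "z ` {c<..<b} \<noteq> {}"
    using \<open>c < b\<close> by simp
  have "(z \<longlongrightarrow> L) (at_left b)"
  proof (rule order_tendstoI)
    fix l
    assume "l < L"
    then obtain x1 where x1: "c < x1" "x1 < b" "l < z x1"
      using less_cSup_iff[OF ne True] by (auto simp: L_def)
    then have "\<And>x. x1 < x \<Longrightarrow> x < b \<Longrightarrow> l < z x"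
      using mono by (meson less_eq_real_def less_le_trans)
    then show "\<forall>\<^sub>F x in at_left b. l < z x"
      using x1(2) eventually_at_left by blast
  next
    fix u
    assume "L < u"
    then have "\<And>x. c < x \<Longrightarrow> x < b \<Longrightarrow> z x < u"
      using cSup_upper[OF _ True] by (force simp: L_def)
    then show "\<forall>\<^sub>F x in at_left b. z x < u"
      using \<open>c < b\<close> eventually_at_left by blast
  qed
  then show ?thesis
    by blast
next
  case False
  have "filterlim z at_top (at_left b)"
    unfolding filterlim_at_top
  proof
    fix Z
    have "\<exists>x\<in>{c<..<b}. Z < z x"
      using False by (simp add: bdd_above_def not_le)
    then obtain x1 where x1: "c < x1" "x1 < b" "Z < z x1"
      by auto
    then have "\<And>x. x1 < x \<Longrightarrow> x < b \<Longrightarrow> Z \<le> z x"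
      using mono by (meson less_eq_real_def less_le_trans order_trans)
    then show "\<forall>\<^sub>F x in at_left b. Z \<le> z x"
      using x1(2) eventually_at_left by blast
  qed
  then show ?thesis
    by blast
qed

text \<open>A convex function is monotone near the right end: increasing once its derivative is
  positive, and otherwise decreasing but bounded below by a tangent, which excludes minus
  infinity.\<close>

lemma convex_left_limit:
  fixes z :: "real \<Rightarrow> real"
  assumes "a < b" and der: "\<And>x. a < x \<Longrightarrow> x < b \<Longrightarrow> (z has_real_derivative z' x) (at x)"
    and mono: "\<And>x x'. a < x \<Longrightarrow> x \<le> x' \<Longrightarrow> x' < b \<Longrightarrow> z' x \<le> z' x'"
  shows "(\<exists>L. (z \<longlongrightarrow> L) (at_left b)) \<or> filterlim z at_top (at_left b)"
proof (cases "\<exists>c. a < c \<and> c < b \<and> z' c > 0")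
  case True
  then obtain c where c: "a < c" "c < b" "z' c > 0"
    by blast
  show ?thesis
  proof (rule mono_left_limit[OF c(2)])
    fix x x'
    assume x: "c < x" "x \<le> x'" "x' < b"
    show "z x \<le> z x'"
    proof (rule DERIV_nonneg_imp_nondecreasing[OF x(2)])
      fix t
      assume "x \<le> t" "t \<le> x'"
      then have "z' c \<le> z' t" "(z has_real_derivative z' t) (at t)"
        using mono[of c t] der[of t] x c by auto
      then show "\<exists>y. (z has_real_derivative y) (at t) \<and> 0 \<le> y"
        using c(3) by (intro exI[of _ "z' t"]) simp
    qed
  qed
next
  case False
  define c where "c = (a + b) / 2"
  have c: "a < c" "c < b"
    using \<open>a < b\<close> by (auto simp: c_def)
  have anti: "z x' \<le> z x" if x: "c < x" "x \<le> x'" "x' < b" for x x'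
  proof (rule DERIV_nonpos_imp_nonincreasing[OF x(2)])
    fix t
    assume "x \<le> t" "t \<le> x'"
    then have t: "a < t" "t < b"
      using x c by auto
    then have "z' t \<le> 0"
      using False not_le by blast
    then show "\<exists>y. (z has_real_derivative y) (at t) \<and> y \<le> 0"
      using der[OF t] by blast
  qed
  \<comment> \<open>The tangent at \<open>c\<close> supports the graph, and as it does not rise, its
    value at \<open>b\<close> is a lower bound on the whole interval.\<close>
  have below: "z c + z' c * (b - c) \<le> z x" if x: "c < x" "x < b" for x
  proof -
    obtain t where t: "c < t" "t < x" "z x - z c = (x - c) * z' t"
      using MVT2[OF x(1), of z z'] der x c by auto
    have "(x - c) * z' c \<le> (x - c) * z' t"
      using mono[of c t] t x c by (intro mult_left_mono) auto
    moreover have "z' c \<le> 0"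
      using False c not_le by blast
    then have "(b - c) * z' c \<le> (x - c) * z' c"
      using x by (intro mult_right_mono_neg) auto
    ultimately show ?thesis
      using t(3) by (simp add: mult.commute)
  qed
  have "(\<exists>L. ((\<lambda>x. - z x) \<longlongrightarrow> L) (at_left b)) \<or> filterlim (\<lambda>x. - z x) at_top (at_left b)"
    by (rule mono_left_limit[OF c(2)]) (use anti in auto)
  then show ?thesis
  proof
    assume "\<exists>L. ((\<lambda>x. - z x) \<longlongrightarrow> L) (at_left b)"
    then show ?thesis
      using tendsto_minus by fastforce
  next
    assume "filterlim (\<lambda>x. - z x) at_top (at_left b)"
    then have "\<forall>\<^sub>F x in at_left b. - z x \<ge> 1 - (z c + z' c * (b - c))"
      unfolding filterlim_at_top by blast
    moreover have "\<forall>\<^sub>F x in at_left b. c < x \<and> x < b"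
      using c(2) eventually_at_left by blast
    ultimately have "\<forall>\<^sub>F x in at_left b. False"
    proof eventually_elim
      case (elim x)
      then show ?case
        using below[of x] by simp
    qed
    then show ?thesis
      by simp
  qed
qed

text \<open>The second derivative of a function y whose graph lies in the zero set of g is
  - hess g / (dy g)^3.\<close>

definition hess :: "real poly poly \<Rightarrow> real poly poly" where
  "hess g = dx (dx g) * pderiv g ^ 2 - [:[:2:]:] * dx (pderiv g) * dx g * pderiv g + pderiv (pderiv g) * dx g ^ 2"

text \<open>\<open>Q\<close> cuts out the removed points, and \<open>s\<close> selects convex
  (\<open>1\<close>) or concave (\<open>- 1\<close>) arcs. The alternative in \<open>flex\<close> is
  needed for straight curves, where every point satisfies the inflection equation and
  \<open>Q\<close> could not remove these points and leave anything.\<close>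

locale plane_curve =
  fixes g Q :: "real poly poly" and s :: real
  assumes nonsing: "\<And>p. eval2 g p = 0 \<Longrightarrow> eval2 (dx g) p \<noteq> 0 \<or> eval2 (pderiv g) p \<noteq> 0"
    and Q_dy: "\<And>p. eval2 g p = 0 \<Longrightarrow> eval2 Q p \<noteq> 0 \<Longrightarrow> eval2 (pderiv g) p \<noteq> 0"
    and flex: "(\<forall>p. eval2 g p = 0 \<and> eval2 Q p \<noteq> 0 \<longrightarrow> eval2 (hess g) p \<noteq> 0) \<or>
      (\<forall>p. eval2 g p = 0 \<longrightarrow> eval2 (hess g) p = 0)"
    and sign: "s = 1 \<or> s = - 1"
begin

text \<open>Only continuity is demanded; differentiability follows from the equation. The function
  is total, but its values outside \<open>I\<close> do not matter.\<close>

definition arc :: "real set \<Rightarrow> (real \<Rightarrow> real) \<Rightarrow> bool" where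
  "arc I y \<longleftrightarrow> continuous_on I y \<and> (\<forall>x\<in>I. eval2 g (x, y x) = 0 \<and> eval2 Q (x, y x) \<noteq> 0)"

text \<open>By the formula for the second derivative, the branch of the curve through p is convex if s = 1
  and concave if s = - 1.\<close>

definition bends :: "point \<Rightarrow> bool" where
  "bends p \<longleftrightarrow> s * eval2 (hess g) p * eval2 (pderiv g) p \<le> 0"

lemma arc_dy: "arc I y \<Longrightarrow> x \<in> I \<Longrightarrow> eval2 (pderiv g) (x, y x) \<noteq> 0"
  using Q_dy by (auto simp: arc_def)

lemma arc_subset: "arc I y \<Longrightarrow> J \<subseteq> I \<Longrightarrow> arc J y"
  by (auto simp: arc_def intro: continuous_on_subset)

lemma arc_cong: "(\<And>x. x \<in> I \<Longrightarrow> y x = z x) \<Longrightarrow> arc I y \<longleftrightarrow> arc I z"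
  unfolding arc_def by (metis continuous_on_cong)

lemma arc_Union:
  assumes "\<And>I. I \<in> F \<Longrightarrow> open I" "\<And>I. I \<in> F \<Longrightarrow> arc I y"
  shows "arc (\<Union>F) y"
  using assms unfolding arc_def by (blast intro: continuous_on_open_Union)

text \<open>Uniqueness of zeros on vertical lines near the limit point. An arbitrary filter covers
  both interior points and one-sided limits at an end.\<close>

lemma arc_eventually_eq:
  assumes y: "(y \<longlongrightarrow> y0) F" and z: "(z \<longlongrightarrow> y0) F" and id: "((\<lambda>x. x) \<longlongrightarrow> x0) F"
    and dy: "eval2 (pderiv g) (x0, y0) \<noteq> 0"
    and zero: "\<forall>\<^sub>F x in F. eval2 g (x, y x) = 0" "\<forall>\<^sub>F x in F. eval2 g (x, z x) = 0"
  shows "\<forall>\<^sub>F x in F. y x = z x"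
proof -
  obtain U where U: "open U" "(x0, y0) \<in> U"
    "\<And>x v w. \<lbrakk>(x, v) \<in> U; (x, w) \<in> U; eval2 g (x, v) = 0; eval2 g (x, w) = 0\<rbrakk> \<Longrightarrow> v = w"
    using zeros_unique_vertically[OF dy] by blast
  have "\<forall>\<^sub>F x in F. (x, y x) \<in> U" "\<forall>\<^sub>F x in F. (x, z x) \<in> U"
    using topological_tendstoD[OF tendsto_Pair[OF id y] U(1,2)] topological_tendstoD[OF tendsto_Pair[OF id z] U(1,2)] .
  with zero show ?thesis
    by eventually_elim (use U(3) in blast)
qed

text \<open>The set where two arcs agree is open in \<open>I\<close> by local uniqueness and closed
  by continuity, and \<open>I\<close> is connected.\<close>

lemma arc_unique:
  assumes y: "arc I y" and z: "arc I z" and I: "connected I" and x0: "x0 \<in> I" "y x0 = z x0" and x: "x \<in> I"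
  shows "y x = z x"
proof (rule connected_induction_simple[where P = "\<lambda>x. y x = z x", OF I x0(1) x x0(2)])
  fix x1
  assume x1: "x1 \<in> I"
  have cont: "continuous_on I y" "continuous_on I z"
    using y z by (auto simp: arc_def)
  show "\<exists>T. openin (top_of_set I) T \<and> x1 \<in> T \<and> (\<forall>x\<in>T. \<forall>x'\<in>T. y x = z x \<longrightarrow> y x' = z x')"
  proof (cases "y x1 = z x1")
    case True
    have lim: "(y \<longlongrightarrow> y x1) (at x1 within I)" "(z \<longlongrightarrow> y x1) (at x1 within I)"
      using cont x1 True by (auto simp: continuous_on_def)
    have "\<forall>\<^sub>F x in at x1 within I. y x = z x"
      by (rule arc_eventually_eq[OF lim tendsto_ident_at arc_dy[OF y x1]])
        (use y z in \<open>auto simp: eventually_at_filter arc_def\<close>)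
    then obtain d where d: "d > 0" "\<And>x. x \<in> I \<Longrightarrow> x \<noteq> x1 \<Longrightarrow> dist x x1 < d \<Longrightarrow> y x = z x"
      unfolding eventually_at by blast
    have "\<forall>x\<in>I \<inter> ball x1 d. y x = z x"
      using d(2) True by (metis IntE dist_commute mem_ball)
    then show ?thesis
      using d(1) x1 by (intro exI[of _ "I \<inter> ball x1 d"]) auto
  next
    case False
    have "continuous_on I (\<lambda>x. y x - z x)"
      using cont by (intro continuous_intros)
    then have "openin (top_of_set I) (I \<inter> (\<lambda>x. y x - z x) -` (- {0}))"
      by (intro continuous_openin_preimage_gen) auto
    then show ?thesis
      using False x1 by (intro exI[of _ "I \<inter> (\<lambda>x. y x - z x) -` (- {0})"]) auto
  qed
qed

text \<open>Along the arc the increment of \<open>g\<close> is 0, so by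
  \<open>eval2_increment\<close> the difference quotient of \<open>y\<close> equals
  \<open>- A / B\<close> near \<open>x\<close>.\<close>

lemma arc_derivative:
  assumes y: "arc I y" and "open I" and x: "x \<in> I"
  shows "(y has_real_derivative - eval2 (dx g) (x, y x) / eval2 (pderiv g) (x, y x)) (at x)"
proof -
  obtain A B where AB: "isCont A (x, y x)" "isCont B (x, y x)"
    "A (x, y x) = eval2 (dx g) (x, y x)" "B (x, y x) = eval2 (pderiv g) (x, y x)"
    "\<And>q. eval2 g q - eval2 g (x, y x) = (fst q - x) * A q + (snd q - y x) * B q"
    using eval2_increment[of "(x, y x)" g] by auto
  have "isCont y x"
    using y assms by (auto simp: arc_def continuous_on_eq_continuous_at)
  then have lim: "((\<lambda>t. (t, y t)) \<longlongrightarrow> (x, y x)) (at x)"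
    by (intro tendsto_Pair tendsto_ident_at) (simp add: isCont_def)
  have A: "((\<lambda>t. A (t, y t)) \<longlongrightarrow> A (x, y x)) (at x)" and B: "((\<lambda>t. B (t, y t)) \<longlongrightarrow> B (x, y x)) (at x)"
    by (rule isCont_tendsto_compose[OF _ lim] AB)+
  have B0: "B (x, y x) \<noteq> 0"
    using arc_dy[OF y x] AB(4) by simp
  have "\<forall>\<^sub>F t in at x. B (t, y t) \<noteq> 0"
    using tendsto_imp_eventually_ne[OF B B0] .
  moreover have "\<forall>\<^sub>F t in at x. t \<in> I"
    using \<open>open I\<close> x by (rule eventually_at_in_open')
  moreover have "\<forall>\<^sub>F t in at x. t \<noteq> x"
    by (simp add: eventually_at_filter)
  ultimately have "\<forall>\<^sub>F t in at x. - A (t, y t) / B (t, y t) = (y t - y x) / (t - x)"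
  proof eventually_elim
    case (elim t)
    then have "(t - x) * A (t, y t) + (y t - y x) * B (t, y t) = 0"
      using AB(5)[of "(t, y t)"] y x by (auto simp: arc_def)
    with elim show ?case
      by (simp add: field_simps)
  qed
  moreover have "((\<lambda>t. - A (t, y t) / B (t, y t)) \<longlongrightarrow> - A (x, y x) / B (x, y x)) (at x)"
    by (rule tendsto_divide[OF tendsto_minus[OF A] B B0])
  with \<open>\<forall>\<^sub>F t in at x. - A (t, y t) / B (t, y t) = (y t - y x) / (t - x)\<close>
  have "((\<lambda>t. (y t - y x) / (t - x)) \<longlongrightarrow> - A (x, y x) / B (x, y x)) (at x)"
    by (rule Lim_transform_eventually[rotated])
  then show ?thesis
    using AB(3,4) by (simp add: has_field_derivative_iff)
qed

definition slope :: "(real \<Rightarrow> real) \<Rightarrow> real \<Rightarrow> real" where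
  "slope y x = - eval2 (dx g) (x, y x) / eval2 (pderiv g) (x, y x)"

lemma slope_derivative:
  assumes y: "arc I y" and "open I" and x: "x \<in> I"
  shows "(slope y has_real_derivative - eval2 (hess g) (x, y x) / eval2 (pderiv g) (x, y x) ^ 3) (at x)"
proof -
  define m a b where "m = slope y x" and "a = eval2 (dx g) (x, y x)" and "b = eval2 (pderiv g) (x, y x)"
  have b: "b \<noteq> 0"
    using arc_dy[OF y x] by (simp add: b_def)
  have dy: "(y has_real_derivative m) (at x)"
    using arc_derivative[OF assms] by (simp add: m_def slope_def)
  define p q r where "p = eval2 (dx (dx g)) (x, y x)" and "q = eval2 (pderiv (dx g)) (x, y x)"
    and "r = eval2 (pderiv (pderiv g)) (x, y x)"
  have "(slope y has_real_derivative ((- (p * 1 + q * m)) * b - (- a) * (q * 1 + r * m)) / (b * b)) (at x)"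
    unfolding slope_def[abs_def] a_def b_def p_def q_def r_def
    by (rule DERIV_divide[OF DERIV_minus[OF eval2_chain[OF DERIV_ident dy]]
          eval2_chain[OF DERIV_ident dy, of "pderiv g", unfolded dx_pderiv_commute]])
      (use b in \<open>simp add: b_def\<close>)
  moreover have "((- (p * 1 + q * m)) * b - (- a) * (q * 1 + r * m)) / (b * b) =
      - (p * b ^ 2 - 2 * q * a * b + r * a ^ 2) / b ^ 3"
  proof -
    have "m = - a / b"
      by (simp add: m_def slope_def a_def b_def)
    then show ?thesis
      using b by (simp only:) (simp add: field_simps power2_eq_square power3_eq_cube)
  qed
  moreover have "eval2 (hess g) (x, y x) = p * b ^ 2 - 2 * q * a * b + r * a ^ 2"
    by (simp add: hess_def dx_pderiv_commute eval2_add eval2_diff eval2_mult eval2_power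
        p_def q_def r_def a_def b_def) (simp add: eval2_def)
  ultimately show ?thesis
    by (simp add: b_def)
qed


text \<open>A change of sign along the arc would need a zero of \<open>hess g\<close> on it, and by
  \<open>flex\<close> \<open>hess g\<close> would then vanish along the whole curve.\<close>

lemma arc_bends:
  assumes y: "arc I y" and I: "connected I" and x0: "x0 \<in> I" "bends (x0, y x0)" and x: "x \<in> I"
  shows "bends (x, y x)"
proof (rule ccontr)
  assume not: "\<not> bends (x, y x)"
  define \<phi> where "\<phi> t = s * eval2 (hess g) (t, y t) * eval2 (pderiv g) (t, y t)" for t
  have "connected (\<phi> ` I)"
    unfolding \<phi>_def using y I
    by (intro connected_continuous_image continuous_intros) (auto simp: arc_def)
  moreover have "\<phi> x0 \<le> 0" "\<phi> x > 0"
    using x0(2) not by (auto simp: bends_def \<phi>_def)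
  ultimately have "0 \<in> \<phi> ` I"
    using x0(1) x connected_contains_Icc[of "\<phi> ` I" "\<phi> x0" "\<phi> x"] by auto
  then obtain t where t: "t \<in> I" "\<phi> t = 0"
    by auto
  then have "eval2 (hess g) (t, y t) = 0"
    using arc_dy[OF y t(1)] sign by (auto simp: \<phi>_def)
  then have "eval2 (hess g) (x, y x) = 0"
    using flex y t x by (auto simp: arc_def)
  then show False
    using \<open>\<phi> x > 0\<close> by (simp add: \<phi>_def)
qed

lemma arc_second_derivative:
  assumes y: "arc I y" and I: "open I" "connected I" and x0: "x0 \<in> I" "bends (x0, y x0)" and x: "x \<in> I"
  obtains D where "((\<lambda>t. s * slope y t) has_real_derivative D) (at x)" "D \<ge> 0"
proof
  let ?H = "eval2 (hess g) (x, y x)" and ?d = "eval2 (pderiv g) (x, y x)"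
  show "((\<lambda>t. s * slope y t) has_real_derivative s * (- ?H / ?d ^ 3)) (at x)"
    using DERIV_cmult[OF slope_derivative[OF y I(1) x]] .
  have "?d \<noteq> 0"
    using arc_dy[OF y x] .
  \<comment> \<open>Extending the fraction by \<open>?d\<close> makes the denominator an even power,
    so that \<open>bends\<close> decides the sign.\<close>
  then have "s * (- ?H / ?d ^ 3) = - (s * ?H * ?d) / ?d ^ 4"
    by (simp add: field_simps eval_nat_numeral)
  moreover have "s * ?H * ?d \<le> 0"
    using arc_bends[OF y I(2) x0 x] by (simp add: bends_def)
  ultimately show "s * (- ?H / ?d ^ 3) \<ge> 0"
    by (simp add: divide_nonpos_nonneg)
qed

lemma arc_slope_mono:
  assumes y: "arc I y" and I: "open I" "connected I" and x0: "x0 \<in> I" "bends (x0, y x0)"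
    and x: "x \<in> I" "x' \<in> I" "x \<le> x'"
  shows "s * slope y x \<le> s * slope y x'"
proof (rule DERIV_nonneg_imp_nondecreasing[OF x(3)])
  fix t
  assume "x \<le> t" "t \<le> x'"
  then have "t \<in> I"
    using connected_contains_Icc[OF I(2) x(1,2)] by auto
  then show "\<exists>D. ((\<lambda>t. s * slope y t) has_real_derivative D) (at t) \<and> 0 \<le> D"
    using arc_second_derivative[OF y I x0] by blast
qed

lemma arc_scaled_derivative:
  assumes "arc I y" "open I" "x \<in> I"
  shows "((\<lambda>t. s * y t) has_real_derivative s * slope y x) (at x)"
  using DERIV_cmult[OF arc_derivative[OF assms]] by (simp add: slope_def)

lemma arc_convex:
  assumes y: "arc I y" and I: "open I" "connected I" and x0: "x0 \<in> I" "bends (x0, y x0)"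
  shows "convex_on I (\<lambda>x. s * y x)"
proof -
  have "\<forall>x\<in>I. \<exists>D. ((\<lambda>t. s * slope y t) has_real_derivative D) (at x) \<and> D \<ge> 0"
    using arc_second_derivative[OF y I x0] by blast
  then obtain D where "\<And>x. x \<in> I \<Longrightarrow> ((\<lambda>t. s * slope y t) has_real_derivative D x) (at x) \<and> D x \<ge> 0"
    by metis
  then show ?thesis
    using I arc_scaled_derivative[OF y I(1)]
    by (intro f''_ge0_imp_convex[of I _ "\<lambda>t. s * slope y t" D]) (auto simp flip: is_interval_convex_1 is_interval_connected_1)
qed

text \<open>The union of all prolongations to the right, which agree by \<open>arc_unique\<close>.
  The left end stays where the local branch put it, because arcs are charged to right ends
  only.\<close>

lemma maximal_arc:
  assumes "eval2 g (x0, y0) = 0" "eval2 Q (x0, y0) \<noteq> 0"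
  obtains a y where "a < x0" "y x0 = y0"
    "arc {a<..} y \<or> (\<exists>b>x0. arc {a<..<b} y \<and> (\<forall>b'>b. \<forall>z. z x0 = y0 \<longrightarrow> \<not> arc {a<..<b'} z))"
proof -
  obtain d w where w: "d > 0" "continuous_on {x0 - d<..<x0 + d} w" "w x0 = y0"
    "\<And>x. x \<in> {x0 - d<..<x0 + d} \<Longrightarrow> eval2 g (x, w x) = 0 \<and> (x, w x) \<in> {p. eval2 Q p \<noteq> 0}"
    using local_branch[OF assms(1) Q_dy[OF assms] open_eval2_ne[of Q]] assms(2) by blast
  define a where "a = x0 - d"
  define B where "B = {b. b > x0 \<and> (\<exists>z. arc {a<..<b} z \<and> z x0 = y0)}"
  have a: "a < x0"
    using w(1) by (simp add: a_def)
  have "x0 + d \<in> B"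
    using w unfolding B_def arc_def a_def by auto
  have "\<exists>Z. \<forall>b\<in>B. arc {a<..<b} (Z b) \<and> Z b x0 = y0"
    by (rule bchoice) (auto simp: B_def)
  then obtain Z where Z: "\<And>b. b \<in> B \<Longrightarrow> arc {a<..<b} (Z b)" "\<And>b. b \<in> B \<Longrightarrow> Z b x0 = y0"
    by blast
  have B: "x0 < b" if "b \<in> B" for b
    using that by (simp add: B_def)
  define y where "y x = Z (SOME b. b \<in> B \<and> x < b) x" for x
  have y: "y x = Z b x" if b: "b \<in> B" "a < x" "x < b" for b x
  proof -
    define b' where "b' = (SOME b. b \<in> B \<and> x < b)"
    have b': "b' \<in> B \<and> x < b'"
      unfolding b'_def by (rule someI[of _ b]) (use b in auto)
    have "arc {a<..<min b b'} (Z b')" "arc {a<..<min b b'} (Z b)"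
      using b(1) b' by (auto intro: arc_subset[OF Z(1)[of b']] arc_subset[OF Z(1)[of b]])
    from arc_unique[OF this, of x0 x] show ?thesis
      using a b b' Z(2) B[of b] B[of b'] by (simp add: y_def flip: b'_def)
  qed
  have "arc (\<Union>b\<in>B. {a<..<b}) y"
  proof (rule arc_Union)
    fix I
    assume "I \<in> (\<lambda>b. {a<..<b}) ` B"
    then obtain b where b: "b \<in> B" "I = {a<..<b}"
      by auto
    then show "arc I y"
      using arc_cong[of I y "Z b"] Z(1) y[OF b(1)] by auto
  qed auto
  moreover have "y x0 = y0"
    using y[OF \<open>x0 + d \<in> B\<close> a] Z(2) w(1) \<open>x0 + d \<in> B\<close> by simp
  moreover have "arc {a<..} y \<or> (\<exists>b>x0. arc {a<..<b} y \<and> (\<forall>b'>b. \<forall>z. z x0 = y0 \<longrightarrow> \<not> arc {a<..<b'} z))"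
  proof (cases "bdd_above B")
    case True
    have ne: "B \<noteq> {}"
      using \<open>x0 + d \<in> B\<close> by blast
    have "(\<Union>b\<in>B. {a<..<b}) = {a<..<Sup B}"
      using less_cSup_iff[OF ne True] by fastforce
    moreover have "x0 < Sup B"
      using less_cSup_iff[OF ne True] \<open>x0 + d \<in> B\<close> w(1) by force
    moreover have "\<not> arc {a<..<b'} z" if "Sup B < b'" "z x0 = y0" for b' z
    proof
      assume "arc {a<..<b'} z"
      then have "b' \<in> B"
        using that \<open>x0 < Sup B\<close> by (auto simp: B_def)
      then show False
        using cSup_upper[OF _ True] that(1) by fastforce
    qed
    ultimately show ?thesis
      using \<open>arc (\<Union>b\<in>B. {a<..<b}) y\<close> by auto
  next
    case False
    then have "\<exists>b\<in>B. x < b" for x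
      by (force simp: bdd_above_def not_le)
    then have "(\<Union>b\<in>B. {a<..<b}) = {a<..}"
      by auto
    then show ?thesis
      using \<open>arc (\<Union>b\<in>B. {a<..<b}) y\<close> by simp
  qed
  ultimately show ?thesis
    using a that by blast
qed

text \<open>Convexity leaves only a finite limit or divergence to infinity in the direction of
  \<open>s\<close>. A finite limit lies on the curve, and if \<open>Q\<close> did not vanish there,
  the local branch would prolong the arc.\<close>

lemma right_end:
  assumes y: "arc {a<..<b} y" and x0: "a < x0" "x0 < b" "bends (x0, y x0)"
    and maximal: "\<And>b' z. b' > b \<Longrightarrow> z x0 = y x0 \<Longrightarrow> \<not> arc {a<..<b'} z"
  shows "(\<exists>L. (y \<longlongrightarrow> L) (at_left b) \<and> eval2 g (b, L) = 0 \<and> eval2 Q (b, L) = 0) \<or>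
    filterlim (\<lambda>x. s * y x) at_top (at_left b)"
proof -
  have "a < b"
    using x0 by simp
  have "(\<exists>L. ((\<lambda>x. s * y x) \<longlongrightarrow> L) (at_left b)) \<or> filterlim (\<lambda>x. s * y x) at_top (at_left b)"
    by (rule convex_left_limit[OF \<open>a < b\<close>, of _ "\<lambda>x. s * slope y x"])
      (use arc_scaled_derivative[OF y] arc_slope_mono[OF y, of x0] x0 in auto)
  then show ?thesis
  proof
    assume "\<exists>L. ((\<lambda>x. s * y x) \<longlongrightarrow> L) (at_left b)"
    then obtain L' where "((\<lambda>x. s * y x) \<longlongrightarrow> L') (at_left b)"
      by blast
    from tendsto_mult_left[OF this, of s] have lim: "(y \<longlongrightarrow> s * L') (at_left b)"
      using sign by auto
    define L where "L = s * L'"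
    have inside: "\<forall>\<^sub>F x in at_left b. a < x \<and> x < b"
      using \<open>a < b\<close> eventually_at_left by blast
    have id: "((\<lambda>x. x) \<longlongrightarrow> b) (at_left b)"
      by (rule tendsto_ident_at)
    have zero: "\<forall>\<^sub>F x in at_left b. eval2 g (x, y x) = 0"
      using inside by eventually_elim (use y in \<open>auto simp: arc_def\<close>)
    have "((\<lambda>x. eval2 g (x, y x)) \<longlongrightarrow> eval2 g (b, L)) (at_left b)"
      using tendsto_eval2[OF id lim] by (simp add: L_def)
    then have gL: "eval2 g (b, L) = 0"
      using tendsto_eventually[OF zero] by (metis tendsto_unique trivial_limit_at_left_real)
    moreover have "eval2 Q (b, L) = 0"
    proof (rule ccontr)
      assume Q: "eval2 Q (b, L) \<noteq> 0"
      obtain d w where w: "d > 0" "continuous_on {b - d<..<b + d} w" "w b = L"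
        "\<And>x. x \<in> {b - d<..<b + d} \<Longrightarrow> eval2 g (x, w x) = 0 \<and> (x, w x) \<in> {p. eval2 Q p \<noteq> 0}"
        using local_branch[OF gL Q_dy[OF gL Q] open_eval2_ne[of Q]] Q by blast
      have "(w \<longlongrightarrow> L) (at b)"
        using w(1,2,3) by (auto simp: continuous_on_eq_continuous_at isCont_def)
      then have wlim: "(w \<longlongrightarrow> L) (at_left b)"
        by (rule filterlim_mono) (auto simp: at_le)
      have "\<forall>\<^sub>F x in at_left b. b - d < x \<and> x < b"
        using w(1) by (intro eventually_at_leftI[of "b - d"]) auto
      then have wzero: "\<forall>\<^sub>F x in at_left b. eval2 g (x, w x) = 0"
        by eventually_elim (use w(1,4) in auto)
      have "\<forall>\<^sub>F x in at_left b. y x = w x"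
        by (rule arc_eventually_eq[OF lim[folded L_def] wlim id Q_dy[OF gL Q] zero wzero])
      then obtain c where c: "c < b" "\<And>x. c < x \<Longrightarrow> x < b \<Longrightarrow> y x = w x"
        unfolding eventually_at_left[OF \<open>a < b\<close>] by blast
      \<comment> \<open>The arc and the local branch agree on the overlap of two open intervals, so
        \<open>z\<close> is an arc on their union, which reaches beyond \<open>b\<close>.\<close>
      define c' z where "c' = max c (b - d)" and "z = (\<lambda>x. if x < b then y x else w x)"
      have "arc {a<..<b} z"
        using y arc_cong[of "{a<..<b}" y z] by (simp add: z_def)
      moreover have "arc {c'<..<b + d} w"
        using w unfolding arc_def by (auto simp: c'_def intro: continuous_on_subset)
      then have "arc {c'<..<b + d} z"
        using c arc_cong[of "{c'<..<b + d}" w z] by (simp add: z_def c'_def)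
      ultimately have "arc (\<Union>{{a<..<b}, {c'<..<b + d}}) z"
        by (intro arc_Union) auto
      then have "arc {a<..<b + d} z"
        by (rule arc_subset) (use c w(1) in \<open>auto simp: c'_def\<close>)
      then show False
        using maximal[of "b + d" z] w(1) x0 by (simp add: z_def)
    qed
    ultimately show ?thesis
      using lim by (auto simp: L_def)
  qed simp
qed

end

text \<open>As the ordinate grows, the highest power of x2 dominates. A branch of the curve can
  therefore escape to infinity over \<open>b\<close> only if the leading coefficient vanishes at
  \<open>b\<close>.\<close>

lemma eval2_over_power_tendsto:
  fixes h :: "real poly poly"
  assumes x: "(x \<longlongrightarrow> b) F" and y: "filterlim y at_infinity F"
  shows "((\<lambda>t. eval2 h (x t, y t) / y t ^ degree h) \<longlongrightarrow> poly (lead_coeff h) b) F"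
proof -
  define n where "n = degree h"
  have "\<forall>\<^sub>F t in F. 1 \<le> norm (y t)"
    using y filterlim_at_infinity[OF order_refl, of y F] zero_less_one by blast
  then have ev: "\<forall>\<^sub>F t in F. y t \<noteq> 0"
    by eventually_elim auto
  have inv: "((\<lambda>t. inverse (y t)) \<longlongrightarrow> 0) F"
    using tendsto_inverse_0 y by (rule filterlim_compose)
  have "((\<lambda>t. poly (coeff h j) (x t)) \<longlongrightarrow> poly (coeff h j) b) F" for j
    by (rule tendsto_poly[OF x])
  then have "((\<lambda>t. \<Sum>j\<le>n. poly (coeff h j) (x t) * inverse (y t) ^ (n - j)) \<longlongrightarrow>
      (\<Sum>j\<le>n. poly (coeff h j) b * 0 ^ (n - j))) F"
    by (intro tendsto_sum tendsto_mult tendsto_power inv)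
  also have "(\<Sum>j\<le>n. poly (coeff h j) b * 0 ^ (n - j)) = (\<Sum>j\<in>{n}. poly (coeff h j) b * 0 ^ (n - j))"
    by (rule sum.mono_neutral_right) auto
  finally have "((\<lambda>t. \<Sum>j\<le>n. poly (coeff h j) (x t) * inverse (y t) ^ (n - j)) \<longlongrightarrow> poly (lead_coeff h) b) F"
    by (simp add: n_def)
  moreover have "\<forall>\<^sub>F t in F. (\<Sum>j\<le>n. poly (coeff h j) (x t) * inverse (y t) ^ (n - j)) = eval2 h (x t, y t) / y t ^ n"
    using ev
  proof eventually_elim
    case (elim t)
    have "eval2 h (x t, y t) = (\<Sum>j\<le>n. poly (coeff h j) (x t) * y t ^ j)"
      by (simp add: eval2_def poly_altdef[of h] poly_sum poly_power n_def)
    moreover have "inverse (y t) ^ (n - j) = y t ^ j / y t ^ n" if "j \<le> n" for j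
      using elim that by (simp add: power_diff power_inverse field_simps)
    ultimately show ?case
      by (simp add: sum_divide_distrib)
  qed
  ultimately show ?thesis
    unfolding n_def by (rule Lim_transform_eventually)
qed

lemma card_vertical_zeros:
  assumes "poly (lead_coeff g) x \<noteq> 0"
  shows "finite {v. eval2 g (x, v) = 0}" "card {v. eval2 g (x, v) = 0} \<le> degree g"
proof -
  define h where "h = map_poly (\<lambda>a. poly a x) g"
  have eval: "eval2 f (x, v) = poly (map_poly (\<lambda>a. poly a x) f) v" for f v
    by (induction f) (simp_all add: eval2_pCons map_poly_pCons)
  have "coeff h (degree g) \<noteq> 0"
    using assms by (simp add: h_def coeff_map_poly)
  then have "h \<noteq> 0"
    by auto
  moreover have "degree h \<le> degree g"
    by (rule degree_le) (simp add: h_def coeff_map_poly coeff_eq_0)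
  ultimately show "finite {v. eval2 g (x, v) = 0}" "card {v. eval2 g (x, v) = 0} \<le> degree g"
    using poly_roots_finite[of h] card_poly_roots_bound[of h] by (auto simp: eval h_def[symmetric])
qed

lemma three_sorted:
  fixes P :: "point set"
  assumes "inj_on fst P" "3 \<le> card P"
  obtains p q r where "p \<in> P" "q \<in> P" "r \<in> P" "fst p < fst q" "fst q < fst r"
proof -
  obtain T where T: "T \<subseteq> P" "card T = 3" "finite T"
    using assms(2) obtain_subset_with_card_n by (metis card.infinite zero_neq_numeral)
  define X where "X = fst ` T"
  have X: "card X = 3" "finite X"
    using T assms(1) by (auto simp: X_def card_image inj_on_subset)
  define a c where "a = Min X" and "c = Max X"
  have "X \<noteq> {}"
    using X by auto
  then have ac: "a \<in> X" "c \<in> X" "\<And>x. x \<in> X \<Longrightarrow> a \<le> x \<and> x \<le> c"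
    using X by (auto simp: a_def c_def)
  have "card {a, c} < card X"
    using X by (simp add: card_insert_if)
  then have "\<not> X \<subseteq> {a, c}"
    using card_mono[of "{a, c}" X] by auto
  then obtain b where b: "b \<in> X" "b \<noteq> a" "b \<noteq> c"
    by auto
  then have "a < b" "b < c"
    using ac(3)[OF b(1)] by auto
  with ac b obtain p q r where "p \<in> T" "q \<in> T" "r \<in> T" "fst p = a" "fst q = b" "fst r = c"
    by (auto simp: X_def)
  with T \<open>a < b\<close> \<open>b < c\<close> show ?thesis
    using that[of p q r] by auto
qed

section \<open>Arcs with a common right end, and vertical asymptotes\<close>

context plane_curve
begin

text \<open>If the scaled slope never became positive, convexity would keep it between its value at
  \<open>x0\<close> and 0. A bounded slope bounds the x1-derivative of \<open>g\<close> by a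
  multiple of the x2-derivative, and in the limit both would vanish at the end point.\<close>

lemma arc_eventually_steep:
  assumes y: "arc {a<..<b} y" and x0: "a < x0" "x0 < b" "bends (x0, y x0)"
    and lim: "(y \<longlongrightarrow> L) (at_left b)" and dy0: "eval2 (pderiv g) (b, L) = 0" and zero: "eval2 g (b, L) = 0"
  shows "\<forall>\<^sub>F x in at_left b. s * slope y x > 0"
proof (rule ccontr)
  assume not: "\<not> ?thesis"
  have mono: "s * slope y x \<le> s * slope y x'" if "a < x" "x \<le> x'" "x' < b" for x x'
    using arc_slope_mono[OF y, of x0 x x'] x0 that by auto
  have nonpos: "s * slope y x \<le> 0" if x: "a < x" "x < b" for x
  proof (rule ccontr)
    assume "\<not> s * slope y x \<le> 0"
    then have "s * slope y t > 0" if "x < t" "t < b" for t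
      using mono[of x t] x that by linarith
    then have "\<forall>\<^sub>F x in at_left b. s * slope y x > 0"
      using x by (intro eventually_at_leftI[of x]) auto
    then show False
      using not by blast
  qed
  define K where "K = - (s * slope y x0)"
  have "\<forall>\<^sub>F x in at_left b. x0 < x \<and> x < b"
    using x0 by (intro eventually_at_leftI[of x0]) auto
  then have "\<forall>\<^sub>F x in at_left b. \<bar>eval2 (dx g) (x, y x)\<bar> \<le> K * \<bar>eval2 (pderiv g) (x, y x)\<bar>"
  proof eventually_elim
    case (elim x)
    then have "s * slope y x0 \<le> s * slope y x" "s * slope y x \<le> 0"
      using mono[of x0 x] nonpos[of x] x0 by auto
    then have "\<bar>slope y x\<bar> \<le> K"
      using sign by (auto simp: K_def)
    moreover have "eval2 (pderiv g) (x, y x) \<noteq> 0"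
      using arc_dy[OF y] elim x0 by simp
    then have "\<bar>eval2 (dx g) (x, y x)\<bar> = \<bar>slope y x\<bar> * \<bar>eval2 (pderiv g) (x, y x)\<bar>"
      by (simp add: slope_def abs_divide)
    ultimately show ?case
      by (simp add: mult_right_mono)
  qed
  moreover have "((\<lambda>x. \<bar>eval2 h (x, y x)\<bar>) \<longlongrightarrow> \<bar>eval2 h (b, L)\<bar>) (at_left b)" for h
    by (intro tendsto_rabs tendsto_eval2 tendsto_ident_at lim)
  ultimately have "\<bar>eval2 (dx g) (b, L)\<bar> \<le> K * \<bar>eval2 (pderiv g) (b, L)\<bar>"
    by (intro tendsto_le[OF trivial_limit_at_left_real tendsto_mult[OF tendsto_const]])
  then show False
    using nonsing[OF zero] dy0 by simp
qed

text \<open>If two distinct arcs had the same end point, then Rolle's theorem applied between them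
  vertically would make the tangent at the end point vertical; both arcs are then monotone, and
  Rolle's theorem applied horizontally would make the end point singular.\<close>

lemma arcs_with_same_end:
  assumes y: "arc {a<..<b} y" "a < x1" "x1 < b" "bends (x1, y x1)" "(y \<longlongrightarrow> L) (at_left b)"
    and z: "arc {a'<..<b} z" "a' < x2" "x2 < b" "bends (x2, z x2)" "(z \<longlongrightarrow> L) (at_left b)"
    and zero: "eval2 g (b, L) = 0"
    and x: "a < x" "a' < x" "x < b"
  shows "y x = z x"
proof (rule ccontr)
  assume neq: "y x \<noteq> z x"
  define m where "m = max a a'"
  have arcs: "arc {m<..<b} y" "arc {m<..<b} z"
    by (auto simp: m_def intro: arc_subset[OF y(1)] arc_subset[OF z(1)])
  have "m < b"
    using x by (simp add: m_def)
  have disjoint: "y t \<noteq> z t" if "m < t" "t < b" for t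
    using arc_unique[OF arcs, of t x] that x neq by (auto simp: m_def)
  have inside: "\<forall>\<^sub>F t in at_left b. m < t \<and> t < b"
    using \<open>m < b\<close> by (intro eventually_at_leftI[of m]) auto
  \<comment> \<open>Otherwise local uniqueness would make the two arcs agree near
    \<open>b\<close>.\<close>
  have "eval2 (pderiv g) (b, L) = 0"
  proof (rule ccontr)
    assume dy: "eval2 (pderiv g) (b, L) \<noteq> 0"
    have "\<forall>\<^sub>F t in at_left b. eval2 g (t, y t) = 0" "\<forall>\<^sub>F t in at_left b. eval2 g (t, z t) = 0"
      using inside by (eventually_elim, use arcs in \<open>auto simp: arc_def\<close>)+
    from arc_eventually_eq[OF y(5) z(5) tendsto_ident_at dy this] inside
    have "\<forall>\<^sub>F t in at_left b. False"
      by eventually_elim (use disjoint in blast)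
    then show False
      by simp
  qed
  note steep = arc_eventually_steep[OF y this zero] arc_eventually_steep[OF z this zero]
  have "eval2 (dx g) (b, L) \<noteq> 0"
    using nonsing[OF zero] \<open>eval2 (pderiv g) (b, L) = 0\<close> by simp
  then obtain U where U: "open U" "(b, L) \<in> U"
    "\<And>\<eta> v w. \<lbrakk>(v, \<eta>) \<in> U; (w, \<eta>) \<in> U; eval2 g (v, \<eta>) = 0; eval2 g (w, \<eta>) = 0\<rbrakk> \<Longrightarrow> v = w"
    using zeros_unique_horizontally by blast
  have inU: "\<forall>\<^sub>F t in at_left b. (t, y t) \<in> U" "\<forall>\<^sub>F t in at_left b. (t, z t) \<in> U"
    using topological_tendstoD[OF tendsto_Pair[OF tendsto_ident_at y(5)] U(1,2)]
      topological_tendstoD[OF tendsto_Pair[OF tendsto_ident_at z(5)] U(1,2)] .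
  have "\<forall>\<^sub>F t in at_left b. s * slope y t > 0 \<and> s * slope z t > 0 \<and> (t, y t) \<in> U \<and> (t, z t) \<in> U \<and> m < t"
    using steep inU inside by eventually_elim auto
  then obtain c where c: "c < b" "\<And>t. c < t \<Longrightarrow> t < b \<Longrightarrow>
      s * slope y t > 0 \<and> s * slope z t > 0 \<and> (t, y t) \<in> U \<and> (t, z t) \<in> U \<and> m < t"
    unfolding eventually_at_left[OF \<open>m < b\<close>] by blast
  have incr: "s * w t < s * w t'"
    if w: "arc {m<..<b} w" "\<And>t. c < t \<Longrightarrow> t < b \<Longrightarrow> s * slope w t > 0" and t: "c < t" "t < t'" "t' < b" for w t t'
  proof (rule DERIV_pos_imp_increasing[OF t(2)])
    fix u
    assume "t \<le> u" "u \<le> t'"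
    then have u: "c < u" "u < b"
      using t by auto
    then have "((\<lambda>t. s * w t) has_real_derivative s * slope w u) (at u)"
      using c(2) by (intro arc_scaled_derivative[OF w(1)]) auto
    with w(2)[OF u] show "\<exists>D. ((\<lambda>t. s * w t) has_real_derivative D) (at u) \<and> 0 < D"
      by blast
  qed
  have incr_y: "s * y t < s * y t'" and incr_z: "s * z t < s * z t'" if "c < t" "t < t'" "t' < b" for t t'
    using incr[OF arcs(1)] incr[OF arcs(2)] c(2) that by blast+
  \<comment> \<open>A strictly increasing function stays strictly below its left limit; the midpoint
    \<open>t'\<close> supplies the strictness.\<close>
  have below: "s * w t < s * L"
    if w: "(w \<longlongrightarrow> L) (at_left b)" "\<And>t t'. c < t \<Longrightarrow> t < t' \<Longrightarrow> t' < b \<Longrightarrow> s * w t < s * w t'" and t: "c < t" "t < b" for w t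
  proof -
    define t' where "t' = (t + b) / 2"
    have t': "t < t'" "t' < b"
      using t by (auto simp: t'_def)
    have "\<forall>\<^sub>F u in at_left b. s * w t' \<le> s * w u"
      using t t' w(2)[of t'] by (intro eventually_at_leftI[of t']) (auto intro: less_imp_le)
    then have "s * w t' \<le> s * L"
      by (intro tendsto_lowerbound[OF tendsto_mult_left[OF w(1)]]) auto
    then show ?thesis
      using w(2)[OF t(1) t'] by linarith
  qed
  \<comment> \<open>Both arcs climb to the same height, so their heights interlace: up to the factor
    \<open>s\<close>, \<open>z c' < y t1 < z t2\<close>. Hence \<open>z\<close> takes the height
    \<open>y t1\<close> at some \<open>t3\<close>, and uniqueness on horizontals forces
    \<open>t3 = t1\<close>, where the arcs are disjoint.\<close>
  define c' where "c' = (c + b) / 2"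
  have c': "c < c'" "c' < b"
    using c(1) by (auto simp: c'_def)
  have "\<forall>\<^sub>F t in at_left b. s * z c' < s * y t"
    using below[OF z(5) incr_z c'] by (intro order_tendstoD(1)[OF tendsto_mult_left[OF y(5)]])
  moreover have "\<forall>\<^sub>F t in at_left b. c' < t \<and> t < b"
    using c' by (intro eventually_at_leftI[of c']) auto
  ultimately have "\<forall>\<^sub>F t in at_left b. s * z c' < s * y t \<and> c' < t \<and> t < b"
    by eventually_elim auto
  then obtain t1 where t1: "s * z c' < s * y t1" "c' < t1" "t1 < b"
    using eventually_happens'[OF trivial_limit_at_left_real] by blast
  have "c < t1"
    using c' t1 by simp
  have "\<forall>\<^sub>F t in at_left b. s * y t1 < s * z t"
    using below[OF y(5) incr_y \<open>c < t1\<close> t1(3)] by (intro order_tendstoD(1)[OF tendsto_mult_left[OF z(5)]])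
  moreover have "\<forall>\<^sub>F t in at_left b. c' < t \<and> t < b"
    using c' by (intro eventually_at_leftI[of c']) auto
  ultimately have "\<forall>\<^sub>F t in at_left b. s * y t1 < s * z t \<and> c' < t \<and> t < b"
    by eventually_elim auto
  then obtain t2 where t2: "s * y t1 < s * z t2" "c' < t2" "t2 < b"
    using eventually_happens'[OF trivial_limit_at_left_real] by blast
  have "continuous_on {m<..<b} z"
    using arcs by (simp add: arc_def)
  then have "continuous_on {c'..t2} (\<lambda>t. s * z t)"
    using t2 c(2)[OF c'] by (intro continuous_intros) (auto elim: continuous_on_subset)
  then obtain t3 where t3: "c' \<le> t3" "t3 \<le> t2" "s * z t3 = s * y t1"
    using IVT'[of "\<lambda>t. s * z t" c' "s * y t1" t2] t1 t2 by auto
  then have same: "z t3 = y t1" and "c < t3" "t3 < b"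
    using sign c' t2 by auto
  have "m < t1" "m < t3"
    using c(2) \<open>c < t1\<close> \<open>c < t3\<close> t1(3) \<open>t3 < b\<close> by blast+
  moreover have "t3 = t1"
  proof (rule U(3))
    show "(t3, y t1) \<in> U" "(t1, y t1) \<in> U"
      using c(2)[of t3] c(2)[of t1] \<open>c < t1\<close> \<open>c < t3\<close> t1(3) \<open>t3 < b\<close> same by auto
    show "eval2 g (t3, y t1) = 0" "eval2 g (t1, y t1) = 0"
      using arcs \<open>m < t1\<close> \<open>m < t3\<close> t1(3) \<open>t3 < b\<close> same unfolding arc_def by (metis greaterThanLessThan_iff)+
  qed
  ultimately show False
    using disjoint[of t1] same t1(3) by simp
qed

lemma asymptote:
  assumes y: "arc {a<..<b} y" "a < b" and lim: "filterlim (\<lambda>x. s * y x) at_top (at_left b)"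
  shows "poly (lead_coeff g) b = 0"
proof -
  have "filterlim (\<lambda>x. s * y x) at_infinity (at_left b)"
    using lim filterlim_at_top_imp_at_infinity by blast
  then have "filterlim y at_infinity (at_left b)"
    using sign by (auto simp: filterlim_at_infinity[OF order_refl])
  from eval2_over_power_tendsto[OF tendsto_ident_at this]
  have lim: "((\<lambda>x. eval2 g (x, y x) / y x ^ degree g) \<longlongrightarrow> poly (lead_coeff g) b) (at_left b)" .
  have "\<forall>\<^sub>F x in at_left b. eval2 g (x, y x) / y x ^ degree g = 0"
    using y by (intro eventually_at_leftI[of a]) (auto simp: arc_def)
  from tendsto_unique[OF trivial_limit_at_left_real lim tendsto_eventually[OF this]]
  show ?thesis .
qed

end

text \<open>Together with injectivity of \<open>fst\<close>, this is what the counting on arcs needs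
  to know about the points of a chain. Stated for a function on a compact interval, it can be proved
  on the side of the chains without mentioning maximal arcs.\<close>

definition no_three_on_arc :: "real poly poly \<Rightarrow> real \<Rightarrow> point set \<Rightarrow> bool" where
  "no_three_on_arc g s P \<longleftrightarrow> (\<forall>y x1 x2 x3. x1 < x2 \<longrightarrow> x2 < x3 \<longrightarrow> convex_on {x1..x3} (\<lambda>x. s * y x) \<longrightarrow>
     (\<forall>x\<in>{x1..x3}. eval2 g (x, y x) = 0) \<longrightarrow> \<not> {(x1, y x1), (x2, y x2), (x3, y x3)} \<subseteq> P)"

section \<open>Counting the points of a chain that lie on arcs\<close>

context plane_curve
begin

text \<open>A height \<open>v\<close> over a vertical line at \<open>x\<close> to the right of the
  points serves as the name of an arc, since arcs that agree at \<open>x\<close> agree as far as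
  both are defined.\<close>

definition through :: "point set \<Rightarrow> real \<Rightarrow> real \<Rightarrow> point set" where
  "through P x v = {p \<in> P. \<exists>a b y. a < fst p \<and> fst p < x \<and> x < b \<and> arc {a<..<b} y \<and> y (fst p) = snd p \<and> y x = v}"

text \<open>The arc of the leftmost of three such points extends over the other two and, agreeing
  with their arcs at \<open>x\<close>, passes through them; by \<open>arc_convex\<close> this
  contradicts the hypothesis on \<open>P\<close>.\<close>

lemma card_through:
  assumes inj: "inj_on fst P" and bends: "\<And>p. p \<in> P \<Longrightarrow> bends p" and three: "no_three_on_arc g s P"
  shows "card (through P x v) \<le> 2"
proof (rule ccontr)
  assume "\<not> ?thesis"
  moreover have "inj_on fst (through P x v)"
    using inj by (rule inj_on_subset) (auto simp: through_def)
  ultimately obtain p q r where pqr: "p \<in> through P x v" "q \<in> through P x v" "r \<in> through P x v"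
    "fst p < fst q" "fst q < fst r"
    using three_sorted[of "through P x v"] by (metis not_less_eq_eq numeral_2_eq_2 numeral_3_eq_3)
  obtain a b y where y: "a < fst p" "x < b" "arc {a<..<b} y" "y (fst p) = snd p" "y x = v"
    using pqr(1) by (auto simp: through_def)
  have on: "y (fst t) = snd t" if t: "t \<in> through P x v" "fst p < fst t" for t
  proof -
    obtain a' b' z where z: "a' < fst t" "fst t < x" "x < b'" "arc {a'<..<b'} z" "z (fst t) = snd t" "z x = v"
      using t(1) by (auto simp: through_def)
    have "arc {max a a'<..<min b b'} y" "arc {max a a'<..<min b b'} z"
      by (auto intro: arc_subset[OF y(3)] arc_subset[OF z(4)])
    from arc_unique[OF this, of x "fst t"] show ?thesis
      using y z t(2) by auto
  qed
  have r: "fst r < x"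
    using pqr(3) by (auto simp: through_def)
  have sub: "{fst p..fst r} \<subseteq> {a<..<b}"
    using y r by auto
  have "bends (fst p, y (fst p))"
    using y(4) bends[of p] pqr(1) by (auto simp: through_def)
  moreover have "fst p \<in> {a<..<b}"
    using y r pqr by auto
  ultimately have "convex_on {a<..<b} (\<lambda>x. s * y x)"
    by (intro arc_convex[OF y(3)]) auto
  then have "convex_on {fst p..fst r} (\<lambda>x. s * y x)"
    by (rule convex_on_subset) (use sub in auto)
  moreover have "\<forall>x\<in>{fst p..fst r}. eval2 g (x, y x) = 0"
    using y(3) sub by (auto simp: arc_def)
  moreover have "{(fst p, y (fst p)), (fst q, y (fst q)), (fst r, y (fst r))} \<subseteq> P"
    using y(4) on[OF pqr(2)] on[OF pqr(3)] pqr by (auto simp: through_def)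
  ultimately show False
    using three pqr(4,5) unfolding no_three_on_arc_def by blast
qed

text \<open>The arcs cross the vertical line at \<open>x\<close> in at most \<open>degree g\<close>
  heights, and each height accounts for at most two points.\<close>

lemma card_beyond:
  assumes inj: "inj_on fst P" and bends: "\<And>p. p \<in> P \<Longrightarrow> bends p" and three: "no_three_on_arc g s P"
    and lc: "poly (lead_coeff g) x \<noteq> 0" and "finite P"
    and E: "E \<subseteq> P" "\<And>p. p \<in> E \<Longrightarrow> \<exists>a b y. a < fst p \<and> fst p < x \<and> x < b \<and> arc {a<..<b} y \<and> y (fst p) = snd p"
  shows "card E \<le> 2 * degree g"
proof -
  define R where "R = {v. eval2 g (x, v) = 0}"
  have R: "finite R" "card R \<le> degree g"
    using card_vertical_zeros[OF lc] by (auto simp: R_def)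
  have "E \<subseteq> (\<Union>v\<in>R. through P x v)"
  proof
    fix p
    assume p: "p \<in> E"
    then obtain a b y where y: "a < fst p" "fst p < x" "x < b" "arc {a<..<b} y" "y (fst p) = snd p"
      using E(2) by blast
    then have "y x \<in> R"
      by (auto simp: R_def arc_def)
    moreover have "p \<in> through P x (y x)"
      unfolding through_def using y p E(1) by blast
    ultimately show "p \<in> (\<Union>v\<in>R. through P x v)"
      by blast
  qed
  moreover have "finite (\<Union>v\<in>R. through P x v)"
    using \<open>finite P\<close> by (rule rev_finite_subset) (auto simp: through_def)
  ultimately have "card E \<le> card (\<Union>v\<in>R. through P x v)"
    by (intro card_mono)
  also have "\<dots> \<le> (\<Sum>v\<in>R. card (through P x v))"
    using R(1) by (rule card_UN_le)
  also have "\<dots> \<le> of_nat (card R) * 2"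
    by (intro sum_bounded_above card_through inj bends three)
  also have "\<dots> \<le> 2 * degree g"
    using R(2) by simp
  finally show ?thesis .
qed

text \<open>Each point is charged to the right end of its maximal arc: a removed point
  (\<open>E1\<close>), a vertical asymptote (\<open>E2\<close>) or infinity
  (\<open>E3\<close>).\<close>

lemma card_points_on_arcs:
  assumes inj: "inj_on fst P" and bends: "\<And>p. p \<in> P \<Longrightarrow> bends p" and three: "no_three_on_arc g s P"
    and finP: "finite P" and regular: "\<And>p. p \<in> P \<Longrightarrow> eval2 g p = 0 \<and> eval2 Q p \<noteq> 0"
    and finS: "finite {p. eval2 g p = 0 \<and> eval2 Q p = 0}" and "g \<noteq> 0"
  shows "card P \<le> 2 * card {p. eval2 g p = 0 \<and> eval2 Q p = 0} +
    2 * degree g * (card {b. poly (lead_coeff g) b = 0} + 1)"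
proof -
  define \<Sigma> R where "\<Sigma> = {p. eval2 g p = 0 \<and> eval2 Q p = 0}" and "R = {b. poly (lead_coeff g) b = 0}"
  define E1 where "E1 \<sigma> = {p \<in> P. \<exists>a y. a < fst p \<and> fst p < fst \<sigma> \<and> arc {a<..<fst \<sigma>} y \<and> y (fst p) = snd p \<and>
      (y \<longlongrightarrow> snd \<sigma>) (at_left (fst \<sigma>))}" for \<sigma>
  define E2 where "E2 b = {p \<in> P. \<exists>a y. a < fst p \<and> fst p < b \<and> arc {a<..<b} y \<and> y (fst p) = snd p}" for b
  define E3 where "E3 = {p \<in> P. \<exists>a y. a < fst p \<and> arc {a<..} y \<and> y (fst p) = snd p}"
  have finR: "finite R"
    using \<open>g \<noteq> 0\<close> by (simp add: R_def poly_roots_finite)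
  have cover: "P \<subseteq> (\<Union>\<sigma>\<in>\<Sigma>. E1 \<sigma>) \<union> ((\<Union>b\<in>R. E2 b) \<union> E3)"
  proof
    fix p
    assume p: "p \<in> P"
    obtain a y where y: "a < fst p" "y (fst p) = snd p"
      "arc {a<..} y \<or> (\<exists>b>fst p. arc {a<..<b} y \<and> (\<forall>b'>b. \<forall>z. z (fst p) = snd p \<longrightarrow> \<not> arc {a<..<b'} z))"
      using maximal_arc[of "fst p" "snd p"] regular[OF p] by auto
    from y(3) show "p \<in> (\<Union>\<sigma>\<in>\<Sigma>. E1 \<sigma>) \<union> ((\<Union>b\<in>R. E2 b) \<union> E3)"
    proof
      assume "arc {a<..} y"
      then show ?thesis
        using p y(1,2) unfolding E3_def by blast
    next
      assume "\<exists>b>fst p. arc {a<..<b} y \<and> (\<forall>b'>b. \<forall>z. z (fst p) = snd p \<longrightarrow> \<not> arc {a<..<b'} z)"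
      then obtain b where b: "fst p < b" "arc {a<..<b} y" "\<And>b' z. b' > b \<Longrightarrow> z (fst p) = snd p \<Longrightarrow> \<not> arc {a<..<b'} z"
        by blast
      have "bends (fst p, y (fst p))"
        using y(2) bends[OF p] by simp
      then consider L where "(y \<longlongrightarrow> L) (at_left b)" "eval2 g (b, L) = 0" "eval2 Q (b, L) = 0"
        | "filterlim (\<lambda>x. s * y x) at_top (at_left b)"
        using right_end[OF b(2) y(1) b(1)] b(3) y(2) by metis
      then show ?thesis
      proof cases
        case 1
        then have "(b, L) \<in> \<Sigma>" "p \<in> E1 (b, L)"
          using p y b unfolding \<Sigma>_def E1_def by auto
        then show ?thesis
          by blast
      next
        case 2
        then have "b \<in> R" "p \<in> E2 b"
          using asymptote[OF b(2) _ 2] p y b unfolding R_def E2_def by auto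
        then show ?thesis
          by blast
      qed
    qed
  qed
  have E1: "card (E1 \<sigma>) \<le> 2" if \<sigma>: "\<sigma> \<in> \<Sigma>" for \<sigma>
  proof (cases "E1 \<sigma> = {}")
    case False
    then obtain p0 where p0: "p0 \<in> E1 \<sigma>"
      by blast
    have finE: "finite (E1 \<sigma>)"
      using finP by (rule rev_finite_subset) (auto simp: E1_def)
    \<comment> \<open>An abscissa between all points charged to \<open>\<sigma>\<close> and
      \<open>\<sigma>\<close> itself: all their arcs agree there, so one height serves for all of
      them.\<close>
    define x where "x = (Max (fst ` E1 \<sigma>) + fst \<sigma>) / 2"
    have "Max (fst ` E1 \<sigma>) < fst \<sigma>"
      using finE False by (subst Max_less_iff) (auto simp: E1_def)
    then have x: "Max (fst ` E1 \<sigma>) < x" "x < fst \<sigma>"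
      by (auto simp: x_def)
    have before: "fst p < x" if "p \<in> E1 \<sigma>" for p
      using le_less_trans[OF Max_ge[OF finite_imageI[OF finE] imageI[OF that]] x(1)] .
    obtain a y where y: "a < fst p0" "fst p0 < fst \<sigma>" "arc {a<..<fst \<sigma>} y" "y (fst p0) = snd p0"
      "(y \<longlongrightarrow> snd \<sigma>) (at_left (fst \<sigma>))" "p0 \<in> P"
      using p0 by (auto simp: E1_def)
    have "E1 \<sigma> \<subseteq> through P x (y x)"
    proof
      fix p
      assume p: "p \<in> E1 \<sigma>"
      then obtain a' z where z: "a' < fst p" "fst p < fst \<sigma>" "arc {a'<..<fst \<sigma>} z" "z (fst p) = snd p"
        "(z \<longlongrightarrow> snd \<sigma>) (at_left (fst \<sigma>))" "p \<in> P"
        by (auto simp: E1_def)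
      have "bends (fst p0, y (fst p0))" "bends (fst p, z (fst p))"
        using bends y(4,6) z(4,6) by auto
      then have "z x = y x"
        using arcs_with_same_end[OF z(3,1,2) _ z(5) y(3,1,2) _ y(5), of x] \<sigma> before[OF p] before[OF p0] x(2) y(1) z(1)
        by (simp add: \<Sigma>_def)
      then show "p \<in> through P x (y x)"
        unfolding through_def using z before[OF p] x(2) by blast
    qed
    moreover have "finite (through P x (y x))"
      using finP by (rule rev_finite_subset) (auto simp: through_def)
    ultimately show ?thesis
      using card_mono card_through[OF inj bends three] le_trans by metis
  qed simp
  \<comment> \<open>The roots of the leading coefficient must be avoided, as the bound on the number
    of heights needs it to be nonzero.\<close>
  have ex: "\<exists>x. M < x \<and> x < b \<and> poly (lead_coeff g) x \<noteq> 0" if "M < b" for M b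
  proof -
    have "infinite ({M<..<b} - R)"
      using that finR infinite_Ioo by (simp add: Diff_infinite_finite)
    then obtain x where "x \<in> {M<..<b} - R"
      by (metis ex_in_conv finite.emptyI)
    then show ?thesis
      by (auto simp: R_def)
  qed
  have E2: "card (E2 b) \<le> 2 * degree g" for b
  proof (cases "E2 b = {}")
    case False
    have finE: "finite (E2 b)"
      using finP by (rule rev_finite_subset) (auto simp: E2_def)
    have "Max (fst ` E2 b) < b"
      using finE False by (subst Max_less_iff) (auto simp: E2_def)
    then obtain x where x: "Max (fst ` E2 b) < x" "x < b" "poly (lead_coeff g) x \<noteq> 0"
      using ex by blast
    have before: "fst p < x" if "p \<in> E2 b" for p
      using le_less_trans[OF Max_ge[OF finite_imageI[OF finE] imageI[OF that]] x(1)] .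
    show ?thesis
    proof (rule card_beyond[OF inj bends three x(3) finP])
      fix p
      assume p: "p \<in> E2 b"
      then obtain a y where "a < fst p" "arc {a<..<b} y" "y (fst p) = snd p"
        by (auto simp: E2_def)
      then show "\<exists>a b y. a < fst p \<and> fst p < x \<and> x < b \<and> arc {a<..<b} y \<and> y (fst p) = snd p"
        using before[OF p] x(2) by blast
    qed (auto simp: E2_def)
  qed simp
  have E3: "card E3 \<le> 2 * degree g"
  proof (cases "E3 = {}")
    case False
    have finE: "finite E3"
      using finP by (rule rev_finite_subset) (auto simp: E3_def)
    obtain x where x: "Max (fst ` E3) < x" "poly (lead_coeff g) x \<noteq> 0"
      using ex[of "Max (fst ` E3)" "Max (fst ` E3) + 1"] by auto
    have before: "fst p < x" if "p \<in> E3" for p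
      using le_less_trans[OF Max_ge[OF finite_imageI[OF finE] imageI[OF that]] x(1)] .
    show ?thesis
    proof (rule card_beyond[OF inj bends three x(2) finP])
      fix p
      assume p: "p \<in> E3"
      then obtain a y where y: "a < fst p" "arc {a<..} y" "y (fst p) = snd p"
        by (auto simp: E3_def)
      then have "arc {a<..<x + 1} y"
        by (auto intro: arc_subset[OF y(2)])
      then show "\<exists>a b y. a < fst p \<and> fst p < x \<and> x < b \<and> arc {a<..<b} y \<and> y (fst p) = snd p"
        using before[OF p] y by (intro exI[of _ a] exI[of _ "x + 1"] exI[of _ y]) auto
    qed (auto simp: E3_def)
  qed simp
  have finE: "finite (\<Union>\<sigma>\<in>\<Sigma>. E1 \<sigma>)" "finite (\<Union>b\<in>R. E2 b)" "finite E3"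
    using finP by (rule rev_finite_subset; auto simp: E1_def E2_def E3_def)+
  have "card P \<le> card ((\<Union>\<sigma>\<in>\<Sigma>. E1 \<sigma>) \<union> ((\<Union>b\<in>R. E2 b) \<union> E3))"
    using finE cover by (intro card_mono) auto
  also have "\<dots> \<le> card (\<Union>\<sigma>\<in>\<Sigma>. E1 \<sigma>) + (card (\<Union>b\<in>R. E2 b) + card E3)"
    by (meson add_left_mono card_Un_le le_trans)
  also have "card (\<Union>\<sigma>\<in>\<Sigma>. E1 \<sigma>) \<le> (\<Sum>\<sigma>\<in>\<Sigma>. card (E1 \<sigma>))"
    using finS by (intro card_UN_le) (simp add: \<Sigma>_def)
  also have "\<dots> \<le> of_nat (card \<Sigma>) * 2"
    by (rule sum_bounded_above) (rule E1)
  also have "card (\<Union>b\<in>R. E2 b) \<le> (\<Sum>b\<in>R. card (E2 b))"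
    using finR by (rule card_UN_le)
  also have "\<dots> \<le> of_nat (card R) * (2 * degree g)"
    by (rule sum_bounded_above) (rule E2)
  finally show ?thesis
    using E3 by (simp add: \<Sigma>_def R_def algebra_simps)
qed

end

section \<open>The removed points and the two kinds of arcs of an irreducible curve\<close>

lemma not_dvd_pderiv:
  fixes g :: "real poly poly"
  assumes "degree g > 0"
  shows "\<not> g dvd pderiv g"
proof
  assume "g dvd pderiv g"
  moreover have "pderiv g \<noteq> 0"
    using assms by (simp add: pderiv_eq_0_iff)
  ultimately have "degree g \<le> degree (pderiv g)"
    by (rule dvd_imp_degree_le)
  then show False
    using assms by (simp add: degree_pderiv)
qed

lemma total_degree_add_le: "total_degree f \<le> d \<Longrightarrow> total_degree h \<le> d \<Longrightarrow> total_degree (f + h) \<le> d"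
  unfolding total_degree_le_iff by (metis add.right_neutral coeff_add)

lemma total_degree_diff_le: "total_degree f \<le> d \<Longrightarrow> total_degree h \<le> d \<Longrightarrow> total_degree (f - h) \<le> d"
  unfolding total_degree_le_iff by (metis coeff_diff diff_0_right)

lemma total_degree_hess_le: "total_degree (hess g) \<le> 3 * total_degree g"
proof -
  let ?d = "total_degree g"
  have prod: "total_degree (p * q) \<le> m + n" if "total_degree p \<le> m" "total_degree q \<le> n" for p q m n
    using total_degree_mult_le[of p q] that by linarith
  have one: "total_degree (dx g) \<le> ?d" "total_degree (pderiv g) \<le> ?d"
    by (rule total_degree_dx_le total_degree_pderiv_le)+
  then have two: "total_degree (dx (dx g)) \<le> ?d" "total_degree (dx (pderiv g)) \<le> ?d" "total_degree (pderiv (pderiv g)) \<le> ?d"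
    using total_degree_dx_le total_degree_pderiv_le le_trans by blast+
  have "total_degree [:[:2:]:] \<le> 0"
    unfolding total_degree_le_iff by (auto simp: coeff_pCons split: nat.splits)
  then have "total_degree ([:[:2:]:] * dx (pderiv g) * dx g * pderiv g) \<le> 0 + ?d + ?d + ?d"
    using one two by (intro prod)
  moreover have "total_degree (dx (dx g) * (pderiv g * pderiv g)) \<le> ?d + (?d + ?d)"
    "total_degree (pderiv (pderiv g) * (dx g * dx g)) \<le> ?d + (?d + ?d)"
    using one two by (simp_all only: prod)
  ultimately show ?thesis
    unfolding hess_def power2_eq_square by (intro total_degree_add_le total_degree_diff_le) auto
qed

text \<open>\<open>B 1\<close> and \<open>B (- 1)\<close> hold the points at which the curve is
  convex and concave. The bound \<open>10 d^2\<close> allows two points on the arc into each of at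
  most \<open>4 d^2\<close> removed points and on each of at most \<open>d^2\<close> arcs going to
  an asymptote or to infinity.\<close>

lemma curve_decomposition:
  fixes g :: "real poly poly"
  defines "d \<equiv> total_degree g"
  assumes g: "irreducible g" "nonsingular g" "degree g > 0"
  obtains \<Sigma> B where "finite \<Sigma>" "card \<Sigma> \<le> 4 * d ^ 2" "zero_set g \<subseteq> \<Sigma> \<union> B 1 \<union> B (- 1)"
    "\<And>s P. \<lbrakk>s = 1 \<or> s = - 1; P \<subseteq> B s; finite P; inj_on fst P; no_three_on_arc g s P\<rbrakk> \<Longrightarrow> card P \<le> 10 * d ^ 2"
proof -
  \<comment> \<open>Bezout's inequality needs \<open>g\<close> not to divide \<open>Q\<close>, so
    the factor \<open>hess g\<close> is dropped when \<open>g\<close> divides it; the second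
    alternative of \<open>flex\<close> then holds.\<close>
  define Q where "Q = (if g dvd hess g then pderiv g else pderiv g * hess g)"
  have "prime_elem g"
    using g(1) by (rule irreducible_imp_prime_elem)
  then have ndvd: "\<not> g dvd Q"
    using not_dvd_pderiv[OF g(3)] by (simp add: Q_def prime_elem_dvd_mult_iff)
  have "total_degree Q \<le> 4 * d"
    using total_degree_mult_le[of "pderiv g" "hess g"] total_degree_hess_le[of g] total_degree_pderiv_le[of g]
    by (simp add: Q_def d_def)
  then have bound: "d * total_degree Q \<le> 4 * d ^ 2"
    using mult_le_mono2[of "total_degree Q" "4 * d" d] by (simp add: power2_eq_square)
  define \<Sigma> where "\<Sigma> = {p. eval2 g p = 0 \<and> eval2 Q p = 0}"
  \<comment> \<open>Bezout's inequality speaks of finite sets of common zeros; a uniform bound on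
    these makes \<open>\<Sigma>\<close> itself finite.\<close>
  have "finite F \<and> card F \<le> d * total_degree Q" if "finite F" "F \<subseteq> \<Sigma>" for F
    using bezout_inequality[OF g(1) ndvd that(1)] that by (auto simp: \<Sigma>_def zero_set_def d_def)
  then have \<Sigma>: "finite \<Sigma>" "card \<Sigma> \<le> d * total_degree Q"
    using finite_if_finite_subsets_card_bdd[of \<Sigma> "d * total_degree Q"] by blast+
  \<comment> \<open>The two sets may overlap, and on a straight curve they coincide; together with
    \<open>\<Sigma>\<close> they only have to cover the curve.\<close>
  define B where "B s = {p. eval2 g p = 0 \<and> eval2 Q p \<noteq> 0 \<and> s * eval2 (hess g) p * eval2 (pderiv g) p \<le> 0}" for s
  have curve: "plane_curve g Q s" if "s = 1 \<or> s = - 1" for s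
  proof
    show "eval2 (dx g) p \<noteq> 0 \<or> eval2 (pderiv g) p \<noteq> 0" if "eval2 g p = 0" for p
      using nonsingular_gradient[OF g(2) that] .
    show "eval2 (pderiv g) p \<noteq> 0" if "eval2 g p = 0" "eval2 Q p \<noteq> 0" for p
      using that by (auto simp: Q_def eval2_mult split: if_splits)
    show "(\<forall>p. eval2 g p = 0 \<and> eval2 Q p \<noteq> 0 \<longrightarrow> eval2 (hess g) p \<noteq> 0) \<or> (\<forall>p. eval2 g p = 0 \<longrightarrow> eval2 (hess g) p = 0)"
    proof (cases "g dvd hess g")
      case True
      then show ?thesis
        by (metis dvdE eval2_mult mult_zero_left)
    next
      case False
      then show ?thesis
        by (simp add: Q_def eval2_mult)
    qed
  qed (use that in auto)
  have count: "card P \<le> 10 * d ^ 2"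
    if P: "s = 1 \<or> s = - 1" "P \<subseteq> B s" "finite P" "inj_on fst P" "no_three_on_arc g s P" for s P
  proof -
    interpret plane_curve g Q s
      using curve[OF P(1)] .
    have "g \<noteq> 0"
      using g(3) by auto
    have "card P \<le> 2 * card \<Sigma> + 2 * degree g * (card {b. poly (lead_coeff g) b = 0} + 1)"
      unfolding \<Sigma>_def using P \<Sigma> \<open>g \<noteq> 0\<close>
      by (intro card_points_on_arcs) (auto simp: B_def bends_def \<Sigma>_def)
    \<comment> \<open>The leading coefficient has degree at most \<open>d - e\<close>, and
      \<open>e\<close> is positive, so even with infinity added there are at most \<open>d\<close>
      ends, each shared by at most \<open>e \<le> d\<close> arcs.\<close>
    moreover have "degree g * (card {b. poly (lead_coeff g) b = 0} + 1) \<le> d * d"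
    proof -
      define e c where "e = degree g" and "c = card {b. poly (lead_coeff g) b = 0}"
      have "c \<le> degree (lead_coeff g)"
        using \<open>g \<noteq> 0\<close> card_poly_roots_bound[of "lead_coeff g"] by (simp add: c_def)
      moreover have "degree (lead_coeff g) + e \<le> d"
        using le_total_degree[of g "degree g" "degree (lead_coeff g)"] \<open>g \<noteq> 0\<close> by (simp add: d_def e_def)
      ultimately have "e \<le> d" "c + 1 \<le> d"
        using g(3) by (auto simp: e_def)
      then have "e * (c + 1) \<le> d * d"
        by (rule mult_le_mono)
      then show ?thesis
        by (simp add: e_def c_def)
    qed
    moreover have "card \<Sigma> \<le> 4 * (d * d)"
      using \<Sigma>(2) bound unfolding power2_eq_square by (rule le_trans)
    ultimately show ?thesis
      unfolding power2_eq_square mult.assoc by linarith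
  qed
  have "zero_set g \<subseteq> \<Sigma> \<union> B 1 \<union> B (- 1)"
    by (auto simp: \<Sigma>_def B_def zero_set_def)
  from that[OF \<Sigma>(1) le_trans[OF \<Sigma>(2) bound] this count] show ?thesis .
qed

section \<open>Convex chains of k-edges\<close>

definition line_slope :: "point \<Rightarrow> point \<Rightarrow> real" where
  "line_slope p q = (snd q - snd p) / (fst q - fst p)"

text \<open>The signed vertical height of \<open>p\<close> above the line through \<open>l\<close>
  and \<open>r\<close>.\<close>

definition excess :: "point \<Rightarrow> point \<Rightarrow> point \<Rightarrow> real" where
  "excess l r p = snd p - snd l - line_slope l r * (fst p - fst l)"

lemma line_slope_commute: "line_slope p q = line_slope q p"
  unfolding line_slope_def by (metis minus_diff_eq minus_divide_divide)

lemma snd_via_line_slope: "fst p \<noteq> fst q \<Longrightarrow> snd q = snd p + line_slope p q * (fst q - fst p)"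
  by (simp add: line_slope_def)

lemma excess_ends: "excess l r l = 0" "fst l \<noteq> fst r \<Longrightarrow> excess l r r = 0"
  by (simp_all add: excess_def line_slope_def)

lemma excess_base: "excess l r p = excess l r q + (snd p - snd q) - line_slope l r * (fst p - fst q)"
  by (simp add: excess_def algebra_simps)

lemma excess_commute: "fst l \<noteq> fst r \<Longrightarrow> excess l r p = excess r l p"
  using excess_base[of l r p r] excess_ends(2)[of l r] by (simp add: excess_def line_slope_commute)

lemma on_line:
  assumes "fst l \<noteq> fst r" "excess l r q = 0"
  defines "v \<equiv> (fst q - fst l) / (fst r - fst l)"
  shows "q = (1 - v) *\<^sub>R l + v *\<^sub>R r"
proof -
  have x: "v * (fst r - fst l) = fst q - fst l"
    using assms(1) by (simp add: v_def)
  have "snd q - snd l = line_slope l r * (v * (fst r - fst l))"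
    unfolding x using assms(2) by (simp add: excess_def)
  also have "\<dots> = v * (snd r - snd l)"
    using snd_via_line_slope[OF assms(1)] by simp
  finally show ?thesis
    using x by (simp add: prod_eq_iff algebra_simps)
qed

lemma halfplane_below_iff:
  assumes "fst l \<noteq> fst r"
  shows "p \<in> halfplane_below l r \<longleftrightarrow> excess l r p < 0"
proof -
  have line: "q \<in> affine hull {l, r} \<longleftrightarrow> excess l r q = 0" for q
  proof
    assume "q \<in> affine hull {l, r}"
    then obtain u v where uv: "q = u *\<^sub>R l + v *\<^sub>R r" "u + v = 1"
      by (auto simp: affine_hull_2)
    then have "u = 1 - v"
      by simp
    with uv(1) have "fst q = (1 - v) * fst l + v * fst r" "snd q = (1 - v) * snd l + v * snd r"
      by simp_all
    then have q: "fst q - fst l = v * (fst r - fst l)" "snd q - snd l = v * (snd r - snd l)"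
      by (simp_all add: algebra_simps)
    show "excess l r q = 0"
      using assms unfolding excess_def q by (simp add: line_slope_def)
  next
    assume 0: "excess l r q = 0"
    define v where "v = (fst q - fst l) / (fst r - fst l)"
    have "q = (1 - v) *\<^sub>R l + v *\<^sub>R r"
      unfolding v_def using assms 0 by (rule on_line)
    then show "q \<in> affine hull {l, r}"
      unfolding affine_hull_2 by (intro CollectI exI[of _ "1 - v"] exI[of _ v]) simp
  qed
  define q where "q = (fst p, snd p - excess l r p)"
  have q: "excess l r q = 0" "fst q = fst p"
    by (simp_all add: q_def excess_def)
  have unique: "snd q' = snd q" if "excess l r q' = 0" "fst q' = fst p" for q'
    using that by (simp add: q_def excess_def)
  have "p \<in> halfplane_below l r \<longleftrightarrow> (\<exists>q'. excess l r q' = 0 \<and> fst q' = fst p \<and> snd p < snd q')"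
    unfolding halfplane_below_def by (simp add: line Bex_def)
  also have "\<dots> \<longleftrightarrow> snd p < snd q"
    using q unique by metis
  also have "\<dots> \<longleftrightarrow> excess l r p < 0"
    by (simp add: q_def)
  finally show ?thesis .
qed

text \<open>Ordering the ends from left to right gives every edge one representative and the sweep
  its direction of motion.\<close>

definition edge_pairs :: "point set \<Rightarrow> nat \<Rightarrow> (point \<times> point) set" where
  "edge_pairs S k = {(l, r). l \<in> S \<and> r \<in> S \<and> fst l < fst r \<and> card {q \<in> S. excess l r q < 0} = k}"

definition segment :: "point \<times> point \<Rightarrow> point set" where
  "segment e = closed_segment (fst e) (snd e)"

lemma k_edges_eq:
  assumes "no_vertical_line S"
  shows "k_edges S k = segment ` edge_pairs S k"
proof (intro equalityI subsetI)
  fix e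
  assume "e \<in> k_edges S k"
  then obtain x y where xy: "e = closed_segment x y" "x \<in> S" "y \<in> S" "x \<noteq> y" "card (S \<inter> halfplane_below x y) = k"
    by (auto simp: k_edges_def)
  then have ne: "fst x \<noteq> fst y"
    using assms by (auto simp: no_vertical_line_def)
  then have "S \<inter> halfplane_below x y = {q \<in> S. excess x y q < 0}"
    by (auto simp: halfplane_below_iff)
  moreover from ne have "S \<inter> halfplane_below x y = {q \<in> S. excess y x q < 0}"
    using excess_commute[of x y] by (auto simp: halfplane_below_iff)
  ultimately have "(x, y) \<in> edge_pairs S k \<or> (y, x) \<in> edge_pairs S k"
    using xy ne by (auto simp: edge_pairs_def)
  then show "e \<in> segment ` edge_pairs S k"
    using xy(1) by (force simp: segment_def closed_segment_commute)
next
  fix e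
  assume "e \<in> segment ` edge_pairs S k"
  then obtain l r where lr: "e = closed_segment l r" "l \<in> S" "r \<in> S" "fst l < fst r" "card {q \<in> S. excess l r q < 0} = k"
    by (auto simp: edge_pairs_def segment_def)
  then have "S \<inter> halfplane_below l r = {q \<in> S. excess l r q < 0}"
    by (auto simp: halfplane_below_iff)
  with lr show "e \<in> k_edges S k"
    unfolding k_edges_def by (intro CollectI exI[of _ l] exI[of _ r]) auto
qed

lemma mem_segment:
  assumes "fst l < fst r"
  shows "p \<in> segment (l, r) \<longleftrightarrow> fst l \<le> fst p \<and> fst p \<le> fst r \<and> excess l r p = 0"
proof
  assume "p \<in> segment (l, r)"
  then obtain u where u: "0 \<le> u" "u \<le> 1" "p = (1 - u) *\<^sub>R l + u *\<^sub>R r"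
    by (auto simp: segment_def closed_segment_def)
  then have "fst p = (1 - u) * fst l + u * fst r" "snd p = (1 - u) * snd l + u * snd r"
    by simp_all
  then have p: "fst p - fst l = u * (fst r - fst l)" "snd p - snd l = u * (snd r - snd l)"
    by (simp_all add: algebra_simps)
  have "0 \<le> fst p - fst l" "fst p - fst l \<le> 1 * (fst r - fst l)"
    unfolding p(1) using u assms by (intro mult_nonneg_nonneg mult_right_mono; simp)+
  moreover have "excess l r p = 0"
    using assms unfolding excess_def p by (simp add: line_slope_def)
  ultimately show "fst l \<le> fst p \<and> fst p \<le> fst r \<and> excess l r p = 0"
    by simp
next
  assume p: "fst l \<le> fst p \<and> fst p \<le> fst r \<and> excess l r p = 0"
  define u where "u = (fst p - fst l) / (fst r - fst l)"
  have "p = (1 - u) *\<^sub>R l + u *\<^sub>R r"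
    unfolding u_def using assms p by (intro on_line) auto
  moreover have "0 \<le> u" "u \<le> 1"
    using p assms by (auto simp: u_def)
  ultimately show "p \<in> segment (l, r)"
    by (auto simp: segment_def closed_segment_def)
qed

lemma equal_slopes_collinear:
  assumes "fst p \<noteq> fst q" "fst p \<noteq> fst r" "line_slope p q = line_slope p r"
  shows "collinear {p, q, r}"
proof -
  have line: "snd t = snd p + line_slope p q * (fst t - fst p)" if "t \<in> {p, q, r}" for t
    using that snd_via_line_slope[of p q] snd_via_line_slope[of p r] assms by auto
  then have diff: "t - t' = (fst t - fst t') *\<^sub>R (1, line_slope p q)" if "t \<in> {p, q, r}" "t' \<in> {p, q, r}" for t t'
    using line[OF that(1)]
      line[OF that(2)]
    by (simp add: prod_eq_iff algebra_simps)
  show ?thesis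
    unfolding collinear_def by (intro exI[of _ "(1, line_slope p q)"] ballI exI) (rule diff)
qed

section \<open>Ranks of points with respect to lines of a given slope\<close>

locale planar_points =
  fixes S :: "point set"
  assumes fin: "finite S" and general: "general_position S" and no_vertical: "no_vertical_line S"
begin

lemma inj_fst: "inj_on fst S"
  using no_vertical by (auto simp: inj_on_def no_vertical_line_def)

lemma distinct_slopes:
  assumes "p \<in> S" "q \<in> S" "r \<in> S" "p \<noteq> q" "p \<noteq> r" "q \<noteq> r"
  shows "line_slope p q \<noteq> line_slope p r"
proof
  assume "line_slope p q = line_slope p r"
  then have "collinear {p, q, r}"
    using assms no_vertical by (intro equal_slopes_collinear) (auto simp: no_vertical_line_def)
  moreover have "card {p, q, r} = 3" "{p, q, r} \<subseteq> S"
    using assms by auto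
  ultimately show False
    using general by (auto simp: general_position_def)
qed

text \<open>Of two parallel lines through points of \<open>S\<close>, the upper one has strictly
  more points below it, so parallel k-edges lie on one line, which contains only two points of
  \<open>S\<close>. The sweep therefore meets one edge at a time.\<close>

lemma edge_pairs_distinct_slopes:
  assumes e: "(l, r) \<in> edge_pairs S k" "(l', r') \<in> edge_pairs S k" "line_slope l r = line_slope l' r'"
  shows "l = l' \<and> r = r'"
proof -
  define c where "c q = snd q - line_slope l r * fst q" for q
  have ex: "excess l r q = c q - c l" "excess l' r' q = c q - c l'" for q
    using e(3) by (simp_all add: excess_def c_def algebra_simps)
  have S: "l \<in> S" "r \<in> S" "l' \<in> S" "r' \<in> S" and lr: "fst l < fst r" "fst l' < fst r'"
    and card: "card {q \<in> S. c q < c l} = k" "card {q \<in> S. c q < c l'} = k"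
    using e by (auto simp: edge_pairs_def ex)
  have cr: "c r = c l" "c r' = c l'"
    using excess_ends(2)[of l r] excess_ends(2)[of l' r'] lr ex[of r] ex[of r'] by auto
  have no: "\<not> c x < c x'" if "x \<in> S" "card {q \<in> S. c q < c x} = k" "card {q \<in> S. c q < c x'} = k" for x x'
  proof
    assume "c x < c x'"
    then have "{q \<in> S. c q < c x} \<subset> {q \<in> S. c q < c x'}"
      using that(1) by auto
    then show False
      using psubset_card_mono[of "{q \<in> S. c q < c x'}"] fin that by auto
  qed
  have "c l = c l'"
    using no[of l l'] no[of l' l] S card by linarith
  then have c: "c x = c l" if "x \<in> {l, r, l', r'}" for x
    using that cr by auto
  have "x = l \<or> x = r" if x: "x \<in> {l', r'}" for x
  proof (rule ccontr)
    assume "\<not> (x = l \<or> x = r)"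
    then have ne: "l \<noteq> x" "r \<noteq> x" "l \<noteq> r" "x \<in> S"
      using x S lr by auto
    have "fst x \<noteq> fst l"
      using inj_onD[OF inj_fst _ ne(4) S(1)] ne(1) by metis
    moreover have "c x = c l"
      using x by (intro c) blast
    then have "snd x - snd l = line_slope l r * (fst x - fst l)"
      by (simp add: c_def algebra_simps)
    ultimately have "line_slope l x = line_slope l r"
      by (simp add: line_slope_def[of l x])
    then show False
      using distinct_slopes[of l x r] ne S by auto
  qed
  from this[of l'] this[of r'] show ?thesis
    using lr by auto
qed

text \<open>rank_at v t counts the points below the line of slope t through v, rank_after v t those below the
  lines of slope slightly larger than t.\<close>

definition rank_at :: "point \<Rightarrow> real \<Rightarrow> nat" where
  "rank_at v t = card {q \<in> S. fst v < fst q \<and> line_slope v q < t} + card {q \<in> S. fst q < fst v \<and> t < line_slope v q}"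

definition rank_after :: "point \<Rightarrow> real \<Rightarrow> nat" where
  "rank_after v t = card {q \<in> S. fst v < fst q \<and> line_slope v q \<le> t} + card {q \<in> S. fst q < fst v \<and> t < line_slope v q}"

lemma rank_at_le_rank_after: "rank_at v t \<le> rank_after v t"
  unfolding rank_at_def rank_after_def using fin by (intro add_right_mono card_mono) auto

text \<open>A point to the right of \<open>v\<close> is below a line through \<open>v\<close> if the
  slope from \<open>v\<close> to it is smaller than that of the line, a point to the left if it is
  larger.\<close>

lemma rank_at_edge:
  assumes v: "v \<in> S" and u: "u \<in> S" "fst u \<noteq> fst v"
  shows "card {q \<in> S. excess v u q < 0} = rank_at v (line_slope v u)"
proof -
  have "{q \<in> S. excess v u q < 0} =
      {q \<in> S. fst v < fst q \<and> line_slope v q < line_slope v u} \<union> {q \<in> S. fst q < fst v \<and> line_slope v u < line_slope v q}"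
  proof -
    have "excess v u q < 0 \<longleftrightarrow> fst v < fst q \<and> line_slope v q < line_slope v u \<or> fst q < fst v \<and> line_slope v u < line_slope v q" if "q \<in> S" for q
    proof (cases "q = v")
      case False
      then have "fst q \<noteq> fst v"
        using that v no_vertical by (auto simp: no_vertical_line_def)
      then have "excess v u q = (line_slope v q - line_slope v u) * (fst q - fst v)"
        using snd_via_line_slope[of v q] by (simp add: excess_def algebra_simps)
      then show ?thesis
        using \<open>fst q \<noteq> fst v\<close> by (auto simp: mult_less_0_iff)
    qed (simp add: excess_ends)
    then show ?thesis
      by auto
  qed
  then show ?thesis
    unfolding rank_at_def using fin by (simp add: card_Un_disjoint disjoint_iff)
qed

lemma edge_pairs_iff:
  "(l, r) \<in> edge_pairs S k \<longleftrightarrow> l \<in> S \<and> r \<in> S \<and> fst l < fst r \<and> rank_at l (line_slope l r) = k"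
  "(l, r) \<in> edge_pairs S k \<longleftrightarrow> l \<in> S \<and> r \<in> S \<and> fst l < fst r \<and> rank_at r (line_slope l r) = k"
proof -
  show "(l, r) \<in> edge_pairs S k \<longleftrightarrow> l \<in> S \<and> r \<in> S \<and> fst l < fst r \<and> rank_at l (line_slope l r) = k"
    using rank_at_edge[of l r] by (auto simp: edge_pairs_def)
  have "{q \<in> S. excess l r q < 0} = {q \<in> S. excess r l q < 0}" if "fst l < fst r"
    using excess_commute[of l r] that by auto
  then show "(l, r) \<in> edge_pairs S k \<longleftrightarrow> l \<in> S \<and> r \<in> S \<and> fst l < fst r \<and> rank_at r (line_slope l r) = k"
    using rank_at_edge[of r l] by (auto simp: edge_pairs_def line_slope_commute[of r l])
qed

text \<open>The rank of v drops only at the slopes of lines through a point to the left of v, each time by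
  one, so on its way from above k to at most k it passes k at a k-edge.\<close>

lemma edge_at_rank_drop:
  assumes v: "v \<in> S" and ab: "a < b" and high: "k < rank_after v a" and low: "rank_at v b \<le> k"
  obtains q where "(q, v) \<in> edge_pairs S k" "a < line_slope q v" "line_slope q v \<le> b"
proof -
  \<comment> \<open>Ranks change only at slopes of lines through \<open>v\<close>, so the first
    slope at which the rank is at most \<open>k\<close> can be sought among finitely many
    candidates.\<close>
  define Y where "Y = {y \<in> insert b (line_slope v ` S). a < y \<and> y \<le> b \<and> rank_at v y \<le> k}"
  have Y: "finite Y" "Y \<noteq> {}"
    using fin ab low by (auto simp: Y_def)
  define y where "y = Min Y"
  have "y \<in> Y"
    using Y Min_in by (simp add: y_def)
  then have y: "a < y" "y \<le> b" "rank_at v y \<le> k"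
    by (auto simp: Y_def)
  \<comment> \<open>\<open>y'\<close> is the last critical slope before \<open>y\<close>, or
    \<open>a\<close> if there is none. Just after it the rank still exceeds \<open>k\<close>, and it
    stays constant up to \<open>y\<close>.\<close>
  define X where "X = insert a {t \<in> line_slope v ` S. a < t \<and> t < y}"
  have X: "finite X" "X \<noteq> {}"
    using fin by (auto simp: X_def)
  define y' where "y' = Max X"
  have "y' \<in> X"
    using X Max_in by (simp add: y'_def)
  then have y': "a \<le> y'" "y' < y"
    using y by (auto simp: X_def)
  have "k < rank_after v y'"
  proof (cases "y' = a")
    case False
    then have "y' \<in> line_slope v ` S" "a < y'"
      using \<open>y' \<in> X\<close> by (auto simp: X_def)
    have "\<not> rank_at v y' \<le> k"
    proof
      assume "rank_at v y' \<le> k"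
      then have "y' \<in> Y"
        using \<open>y' \<in> line_slope v ` S\<close> \<open>a < y'\<close> y y' by (simp add: Y_def)
      then show False
        using Min_le[OF Y(1)] y'(2) by (fastforce simp: y_def)
    qed
    then show ?thesis
      using rank_at_le_rank_after[of v y'] by linarith
  qed (use high in simp)
  have between: "line_slope v q \<le> y' \<longleftrightarrow> line_slope v q < y" if "q \<in> S" for q
  proof
    assume "line_slope v q < y"
    show "line_slope v q \<le> y'"
    proof (cases "a < line_slope v q")
      case True
      then have "line_slope v q \<in> X"
        using that \<open>line_slope v q < y\<close> by (simp add: X_def)
      then show ?thesis
        using X(1) by (simp add: y'_def)
    qed (use y' in simp)
  qed (use y' in simp)
  \<comment> \<open>The points that stop being below as the line reaches slope \<open>y\<close>.
    General position allows only one, so the rank falls from \<open>k + 1\<close> to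
    \<open>k\<close>.\<close>
  define D where "D = {q \<in> S. fst q < fst v \<and> line_slope v q = y}"
  have eq1: "{q \<in> S. fst v < fst q \<and> line_slope v q \<le> y'} = {q \<in> S. fst v < fst q \<and> line_slope v q < y}"
    using between by blast
  have eq2: "{q \<in> S. fst q < fst v \<and> y' < line_slope v q} = {q \<in> S. fst q < fst v \<and> y < line_slope v q} \<union> D"
    using between by (force simp: D_def not_le[symmetric])
  have "rank_after v y' = rank_at v y + card D"
    unfolding rank_after_def rank_at_def eq1 eq2 using fin
    by (subst card_Un_disjoint) (auto simp: D_def)
  moreover have "card D \<le> 1"
  proof (rule card_le_Suc0_iff_eq[THEN iffD2, unfolded One_nat_def[symmetric]])
    show "\<forall>q\<in>D. \<forall>q'\<in>D. q = q'"
    proof (intro ballI, rule ccontr)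
      fix q q'
      assume q: "q \<in> D" "q' \<in> D" "q \<noteq> q'"
      then have "v \<noteq> q" "v \<noteq> q'"
        by (auto simp: D_def)
      then have "line_slope v q \<noteq> line_slope v q'"
        using q v by (intro distinct_slopes) (auto simp: D_def)
      then show False
        using q by (simp add: D_def)
    qed
  qed (use fin in \<open>simp add: D_def\<close>)
  ultimately have "rank_at v y = k" "D \<noteq> {}"
    using y(3) \<open>k < rank_after v y'\<close> by auto
  then obtain q where "q \<in> S" "fst q < fst v" "line_slope v q = y"
    by (auto simp: D_def)
  then show ?thesis
    using that[of q] y \<open>rank_at v y = k\<close> v by (simp add: edge_pairs_iff(2) line_slope_commute[of q v])
qed

end

section \<open>Convex chains and their intersections with concave graphs\<close>

definition chain_points :: "(point \<times> point) set \<Rightarrow> point set" where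
  "chain_points C = \<Union> (segment ` C)"

lemma mem_chain_points: "p \<in> chain_points C \<longleftrightarrow> (\<exists>l r. (l, r) \<in> C \<and> p \<in> segment (l, r))"
  by (auto simp: chain_points_def)

text \<open>Convexity of a chain is expressed by supporting lines, which also forces strictness: distinct
  edges lie on distinct lines.\<close>

definition convex_chain :: "(point \<times> point) set \<Rightarrow> bool" where
  "convex_chain C \<longleftrightarrow> (\<forall>(l, r)\<in>C. fst l < fst r \<and> (\<forall>p\<in>chain_points C. excess l r p > 0 \<or> p \<in> segment (l, r)))"

lemma convex_chainD:
  assumes "convex_chain C" "(l, r) \<in> C"
  shows "fst l < fst r" "p \<in> chain_points C \<Longrightarrow> excess l r p > 0 \<or> p \<in> segment (l, r)"
  using assms by (auto simp: convex_chain_def)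

lemma convex_chain_nonneg:
  assumes "convex_chain C" "(l, r) \<in> C" "p \<in> chain_points C"
  shows "excess l r p \<ge> 0"
  using convex_chainD(1)[OF assms(1,2)] convex_chainD(2)[OF assms] mem_segment[of l r p] by auto

text \<open>Of two points with the same abscissa, each lies on or above a supporting line through
  the other.\<close>

lemma convex_chain_inj:
  assumes "convex_chain C"
  shows "inj_on fst (chain_points C)"
proof (rule inj_onI)
  fix p q
  assume p: "p \<in> chain_points C" and q: "q \<in> chain_points C" and eq: "fst p = fst q"
  have le: "snd p \<le> snd q" if pq: "p \<in> chain_points C" "q \<in> chain_points C" "fst p = fst q" for p q
  proof -
    obtain l r where lr: "(l, r) \<in> C" "p \<in> segment (l, r)"
      using pq(1) unfolding mem_chain_points by blast
    then have "excess l r p = 0"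
      using assms mem_segment[of l r p] by (auto simp: convex_chain_def)
    moreover have "excess l r q \<ge> 0"
      using convex_chain_nonneg[OF assms lr(1) pq(2)] .
    ultimately show ?thesis
      using excess_base[of l r q p] pq(3) by simp
  qed
  show "p = q"
    using le[OF p q eq] le[OF q p eq[symmetric]] eq by (simp add: prod_eq_iff)
qed

text \<open>All three points lie on or above the line of the edge through the middle one, so concavity forces
  the graph to run along that line.\<close>

lemma convex_chain_concave_graph:
  assumes C: "convex_chain C" and y: "convex_on {x1..x3} (\<lambda>x. - y x)"
    and x: "x1 < x2" "x2 < x3" and on: "{(x1, y x1), (x2, y x2), (x3, y x3)} \<subseteq> chain_points C"
    and t: "t \<in> {x1..x3}"
  shows "(t, y t) \<in> chain_points C"
proof -
  have "(x2, y x2) \<in> chain_points C"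
    using on by simp
  then obtain l r where lr: "(l, r) \<in> C" "(x2, y x2) \<in> segment (l, r)"
    unfolding mem_chain_points by blast
  then have less: "fst l < fst r"
    using C by (auto simp: convex_chain_def)
  \<comment> \<open>The height of the graph above the line of the edge: a concave function,
    nonnegative at the outer points and 0 at the middle one, hence 0 throughout.\<close>
  define h where "h x = excess l r (x, y x)" for x
  have h: "h x = y x - (snd l + line_slope l r * (x - fst l))" for x
    by (simp add: h_def excess_def)
  have concave: "(1 - u) * h a + u * h b \<le> h ((1 - u) * a + u * b)"
    if "a \<in> {x1..x3}" "b \<in> {x1..x3}" "0 \<le> u" "u \<le> 1" for a b u
  proof -
    have "- y ((1 - u) *\<^sub>R a + u *\<^sub>R b) \<le> (1 - u) * - y a + u * - y b"
      using convex_onD[OF y, of u a b] that by simp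
    then show ?thesis
      unfolding h by (simp add: algebra_simps)
  qed
  have h0: "h x2 = 0" "h x1 \<ge> 0" "h x3 \<ge> 0"
    using convex_chain_nonneg[OF C lr(1)] on lr(2) mem_segment[OF less, of "(x2, y x2)"] by (auto simp: h_def)
  have between: "h x2 \<ge> (1 - u) * h a + u * h b \<and> 0 < u \<and> u < 1"
    if "u = (x2 - a) / (b - a)" "a \<in> {x1..x3}" "b \<in> {x1..x3}" "a < x2" "x2 < b" for a b u
  proof -
    have u: "0 < u" "u < 1"
      using that by auto
    have "u * (b - a) = x2 - a"
      using that by simp
    then have "(1 - u) * a + u * b = x2"
      by (simp add: algebra_simps)
    with concave[of a b u] that(2,3) u show ?thesis
      by simp
  qed
  have zero: "h a = 0 \<and> h b = 0" if "a \<in> {x1..x3}" "b \<in> {x1..x3}" "a < x2" "x2 < b" "h a \<ge> 0" "h b \<ge> 0" for a b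
  proof -
    define u where "u = (x2 - a) / (b - a)"
    have u: "(1 - u) * h a + u * h b \<le> 0" "0 < u" "u < 1"
      using between[OF u_def that(1-4)] h0(1) by auto
    moreover have "0 \<le> (1 - u) * h a" "0 \<le> u * h b"
      using u that by auto
    ultimately have "(1 - u) * h a = 0" "u * h b = 0"
      by linarith+
    then show ?thesis
      using u by simp
  qed
  have ends: "h x1 = 0" "h x3 = 0"
    using zero[of x1 x3] x h0 by auto
  have nonneg: "h t \<ge> 0"
  proof -
    define u where "u = (t - x1) / (x3 - x1)"
    have "0 \<le> u" "u \<le> 1"
      using t x by (auto simp: u_def)
    moreover have "u * (x3 - x1) = t - x1"
      using x by (simp add: u_def)
    then have "(1 - u) * x1 + u * x3 = t"
      by (simp add: algebra_simps)
    ultimately show ?thesis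
      using concave[of x1 x3 u] x ends by simp
  qed
  have ht: "h t = 0"
  proof (cases t x2 rule: linorder_cases)
    case less
    then show ?thesis
      using zero[of t x3] t x nonneg h0 by auto
  next
    case greater
    then show ?thesis
      using zero[of x1 t] t x nonneg h0 by auto
  qed (simp add: h0)
  \<comment> \<open>Points of the chain off this edge are strictly above its line, so height 0 puts
    the outer points on the edge itself.\<close>
  have "(z, y z) \<in> segment (l, r)" if "z \<in> {x1, x3}" for z
  proof -
    have "(z, y z) \<in> chain_points C" "excess l r (z, y z) = 0"
      using that on ends by (auto simp: h_def)
    then show ?thesis
      using convex_chainD(2)[OF C lr(1)] by force
  qed
  from this[of x1] this[of x3] have "fst l \<le> x1" "x3 \<le> fst r"
    using mem_segment[OF less] by auto
  then have "(t, y t) \<in> segment (l, r)"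
    using mem_segment[OF less] t ht by (auto simp: h_def)
  then show ?thesis
    using lr(1) by (auto simp: chain_points_def)
qed

text \<open>The new edge starts on the chain, hence on or above every old supporting line, and rises
  faster than each of them; conversely \<open>old\<close> keeps the old points above its own
  line.\<close>

lemma convex_chain_insert:
  assumes C: "convex_chain C" and lr: "fst l < fst r"
    and steeper: "\<And>l' r'. (l', r') \<in> C \<Longrightarrow> line_slope l' r' < line_slope l r"
    and l: "C = {} \<or> l \<in> chain_points C"
    and old: "\<And>p. p \<in> chain_points C \<Longrightarrow> p = l \<or> excess l r p > 0"
  shows "convex_chain (insert (l, r) C)"
proof -
  have points: "chain_points (insert (l, r) C) = segment (l, r) \<union> chain_points C"
    by (simp add: chain_points_def)
  have "l \<in> segment (l, r)"
    by (simp add: segment_def)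
  then have "excess l r p > 0 \<or> p \<in> segment (l, r)" if "p \<in> chain_points (insert (l, r) C)" for p
    using that old unfolding points by blast
  moreover have "excess l' r' p > 0 \<or> p \<in> segment (l', r')"
    if e: "(l', r') \<in> C" and p: "p \<in> chain_points (insert (l, r) C)" for l' r' p
  proof (cases "p \<in> chain_points C")
    case True
    then show ?thesis
      using convex_chainD(2)[OF C e] by blast
  next
    case False
    have l: "l \<in> chain_points C"
      using l e by auto
    then have "p \<noteq> l" "p \<in> segment (l, r)"
      using False p points by auto
    then have seg: "fst l \<le> fst p" "excess l r p = 0"
      using mem_segment[OF lr] by auto
    then have snd: "snd p - snd l = line_slope l r * (fst p - fst l)"
      by (simp add: excess_def)
    have "fst l \<noteq> fst p"
      using snd \<open>p \<noteq> l\<close> by (auto simp: prod_eq_iff)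
    then have "0 < (line_slope l r - line_slope l' r') * (fst p - fst l)"
      using seg(1) steeper[OF e] by simp
    moreover have "excess l' r' p = excess l' r' l + (line_slope l r - line_slope l' r') * (fst p - fst l)"
      using excess_base[of l' r' p l] snd by (simp add: algebra_simps)
    ultimately show ?thesis
      using convex_chain_nonneg[OF C e l] by linarith
  qed
  ultimately show ?thesis
    using lr C unfolding convex_chain_def by fastforce
qed

section \<open>The sweep by slope\<close>

context planar_points
begin

lemma finite_edge_pairs: "finite (edge_pairs S k)"
  by (rule finite_subset[of _ "S \<times> S"]) (use fin in \<open>auto simp: edge_pairs_def\<close>)

text \<open>For a slope smaller than those of all spanned lines, the rank of a point is the number
  of points to its left. These are thus the starting points of the sweep.\<close>

lemma card_leftmost: "card {v \<in> S. card {q \<in> S. fst q < fst v} \<le> k} \<le> k + 1"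
proof -
  define T where "T = {v \<in> S. card {q \<in> S. fst q < fst v} \<le> k}"
  have less: "card {q \<in> S. fst q < fst v} < card {q \<in> S. fst q < fst w}" if "v \<in> S" "fst v < fst w" for v w
    using fin that by (intro psubset_card_mono) auto
  have "inj_on (\<lambda>v. card {q \<in> S. fst q < fst v}) T"
  proof (rule inj_onI)
    fix v w
    assume vw: "v \<in> T" "w \<in> T" "card {q \<in> S. fst q < fst v} = card {q \<in> S. fst q < fst w}"
    then have "fst v = fst w"
      using less[of v w] less[of w v] by (cases "fst v" "fst w" rule: linorder_cases) (auto simp: T_def)
    then show "v = w"
      using inj_fst vw by (auto simp: T_def inj_on_def)
  qed
  moreover have "(\<lambda>v. card {q \<in> S. fst q < fst v}) ` T \<subseteq> {..k}"
    by (auto simp: T_def)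
  ultimately have "card T \<le> card {..k}"
    by (intro card_inj_on_le) auto
  then show ?thesis
    by (simp add: T_def)
qed

text \<open>State of a sweep by slope that has passed the slope a: from every starting point \<mu> a token has
  moved along the edges in chain \<mu> and is now at pos \<mu>; the tokens occupy all points of rank at
  most k.\<close>

definition sweep :: "nat \<Rightarrow> point set \<Rightarrow> (point \<Rightarrow> (point \<times> point) set) \<Rightarrow> (point \<Rightarrow> point) \<Rightarrow> real \<Rightarrow> bool" where
  "sweep k \<Lambda> chain pos a \<longleftrightarrow>
     (\<Union>\<mu>\<in>\<Lambda>. chain \<mu>) = {(l, r) \<in> edge_pairs S k. line_slope l r \<le> a} \<and>
     (\<forall>\<mu>\<in>\<Lambda>. convex_chain (chain \<mu>) \<and> (chain \<mu> = {} \<or> pos \<mu> \<in> chain_points (chain \<mu>)) \<and>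
       (\<forall>p\<in>chain_points (chain \<mu>). p = pos \<mu> \<or>
          fst p < fst (pos \<mu>) \<and> snd (pos \<mu>) - snd p \<le> a * (fst (pos \<mu>) - fst p))) \<and>
     {v \<in> S. rank_after v a \<le> k} \<subseteq> pos ` \<Lambda>"

text \<open>Between \<open>a\<close> and \<open>b\<close> only the edge from \<open>l\<close> to
  \<open>r\<close> is met. A rank can fall to at most \<open>k\<close> only at the right end of a
  k-edge, so \<open>l\<close> already had rank at most \<open>k\<close> and carries a token, and
  \<open>r\<close> is the only possible newcomer.\<close>

lemma sweep_step:
  assumes sw: "sweep k \<Lambda> chain pos a" and "a < b"
    and e: "(l, r) \<in> edge_pairs S k" "line_slope l r = b"
    and gap: "\<And>l' r'. (l', r') \<in> edge_pairs S k \<Longrightarrow> line_slope l' r' \<le> a \<or> b \<le> line_slope l' r'"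
  shows "\<exists>chain pos. sweep k \<Lambda> chain pos b"
proof -
  have lr: "l \<in> S" "r \<in> S" "fst l < fst r" "rank_at l b = k"
    using e edge_pairs_iff(1) by auto
  have chains: "(\<Union>\<mu>\<in>\<Lambda>. chain \<mu>) = {(l, r) \<in> edge_pairs S k. line_slope l r \<le> a}"
    and conv: "\<And>\<mu>. \<mu> \<in> \<Lambda> \<Longrightarrow> convex_chain (chain \<mu>)"
    and pos: "\<And>\<mu>. \<mu> \<in> \<Lambda> \<Longrightarrow> chain \<mu> = {} \<or> pos \<mu> \<in> chain_points (chain \<mu>)"
    and last: "\<And>\<mu> p. \<mu> \<in> \<Lambda> \<Longrightarrow> p \<in> chain_points (chain \<mu>) \<Longrightarrow> p = pos \<mu> \<or>
          fst p < fst (pos \<mu>) \<and> snd (pos \<mu>) - snd p \<le> a * (fst (pos \<mu>) - fst p)"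
    and low: "{v \<in> S. rank_after v a \<le> k} \<subseteq> pos ` \<Lambda>"
    using sw unfolding sweep_def by blast+
  have only: "l' = l \<and> r' = r" if "(l', r') \<in> edge_pairs S k" "a < line_slope l' r'" "line_slope l' r' \<le> b" for l' r'
    using that gap[OF that(1)] edge_pairs_distinct_slopes[OF that(1) e(1)] e(2) by auto
  have "rank_after l a \<le> k"
  proof (rule ccontr)
    assume "\<not> rank_after l a \<le> k"
    then obtain q where "(q, l) \<in> edge_pairs S k" "a < line_slope q l" "line_slope q l \<le> b"
      using edge_at_rank_drop[of l a b k] lr \<open>a < b\<close> by auto
    then show False
      using only[of q l] lr(3) by auto
  qed
  then have l_low: "l \<in> pos ` \<Lambda>"
    using low lr(1) by auto
  \<comment> \<open>Just past \<open>b\<close> the point \<open>r\<close> is below the line through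
    \<open>l\<close>, so the rank of \<open>l\<close> exceeds \<open>k\<close> and its place may be
    vacated.\<close>
  have "card {q \<in> S. fst l < fst q \<and> line_slope l q < b} < card {q \<in> S. fst l < fst q \<and> line_slope l q \<le> b}"
    using fin lr e(2) by (intro psubset_card_mono) auto
  then have l_high: "k < rank_after l b"
    using lr(4) by (simp add: rank_at_def rank_after_def)
  \<comment> \<open>Every token standing at \<open>l\<close> moves. Should there be several, the
    edge enters several chains, which is harmless as the chains only have to cover the
    edges.\<close>
  define chain' where "chain' \<mu> = (if pos \<mu> = l then insert (l, r) (chain \<mu>) else chain \<mu>)" for \<mu>
  define pos' where "pos' \<mu> = (if pos \<mu> = l then r else pos \<mu>)" for \<mu>
  have "{v \<in> S. rank_after v b \<le> k} \<subseteq> pos' ` \<Lambda>"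
  proof
    fix v
    assume v: "v \<in> {v \<in> S. rank_after v b \<le> k}"
    show "v \<in> pos' ` \<Lambda>"
    proof (cases "rank_after v a \<le> k")
      case True
      then obtain \<mu> where "\<mu> \<in> \<Lambda>" "v = pos \<mu>"
        using v low by auto
      moreover have "v \<noteq> l"
        using v l_high by auto
      ultimately show ?thesis
        by (auto simp: pos'_def)
    next
      case False
      then obtain q where "(q, v) \<in> edge_pairs S k" "a < line_slope q v" "line_slope q v \<le> b"
        using edge_at_rank_drop[of v a b k] v \<open>a < b\<close> rank_at_le_rank_after[of v b] by auto
      then have "v = r"
        using only by blast
      moreover obtain \<mu> where "\<mu> \<in> \<Lambda>" "pos \<mu> = l"
        using l_low by auto
      ultimately show ?thesis
        by (force simp: pos'_def)
    qed
  qed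
  moreover have "(\<Union>\<mu>\<in>\<Lambda>. chain' \<mu>) = {(l, r) \<in> edge_pairs S k. line_slope l r \<le> b}"
  proof -
    have "(\<Union>\<mu>\<in>\<Lambda>. chain' \<mu>) = insert (l, r) (\<Union>\<mu>\<in>\<Lambda>. chain \<mu>)"
      using l_low by (auto simp: chain'_def)
    also have "\<dots> = {(l, r) \<in> edge_pairs S k. line_slope l r \<le> b}"
      unfolding chains using only e \<open>a < b\<close> by force
    finally show ?thesis .
  qed
  moreover have "convex_chain (chain' \<mu>) \<and> (chain' \<mu> = {} \<or> pos' \<mu> \<in> chain_points (chain' \<mu>)) \<and>
       (\<forall>p\<in>chain_points (chain' \<mu>). p = pos' \<mu> \<or>
          fst p < fst (pos' \<mu>) \<and> snd (pos' \<mu>) - snd p \<le> b * (fst (pos' \<mu>) - fst p))" if \<mu>: "\<mu> \<in> \<Lambda>" for \<mu>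
  proof (cases "pos \<mu> = l")
    case False
    have "snd (pos \<mu>) - snd p \<le> b * (fst (pos \<mu>) - fst p)"
      if "fst p < fst (pos \<mu>)" "snd (pos \<mu>) - snd p \<le> a * (fst (pos \<mu>) - fst p)" for p
      using that mult_right_mono[of a b "fst (pos \<mu>) - fst p"] \<open>a < b\<close> by linarith
    then show ?thesis
      using False conv[OF \<mu>] pos[OF \<mu>] last[OF \<mu>] by (auto simp: chain'_def pos'_def)
  next
    case True
    \<comment> \<open>To the left of \<open>l\<close>, increasing the slope lowers the line through
      \<open>l\<close> strictly; this yields the strict inequality demanded by
      \<open>convex_chain_insert\<close>.\<close>
    have old: "p = l \<or> (fst p < fst l \<and> snd l - snd p < b * (fst l - fst p))" if "p \<in> chain_points (chain \<mu>)" for p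
    proof (cases "p = l")
      case False
      then have "fst p < fst l" "snd l - snd p \<le> a * (fst l - fst p)"
        using last[OF \<mu> that] True by auto
      moreover from this have "a * (fst l - fst p) < b * (fst l - fst p)"
        using \<open>a < b\<close> by (intro mult_strict_right_mono) auto
      ultimately show ?thesis
        by linarith
    qed simp
    have "convex_chain (insert (l, r) (chain \<mu>))"
    proof (rule convex_chain_insert[OF conv[OF \<mu>] lr(3)])
      show "line_slope l' r' < line_slope l r" if "(l', r') \<in> chain \<mu>" for l' r'
      proof -
        have "(l', r') \<in> (\<Union>\<mu>\<in>\<Lambda>. chain \<mu>)"
          using \<mu> that by blast
        then show ?thesis
          unfolding chains using e(2) \<open>a < b\<close> by simp
      qed
      show "chain \<mu> = {} \<or> l \<in> chain_points (chain \<mu>)"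
        using pos[OF \<mu>] True by simp
      show "p = l \<or> excess l r p > 0" if "p \<in> chain_points (chain \<mu>)" for p
        using old[OF that] e(2) by (auto simp: excess_def algebra_simps)
    qed
    moreover have "r \<in> chain_points (insert (l, r) (chain \<mu>))"
      by (simp add: chain_points_def segment_def)
    moreover have "p = r \<or> fst p < fst r \<and> snd r - snd p \<le> b * (fst r - fst p)"
      if p: "p \<in> chain_points (insert (l, r) (chain \<mu>))" for p
    proof -
      have r: "snd r - snd l = b * (fst r - fst l)"
        using snd_via_line_slope[of l r] lr(3) e(2) by simp
      have "p \<in> segment (l, r) \<or> p \<in> chain_points (chain \<mu>)"
        using p by (auto simp: chain_points_def)
      then have "fst p \<le> fst r \<and> snd r - snd p \<le> b * (fst r - fst p) \<and> (fst p = fst r \<longrightarrow> snd p = snd r)"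
      proof
        assume "p \<in> segment (l, r)"
        then have "fst p \<le> fst r" "snd p - snd l = b * (fst p - fst l)"
          using mem_segment[OF lr(3)] e(2) by (auto simp: excess_def)
        then show ?thesis
          using r by (auto simp: algebra_simps)
      next
        assume "p \<in> chain_points (chain \<mu>)"
        from old[OF this] show ?thesis
          using r lr(3) by (auto simp: algebra_simps)
      qed
      then show ?thesis
        by (auto simp: prod_eq_iff)
    qed
    ultimately show ?thesis
      using True by (auto simp: chain'_def pos'_def)
  qed
  ultimately have "sweep k \<Lambda> chain' pos' b"
    unfolding sweep_def by blast
  then show ?thesis
    by blast
qed

lemma convex_chain_cover:
  obtains F where "finite F" "card F \<le> k + 1" "\<Union>F = edge_pairs S k" "\<And>C. C \<in> F \<Longrightarrow> convex_chain C"
proof -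
  define X where "X = (\<lambda>(l, r). line_slope l r) ` edge_pairs S k"
  have finX: "finite X"
    using finite_edge_pairs by (simp add: X_def)
  \<comment> \<open>A slope before every event of the sweep; the inserted 0 guarantees a nonempty
    set.\<close>
  define a0 where "a0 = Min (insert 0 (X \<union> (\<lambda>(p, q). line_slope p q) ` (S \<times> S))) - 1"
  have "a0 < t" if "t \<in> X \<union> (\<lambda>(p, q). line_slope p q) ` (S \<times> S)" for t
  proof -
    have "Min (insert 0 (X \<union> (\<lambda>(p, q). line_slope p q) ` (S \<times> S))) \<le> t"
      using that finX fin by (intro Min_le) auto
    then show ?thesis
      by (simp add: a0_def)
  qed
  then have a0: "\<And>t. t \<in> X \<Longrightarrow> a0 < t" "\<And>p q. p \<in> S \<Longrightarrow> q \<in> S \<Longrightarrow> a0 < line_slope p q"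
    by force+
  define \<Lambda> where "\<Lambda> = {v \<in> S. card {q \<in> S. fst q < fst v} \<le> k}"
  have \<Lambda>: "finite \<Lambda>" "card \<Lambda> \<le> k + 1"
    using fin card_leftmost by (auto simp: \<Lambda>_def)
  \<comment> \<open>Induction over initial segments of the slopes of k-edges; closure of
    \<open>Y\<close> downwards in \<open>X\<close> says that no slope has been skipped.\<close>
  have "Y \<subseteq> X \<Longrightarrow> (\<forall>x\<in>X. \<forall>y\<in>Y. x \<le> y \<longrightarrow> x \<in> Y) \<Longrightarrow> \<exists>chain pos. sweep k \<Lambda> chain pos (Max (insert a0 Y))"
    if "finite Y" for Y
    using that
  proof (induction Y rule: finite_linorder_max_induct)
    case empty
    have "{q \<in> S. fst v < fst q \<and> line_slope v q \<le> a0} = {}" "{q \<in> S. fst q < fst v \<and> a0 < line_slope v q} = {q \<in> S. fst q < fst v}"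
      if "v \<in> S" for v
      using a0(2)[OF that] by force+
    then have "rank_after v a0 = card {q \<in> S. fst q < fst v}" if "v \<in> S" for v
      using that by (simp only: rank_after_def) simp
    then have "{v \<in> S. rank_after v a0 \<le> k} \<subseteq> (\<lambda>v. v) ` \<Lambda>"
      by (auto simp: \<Lambda>_def)
    moreover have "{(l, r) \<in> edge_pairs S k. line_slope l r \<le> a0} = {}"
      using a0(1) by (force simp: X_def)
    ultimately have "sweep k \<Lambda> (\<lambda>_. {}) (\<lambda>v. v) a0"
      unfolding sweep_def by (simp add: convex_chain_def chain_points_def)
    then show ?case
      by auto
  next
    case (insert b Y)
    have down: "\<forall>x\<in>X. \<forall>y\<in>Y. x \<le> y \<longrightarrow> x \<in> Y"
      using insert.prems insert.hyps(2) by fastforce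
    then obtain chain pos where sw: "sweep k \<Lambda> chain pos (Max (insert a0 Y))"
      using insert by blast
    obtain l r where e: "(l, r) \<in> edge_pairs S k" "line_slope l r = b"
      using insert.prems(1) by (auto simp: X_def)
    have "a0 < b"
      using insert.prems a0 by auto
    then have less: "Max (insert a0 Y) < b"
      using insert.hyps by (subst Max_less_iff) auto
    have "line_slope l' r' \<le> Max (insert a0 Y) \<or> b \<le> line_slope l' r'" if "(l', r') \<in> edge_pairs S k" for l' r'
    proof (rule ccontr)
      assume not: "\<not> ?thesis"
      have "line_slope l' r' \<in> X"
        using that by (force simp: X_def)
      then have "line_slope l' r' \<in> Y"
        using not insert.prems(2) by auto
      then show False
        using not insert.hyps(1) by auto
    qed
    from sweep_step[OF sw less e this] show ?case
      using less insert.hyps(1) by (simp add: insert_commute[of a0 b] max_absorb1 less_imp_le)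
  qed
  from this[OF finX] obtain chain pos where sw: "sweep k \<Lambda> chain pos (Max (insert a0 X))"
    by auto
  have "line_slope l r \<le> Max (insert a0 X)" if "(l, r) \<in> edge_pairs S k" for l r
    using finX that by (intro Max_ge) (force simp: X_def)+
  then have "{(l, r) \<in> edge_pairs S k. line_slope l r \<le> Max (insert a0 X)} = edge_pairs S k"
    by auto
  with sw have "\<Union>(chain ` \<Lambda>) = edge_pairs S k" "\<And>C. C \<in> chain ` \<Lambda> \<Longrightarrow> convex_chain C"
    unfolding sweep_def by auto
  moreover have "finite (chain ` \<Lambda>)" "card (chain ` \<Lambda>) \<le> k + 1"
    using \<Lambda> card_image_le[OF \<Lambda>(1), of chain] by auto
  ultimately show ?thesis
    using that by blast
qed

end

section \<open>Intersections of curves with the k-edge graph\<close>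

text \<open>The sign is that of the arcs to be met: concave chains have the property for
  \<open>1\<close>, convex chains for \<open>- 1\<close>.\<close>

definition contains_graphs :: "real \<Rightarrow> point set \<Rightarrow> bool" where
  "contains_graphs s U \<longleftrightarrow> (\<forall>y x1 x2 x3. x1 < x2 \<longrightarrow> x2 < x3 \<longrightarrow> convex_on {x1..x3} (\<lambda>x. s * y x) \<longrightarrow>
     {(x1, y x1), (x2, y x2), (x3, y x3)} \<subseteq> U \<longrightarrow> (\<forall>t\<in>{x1..x3}. (t, y t) \<in> U))"

text \<open>An arc through three points of \<open>U\<close> would run inside \<open>U\<close> over a
  whole interval and give infinitely many intersection points.\<close>

lemma contains_graphs_imp_no_three_on_arc:
  assumes U: "contains_graphs s U" and fin: "finite (zero_set g \<inter> U)" and P: "P \<subseteq> U"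
  shows "no_three_on_arc g s P"
  unfolding no_three_on_arc_def
proof (intro allI impI notI)
  fix y x1 x2 x3
  assume x: "x1 < x2" "x2 < x3" "convex_on {x1..x3} (\<lambda>x. s * y x)" "\<forall>x\<in>{x1..x3}. eval2 g (x, y x) = 0"
    "{(x1, y x1), (x2, y x2), (x3, y x3)} \<subseteq> P"
  then have "\<forall>t\<in>{x1..x3}. (t, y t) \<in> U"
    using U P unfolding contains_graphs_def by (meson subset_trans)
  then have "(\<lambda>t. (t, y t)) ` {x1..x3} \<subseteq> zero_set g \<inter> U"
    using x(4) by (auto simp: zero_set_def)
  then have "finite ((\<lambda>t. (t, y t)) ` {x1..x3})"
    using fin by (rule finite_subset)
  then have "finite {x1..x3}"
    by (rule finite_imageD) (simp add: inj_on_def)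
  then show False
    using x(1,2) infinite_Icc[of x1 x3] by simp
qed

lemma (in planar_points) cover_by_convex_chains:
  obtains F where "finite F" "card F \<le> k + 1" "\<Union>F = \<Union>(k_edges S k)"
    "\<And>U. U \<in> F \<Longrightarrow> inj_on fst U \<and> contains_graphs (- 1) U"
proof -
  obtain F where F: "finite F" "card F \<le> k + 1" "\<Union>F = edge_pairs S k" "\<And>C. C \<in> F \<Longrightarrow> convex_chain C"
    using convex_chain_cover[of k] by blast
  have "\<Union>(chain_points ` F) = \<Union>(segment ` \<Union>F)"
    by (auto simp: chain_points_def)
  then have "\<Union>(chain_points ` F) = \<Union>(k_edges S k)"
    using F(3) k_edges_eq[OF no_vertical] by simp
  moreover have "contains_graphs (- 1) (chain_points C)" if C: "C \<in> F" for C
    unfolding contains_graphs_def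
  proof (intro allI impI ballI)
    fix y x1 x2 x3 t
    assume x: "x1 < x2" "x2 < x3" and conv: "convex_on {x1..x3} (\<lambda>x. - 1 * y x)"
      and on: "{(x1, y x1), (x2, y x2), (x3, y x3)} \<subseteq> chain_points C" and t: "t \<in> {x1..x3}"
    have "convex_on {x1..x3} (\<lambda>x. - y x)"
      using conv by simp
    from convex_chain_concave_graph[OF F(4)[OF C] this x on t] show "(t, y t) \<in> chain_points C" .
  qed
  ultimately show ?thesis
    using F card_image_le[OF F(1), of chain_points] convex_chain_inj
    by (intro that[of "chain_points ` F"]) auto
qed

section \<open>Reflection in the horizontal axis and concave chains\<close>

definition reflect :: "point \<Rightarrow> point" where
  "reflect p = (fst p, - snd p)"

lemma reflect_simps [simp]: "fst (reflect p) = fst p" "snd (reflect p) = - snd p" "reflect (reflect p) = p"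
  by (simp_all add: reflect_def)

lemma linear_reflect: "linear reflect"
  by (intro linearI) (auto simp: reflect_def)

lemma inj_reflect: "inj reflect"
  by (metis injI reflect_simps(3))

lemma collinear_reflect:
  assumes "collinear T"
  shows "collinear (reflect ` T)"
proof -
  obtain u where u: "\<And>x y. x \<in> T \<Longrightarrow> y \<in> T \<Longrightarrow> \<exists>c. x - y = c *\<^sub>R u"
    using assms unfolding collinear_def by blast
  have "\<exists>c. reflect x - reflect y = c *\<^sub>R reflect u" if "x \<in> T" "y \<in> T" for x y
    using u[OF that] linear_diff[OF linear_reflect] linear_cmul[OF linear_reflect] by metis
  then show ?thesis
    unfolding collinear_def by blast
qed

lemma excess_reflect: "excess (reflect l) (reflect r) (reflect p) = - excess l r p"
  by (simp add: excess_def line_slope_def diff_divide_distrib algebra_simps)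

lemma segment_reflect: "segment (reflect l, reflect r) = reflect ` segment (l, r)"
  by (simp add: segment_def closed_segment_linear_image[OF linear_reflect])

context planar_points
begin

lemma planar_points_reflect: "planar_points (reflect ` S)"
proof
  show "finite (reflect ` S)"
    using fin by simp
  show "no_vertical_line (reflect ` S)"
    using no_vertical by (auto simp: no_vertical_line_def)
  have "\<not> collinear T" if T: "T \<subseteq> reflect ` S" "card T = 3" for T
  proof
    assume "collinear T"
    then have "collinear (reflect ` T)"
      by (rule collinear_reflect)
    moreover have "reflect ` T \<subseteq> S" "card (reflect ` T) = 3"
      using T inj_reflect by (auto simp: card_image inj_on_subset)
    ultimately show False
      using general by (auto simp: general_position_def)
  qed
  moreover have "card (reflect ` S) = card S"
    by (rule card_image) (rule inj_on_subset[OF inj_reflect subset_UNIV])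
  ultimately show "general_position (reflect ` S)"
    using general fin by (simp add: general_position_def)
qed

text \<open>By general position the line of an edge contains no points of \<open>S\<close> but its
  two ends.\<close>

lemma card_below_above:
  assumes "l \<in> S" "r \<in> S" "fst l < fst r"
  shows "card {q \<in> S. excess l r q < 0} + card {q \<in> S. excess l r q > 0} + 2 = card S"
proof -
  have "q = l \<or> q = r" if q: "q \<in> S" "excess l r q = 0" for q
  proof (rule ccontr)
    assume not: "\<not> (q = l \<or> q = r)"
    then have "fst q \<noteq> fst l"
      using inj_onD[OF inj_fst _ q(1) assms(1)] by auto
    then have "line_slope l q = line_slope l r"
      using q(2) by (simp add: excess_def line_slope_def[of l q] field_simps)
    then show False
      using distinct_slopes[of l q r] not assms q(1) by auto
  qed
  then have "S = ({q \<in> S. excess l r q < 0} \<union> {q \<in> S. excess l r q > 0}) \<union> {l, r}"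
    using assms by (auto simp: not_less) (metis less_eq_real_def linorder_le_less_linear)
  also have "card \<dots> = card ({q \<in> S. excess l r q < 0} \<union> {q \<in> S. excess l r q > 0}) + card {l, r}"
    using fin assms by (intro card_Un_disjoint) (auto simp: excess_ends)
  also have "card ({q \<in> S. excess l r q < 0} \<union> {q \<in> S. excess l r q > 0}) =
      card {q \<in> S. excess l r q < 0} + card {q \<in> S. excess l r q > 0}"
    using fin by (intro card_Un_disjoint) auto
  also have "card {l, r} = 2"
    using less_imp_neq[OF assms(3)] by (subst card_2_iff) blast
  finally show ?thesis
    by simp
qed

text \<open>Abscissas are kept, so the orientation of edges is too, while the points above an edge
  become the points below it.\<close>

lemma edge_pairs_reflect:
  assumes "k \<le> card S - 2"
  shows "edge_pairs (reflect ` S) (card S - 2 - k) = map_prod reflect reflect ` edge_pairs S k"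
proof -
  have eq: "(reflect l, reflect r) \<in> edge_pairs (reflect ` S) (card S - 2 - k) \<longleftrightarrow> (l, r) \<in> edge_pairs S k"
    if lr: "l \<in> S" "r \<in> S" for l r
  proof (cases "fst l < fst r")
    case True
    have "{q \<in> reflect ` S. excess (reflect l) (reflect r) q < 0} = reflect ` {q \<in> S. excess l r q > 0}"
      by (auto simp: excess_reflect)
    then have "card {q \<in> reflect ` S. excess (reflect l) (reflect r) q < 0} = card {q \<in> S. excess l r q > 0}"
      using inj_reflect by (simp add: card_image inj_on_subset)
    then show ?thesis
      using True lr card_below_above[OF lr True] assms unfolding edge_pairs_def by auto
  qed (simp add: edge_pairs_def)
  show ?thesis
  proof (intro equalityI subsetI)
    fix e
    assume e: "e \<in> edge_pairs (reflect ` S) (card S - 2 - k)"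
    then obtain l r where "e = (reflect l, reflect r)" "l \<in> S" "r \<in> S"
      by (auto simp: edge_pairs_def)
    moreover from this have "(l, r) \<in> edge_pairs S k"
      using e eq by simp
    ultimately show "e \<in> map_prod reflect reflect ` edge_pairs S k"
      by (intro image_eqI[of _ _ "(l, r)"]) auto
  next
    fix e
    assume "e \<in> map_prod reflect reflect ` edge_pairs S k"
    then obtain l r where "e = (reflect l, reflect r)" "(l, r) \<in> edge_pairs S k"
      unfolding map_prod_def by (metis (no_types, lifting) case_prod_conv imageE surj_pair)
    moreover from this have "l \<in> S" "r \<in> S"
      by (auto simp: edge_pairs_def)
    ultimately show "e \<in> edge_pairs (reflect ` S) (card S - 2 - k)"
      using eq by simp
  qed
qed

text \<open>The reflected edges are covered by convex chains, which reflect back to concave chains;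
  this replaces a second sweep following the upper points.\<close>

lemma cover_by_concave_chains:
  assumes k: "k \<le> card S - 2"
  obtains F where "finite F" "card F \<le> card S - 2 - k + 1" "\<Union>F = \<Union>(k_edges S k)"
    "\<And>U. U \<in> F \<Longrightarrow> inj_on fst U \<and> contains_graphs 1 U"
proof -
  interpret R: planar_points "reflect ` S"
    by (rule planar_points_reflect)
  obtain F where F: "finite F" "card F \<le> card S - 2 - k + 1" "\<Union>F = \<Union>(k_edges (reflect ` S) (card S - 2 - k))"
    "\<And>U. U \<in> F \<Longrightarrow> inj_on fst U \<and> contains_graphs (- 1) U"
    using R.cover_by_convex_chains by blast
  have "\<Union>(k_edges (reflect ` S) (card S - 2 - k)) = (\<Union>e\<in>edge_pairs S k. segment (map_prod reflect reflect e))"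
    unfolding k_edges_eq[OF R.no_vertical] edge_pairs_reflect[OF k] by auto
  also have "\<dots> = reflect ` (\<Union>e\<in>edge_pairs S k. segment e)"
    unfolding image_UN by (intro SUP_cong) (auto simp: segment_reflect)
  also have "(\<Union>e\<in>edge_pairs S k. segment e) = \<Union>(k_edges S k)"
    unfolding k_edges_eq[OF no_vertical] by auto
  finally have "\<Union>((`) reflect ` F) = reflect ` reflect ` \<Union>(k_edges S k)"
    using F(3) by (metis image_Union)
  then have "\<Union>((`) reflect ` F) = \<Union>(k_edges S k)"
    by (simp add: image_comp)
  moreover have "inj_on fst (reflect ` U) \<and> contains_graphs 1 (reflect ` U)" if "U \<in> F" for U
  proof
    show "inj_on fst (reflect ` U)"
      using F(4)[OF that] by (auto simp: inj_on_def)
    have mem: "(t, z) \<in> reflect ` U \<longleftrightarrow> (t, - z) \<in> U" for t z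
      by (force simp: reflect_def image_iff)
    show "contains_graphs 1 (reflect ` U)"
      unfolding contains_graphs_def
    proof (intro allI impI ballI)
      fix y x1 x2 x3 t
      assume "x1 < x2" "x2 < x3" "convex_on {x1..x3} (\<lambda>x. 1 * y x)"
        "{(x1, y x1), (x2, y x2), (x3, y x3)} \<subseteq> reflect ` U" "t \<in> {x1..x3}"
      then show "(t, y t) \<in> reflect ` U"
        using conjunct2[OF F(4)[OF that], unfolded contains_graphs_def, rule_format, of x1 x2 x3 "\<lambda>x. - y x" t]
        by (simp add: mem)
    qed
  qed
  ultimately show ?thesis
    using F card_image_le[OF F(1), of "(`) reflect"] by (intro that[of "(`) reflect ` F"]) auto
qed

text \<open>The curve consists of at most \<open>total_degree g\<close> vertical lines, and each
  meets each of the \<open>k + 1\<close> chains at most once.\<close>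

lemma card_vertical_curve:
  assumes "degree g = 0" "g \<noteq> 0" and k: "k \<le> card S - 2" and S: "3 \<le> card S"
  shows "card (zero_set g \<inter> \<Union>(k_edges S k)) \<le> card S * total_degree g"
proof -
  obtain h where h: "g = [:h:]" "h \<noteq> 0"
    using assms(1,2) by (metis degree_eq_zeroE pCons_eq_0_iff)
  define R where "R = {x. poly h x = 0}"
  have "degree h \<le> total_degree g"
    using le_total_degree[of g 0 "degree h"] h by simp
  then have R: "finite R" "card R \<le> total_degree g"
    using h(2) poly_roots_finite[of h] card_poly_roots_bound[of h] by (auto simp: R_def)
  have zero: "zero_set g = {p. fst p \<in> R}"
    by (simp add: zero_set_def eval2_def h R_def)
  obtain F where F: "finite F" "card F \<le> k + 1" "\<Union>F = \<Union>(k_edges S k)"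
    "\<And>U. U \<in> F \<Longrightarrow> inj_on fst U \<and> contains_graphs (- 1) U"
    using cover_by_convex_chains by blast
  have U: "card (zero_set g \<inter> U) \<le> total_degree g" if "U \<in> F" for U
  proof -
    have "card (zero_set g \<inter> U) \<le> card R"
      using F(4)[OF that] R(1) by (intro card_inj_on_le[of fst]) (auto simp: zero inj_on_def)
    then show ?thesis
      using R(2) by simp
  qed
  have "zero_set g \<inter> \<Union>(k_edges S k) = (\<Union>U\<in>F. zero_set g \<inter> U)"
    using F(3) by auto
  then have "card (zero_set g \<inter> \<Union>(k_edges S k)) \<le> (\<Sum>U\<in>F. card (zero_set g \<inter> U))"
    using card_UN_le[OF F(1), of "\<lambda>U. zero_set g \<inter> U"] by (simp only:)
  also have "\<dots> \<le> of_nat (card F) * total_degree g"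
    using U by (rule sum_bounded_above)
  also have "\<dots> \<le> card S * total_degree g"
    using F(2) k S by (intro mult_right_mono) auto
  finally show ?thesis .
qed

lemma card_irreducible_curve:
  assumes g: "irreducible g" "nonsingular g" and k: "k \<le> card S - 2" and S: "3 \<le> card S"
    and fin: "finite (zero_set g \<inter> \<Union>(k_edges S k))"
  shows "card (zero_set g \<inter> \<Union>(k_edges S k)) \<le> 13 * card S * total_degree g ^ 2"
proof (cases "degree g = 0")
  case True
  have "g \<noteq> 0"
    using g(1) by auto
  then have "card (zero_set g \<inter> \<Union>(k_edges S k)) \<le> card S * total_degree g"
    using True k S by (intro card_vertical_curve) auto
  also have "\<dots> \<le> 13 * card S * total_degree g ^ 2"
    by (simp add: power2_eq_square)
  finally show ?thesis .
next
  case False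
  define d where "d = total_degree g"
  define X where "X = zero_set g \<inter> \<Union>(k_edges S k)"
  obtain \<Sigma> B where \<Sigma>: "finite \<Sigma>" "card \<Sigma> \<le> 4 * d ^ 2" "zero_set g \<subseteq> \<Sigma> \<union> B 1 \<union> B (- 1)"
    and B: "\<And>s P. \<lbrakk>s = 1 \<or> s = - 1; P \<subseteq> B s; finite P; inj_on fst P; no_three_on_arc g s P\<rbrakk> \<Longrightarrow> card P \<le> 10 * d ^ 2"
    using curve_decomposition[OF g] False unfolding d_def by blast
  have one_side: "card (X \<inter> B s) \<le> card F * (10 * d ^ 2)"
    if s: "s = 1 \<or> s = - 1" and F: "finite F" "\<Union>F = \<Union>(k_edges S k)"
      "\<And>U. U \<in> F \<Longrightarrow> inj_on fst U \<and> contains_graphs s U" for s F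
  proof -
    have U: "card (X \<inter> B s \<inter> U) \<le> 10 * d ^ 2" if "U \<in> F" for U
    proof (rule B[OF s])
      show "finite (X \<inter> B s \<inter> U)"
        using fin by (simp add: X_def)
      show "inj_on fst (X \<inter> B s \<inter> U)"
        using F(3)[OF that] by (meson Int_lower2 inj_on_subset)
      have "U \<subseteq> \<Union>(k_edges S k)"
        using that F(2) by blast
      then have "zero_set g \<inter> U \<subseteq> zero_set g \<inter> \<Union>(k_edges S k)"
        by blast
      then have "finite (zero_set g \<inter> U)"
        using fin by (rule finite_subset)
      then show "no_three_on_arc g s (X \<inter> B s \<inter> U)"
        using F(3)[OF that] by (intro contains_graphs_imp_no_three_on_arc) auto
    qed auto
    have "X \<inter> B s = (\<Union>U\<in>F. X \<inter> B s \<inter> U)"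
      using F(2) by (auto simp: X_def)
    then have "card (X \<inter> B s) \<le> (\<Sum>U\<in>F. card (X \<inter> B s \<inter> U))"
      using card_UN_le[OF F(1)] by metis
    also have "\<dots> \<le> of_nat (card F) * (10 * d ^ 2)"
      using U by (rule sum_bounded_above)
    finally show ?thesis
      by simp
  qed
  obtain F1 where F1: "finite F1" "card F1 \<le> k + 1" "\<Union>F1 = \<Union>(k_edges S k)"
    "\<And>U. U \<in> F1 \<Longrightarrow> inj_on fst U \<and> contains_graphs (- 1) U"
    using cover_by_convex_chains by blast
  obtain F2 where F2: "finite F2" "card F2 \<le> card S - 2 - k + 1" "\<Union>F2 = \<Union>(k_edges S k)"
    "\<And>U. U \<in> F2 \<Longrightarrow> inj_on fst U \<and> contains_graphs 1 U"
    using cover_by_concave_chains[OF k] by blast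
  have "finite X"
    using fin by (simp add: X_def)
  have "X \<subseteq> \<Sigma> \<union> (X \<inter> B 1 \<union> X \<inter> B (- 1))"
    using \<Sigma>(3) by (auto simp: X_def)
  then have "card X \<le> card (\<Sigma> \<union> (X \<inter> B 1 \<union> X \<inter> B (- 1)))"
    using \<Sigma>(1) \<open>finite X\<close> by (intro card_mono) auto
  also have "\<dots> \<le> card \<Sigma> + (card (X \<inter> B 1) + card (X \<inter> B (- 1)))"
    by (meson add_left_mono card_Un_le le_trans)
  \<comment> \<open>Convex arcs are counted against the concave chains \<open>F2\<close>, concave
    arcs against the convex chains \<open>F1\<close>.\<close>
  also have "\<dots> \<le> 4 * d ^ 2 + (card F2 * (10 * d ^ 2) + card F1 * (10 * d ^ 2))"
    using \<Sigma>(2) one_side[of 1 F2] one_side[of "- 1" F1] F1 F2 by (intro add_mono) auto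
  also have "\<dots> = 4 * d ^ 2 + (card F2 + card F1) * (10 * d ^ 2)"
    by (simp add: add_mult_distrib)
  \<comment> \<open>There are at most (k + 1) + (n - k - 1) = n chains in all, and
    \<open>4 \<le> 3 * card S\<close>.\<close>
  also have "\<dots> \<le> (3 * card S) * d ^ 2 + card S * (10 * d ^ 2)"
    using F1(2) F2(2) k S by (intro add_mono mult_right_mono) auto
  also have "\<dots> = 13 * card S * d ^ 2"
    by simp
  finally show ?thesis
    by (simp add: X_def d_def)
qed

end

text \<open>Total degrees add up over factors and zero sets unite, so the bound passes to products
  by \<open>a^2 + b^2 \<le> (a + b)^2\<close>.\<close>

lemma card_zero_set_by_factors:
  fixes f :: "real poly poly"
  assumes "f \<noteq> 0"
    and "\<And>g. irreducible g \<Longrightarrow> g dvd f \<Longrightarrow> finite (zero_set g \<inter> X) \<and> card (zero_set g \<inter> X) \<le> c * total_degree g ^ 2"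
  shows "finite (zero_set f \<inter> X) \<and> card (zero_set f \<inter> X) \<le> c * total_degree f ^ 2"
  using assms
proof (induction f rule: prime_divisors_induct)
  case (unit f)
  then obtain h where "f * h = 1"
    by (metis dvdE)
  then have "eval2 f p * eval2 h p = 1" for p
    by (metis eval2_mult eval2_def poly_1)
  then have "zero_set f = {}"
    unfolding zero_set_def by (metis (mono_tags, lifting) empty_Collect_eq mult_zero_left zero_neq_one)
  then show ?case
    by simp
next
  case (factor g f)
  have f: "f \<noteq> 0" "g \<noteq> 0"
    using factor.prems by auto
  have IH: "finite (zero_set f \<inter> X)" "card (zero_set f \<inter> X) \<le> c * total_degree f ^ 2"
    using factor.IH[OF f(1)] factor.prems(2) by auto
  have "irreducible g"
    using factor.hyps by (intro prime_elem_imp_irreducible) auto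
  then have g: "finite (zero_set g \<inter> X)" "card (zero_set g \<inter> X) \<le> c * total_degree g ^ 2"
    using factor.prems(2)[of g] by auto
  have eq: "zero_set (g * f) \<inter> X = (zero_set g \<inter> X) \<union> (zero_set f \<inter> X)"
    by (auto simp: zero_set_def eval2_mult)
  have "card (zero_set (g * f) \<inter> X) \<le> c * total_degree g ^ 2 + c * total_degree f ^ 2"
    unfolding eq using card_Un_le[of "zero_set g \<inter> X" "zero_set f \<inter> X"] g(2) IH(2) by linarith
  also have "\<dots> \<le> c * total_degree (g * f) ^ 2"
    unfolding total_degree_mult[OF f(2,1)] by (simp add: power2_eq_square algebra_simps)
  finally show ?case
    using eq g(1) IH(1) by simp
qed simp

theorem lemma3p11:
  fixes S :: "point set" and n k r :: nat and f :: "real poly poly"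
  assumes "finite S" and "card S = n"
    and "general_position S"
    and "no_vertical_line S"
    and "k \<le> n - 2"
    and "total_degree f = r"
    and "\<And>g. irreducible g \<Longrightarrow> g dvd f \<Longrightarrow> nonsingular g"
    and "S \<inter> zero_set f = {}"
    and "finite (intersection_points f (k_edge_graph S k))"
  shows "card (intersection_points f (k_edge_graph S k)) \<le> 13 * n * r ^ 2"
proof -
  interpret planar_points S
    using assms by unfold_locales
  have S: "3 \<le> card S"
    using assms(1,3) by (simp add: general_position_def)
  have X: "intersection_points f (k_edge_graph S k) = zero_set f \<inter> \<Union>(k_edges S k)"
    by (simp add: intersection_points_def k_edge_graph_def)
  \<comment> \<open>The zero polynomial would vanish on \<open>S\<close>, which is nonempty.\<close>
  have "f \<noteq> 0"
    using assms(8) S by (auto simp: zero_set_def)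
  moreover have "finite (zero_set g \<inter> \<Union>(k_edges S k)) \<and>
      card (zero_set g \<inter> \<Union>(k_edges S k)) \<le> (13 * n) * total_degree g ^ 2"
    if g: "irreducible g" "g dvd f" for g
  proof -
    have "zero_set g \<subseteq> zero_set f"
      using g(2) by (auto simp: zero_set_def eval2_mult elim!: dvdE)
    then have "zero_set g \<inter> \<Union>(k_edges S k) \<subseteq> zero_set f \<inter> \<Union>(k_edges S k)"
      by blast
    then have "finite (zero_set g \<inter> \<Union>(k_edges S k))"
      using assms(9) unfolding X by (rule finite_subset)
    then show ?thesis
      using card_irreducible_curve[OF g(1) assms(7)[OF g] _ S] assms(2,5) by auto
  qed
  ultimately show ?thesis
    unfolding X using card_zero_set_by_factors[of f "\<Union>(k_edges S k)" "13 * n"] assms(6) by blast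
qed

end
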